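(* Let $n\ge 1$, let $\Omega\subset\mathbb{R}^n$ be a bounded Lipschitz domain with $\operatorname{meas}(\Omega)=1$, let $s\in(0,1)$, and let $q>2$ be admissible for $(n,s)$. For $\varepsilon>0$ let $\mathcal{I}^{\varepsilon}_{s,q}$ be the functional defined in the context, and put $\varepsilon_s(q):=\left(\lambda_1^s/(q-2)\right)^{1/(2s)}$ for $q<\infty$, where $\lambda_1$ is the first nonzero eigenvalue of the Neumann Laplacian in $\Omega$, and $\varepsilon_s(\infty):=0$. 1. If $\varepsilon>\varepsilon_s(q)$, then the constant function $\mathbf{1}$ is not a local minimizer of $\mathcal{I}^{\varepsilon}_{s,q}$ (consequently, it is not a global minimizer). This includes the case $q=\infty$ (when $q=\infty$ is admissible). 2. If $q<\infty$ and $0<\varepsilon<\varepsilon_s(q)$, then the constant function $\mathbf{1}$ is a local minimizer of $\mathcal{I}^{\varepsilon}_{s,q}$. 3. Let $q<\infty$ and suppose $\int_\Omega \phi_1^3\,dx\neq 0$, where $\phi_1$ is an $L_2(\Omega)$-normalized Neumann eigenfunction corresponding to $\lambda_1$. Then for $\varepsilon=\varepsilon_s(q)$ the constant function $\mathbf{1}$ is not a local minimizer of $\mathcal{I}^{\varepsilon}_{s,q}$. Moreover, there exists $\breve{\varepsilon}(q)<\varepsilon_s(q)$ such that for every $\varepsilon>0$ with $\breve{\varepsilon}(q)<\varepsilon\le\varepsilon_s(q)$ the constant function $\mathbf{1}$ is not a global minimizer of $\mathcal{I}^{\varepsilon}_{s,q}$ (although for $\varepsilon<\varepsilon_s(q)$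 it is a local minimizer).
   Context: All functions are real-valued. A domain is a connected open set. Let $0=\lambda_0<\lambda_1\le\lambda_2\le\dots$ be the eigenvalues of the Neumann Laplacian in $\Omega$ (repeated according to multiplicity), with eigenfunctions $\phi_0,\phi_1,\phi_2,\dots$ forming an orthonormal basis of $L_2(\Omega)$; $\phi_0$ is constant. The quadratic form of the spectral Neumann fractional Laplacian is $$\langle(-\Delta)^s_{Sp}u,u\rangle:=\sum_{j=1}^\infty \lambda_j^s\,(u,\phi_j)_{L_2(\Omega)}^2 .$$ Its domain, i.e. the set of $u\in L_2(\Omega)$ for which this sum is finite, coincides with the Sobolev--Slobodetskii space $\mathcal{H}^s(\Omega)$, which is equipped with the norm $\|u\|^2_{\mathcal{H}^s(\Omega)}:=\langle(-\Delta)^s_{Sp}u,u\rangle+\|u\|^2_{L_2(\Omega)}$ (equivalent to the standard one). Admissible exponents: $q\in[1,2^*_s]$ with $2^*_s:=2n/(n-2s)$ if $n\ge2$, or if $n=1$ and $s<\tfrac12$; $q\in[1,\infty)$ if $n=1$, $s=\tfrac12$; $q\in[1,\infty]$ if $n=1$, $s>\tfrac12$. For admissible $q$ the embedding $\mathcal{H}^s(\Omega)\hookrightarrow L_q(\Omega)$ is continuous. For $\varepsilon>0$ and $u\in\mathcal{H}^s(\Omega)$, $u\ne0$, $$\mathcal{I}^{\varepsilon}_{s,q}[u]:=\frac{\langle(-\Delta)^s_{Sp}u,u\rangle+\varepsilon^{2s}\|u\|^2_{L_2(\Omega)}}{\|u\|^2_{L_q(\Omega)}} .$$ (Up to a power of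 $\varepsilon$, this is the quotient $\|\cdot\|^2_{\mathcal{H}^s}/\|\cdot\|^2_{L_q}$ on the dilated domain $\varepsilon\Omega$.) The function $\mathbf{1}$ is identically equal to one, and $\mathcal{I}^{\varepsilon}_{s,q}[\mathbf{1}]=\varepsilon^{2s}$. A function $v$ is a global minimizer of $\mathcal{I}^{\varepsilon}_{s,q}$ if $\mathcal{I}^{\varepsilon}_{s,q}[v]\le\mathcal{I}^{\varepsilon}_{s,q}[u]$ for all nonzero $u\in\mathcal{H}^s(\Omega)$, and a local minimizer if this inequality holds for all $u$ in some neighbourhood of $v$ in the norm of $\mathcal{H}^s(\Omega)$. *)

theory Defs
  imports "HOL-Analysis.Analysis" "HOL-Probability.Essential_Supremum"
begin

text \<open>Lipschitz domains: open connected sets which, near each boundary point, lie strictly above the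
  graph of a Lipschitz function \<open>g\<close> over the hyperplane orthogonal to a unit vector \<open>e\<close>.
  In dimension one the hyperplane is \<open>{0}\<close>, so the set is locally a half-line.\<close>

definition lipschitz_domain :: "'a::euclidean_space set \<Rightarrow> bool" where
  "lipschitz_domain \<Omega> \<longleftrightarrow> open \<Omega> \<and> connected \<Omega> \<and>
    (\<forall>p\<in>frontier \<Omega>. \<exists>e g L r. norm e = 1 \<and> L-lipschitz_on {y. y \<bullet> e = 0} g \<and> 0 < r \<and>
      \<Omega> \<inter> ball p r = {x \<in> ball p r. g (x - (x \<bullet> e) *\<^sub>R e) < x \<bullet> e})"

text \<open>Functions on \<open>\<Omega>\<close> are represented by functions on the whole space; only their values almost
  everywhere on \<open>\<Omega>\<close> matter.\<close>

definition L2 :: "'a::euclidean_space set \<Rightarrow> ('a \<Rightarrow> real) set" where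
  "L2 \<Omega> = {u \<in> borel_measurable (lebesgue_on \<Omega>). integrable (lebesgue_on \<Omega>) (\<lambda>x. (u x)\<^sup>2)}"

definition L2_inner :: "'a::euclidean_space set \<Rightarrow> ('a \<Rightarrow> real) \<Rightarrow> ('a \<Rightarrow> real) \<Rightarrow> real" where
  "L2_inner \<Omega> u v = (LINT x|lebesgue_on \<Omega>. u x * v x)"

definition L2_norm :: "'a::euclidean_space set \<Rightarrow> ('a \<Rightarrow> real) \<Rightarrow> real" where
  "L2_norm \<Omega> u = sqrt (L2_inner \<Omega> u u)"

definition ae_zero :: "'a::euclidean_space set \<Rightarrow> ('a \<Rightarrow> real) \<Rightarrow> bool" where
  "ae_zero \<Omega> u \<longleftrightarrow> (AE x in lebesgue_on \<Omega>. u x = 0)"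

definition orthonormal_basis_L2 :: "'a::euclidean_space set \<Rightarrow> (nat \<Rightarrow> 'a \<Rightarrow> real) \<Rightarrow> bool" where
  "orthonormal_basis_L2 \<Omega> \<phi> \<longleftrightarrow> (\<forall>j. \<phi> j \<in> L2 \<Omega>) \<and>
    (\<forall>j k. L2_inner \<Omega> (\<phi> j) (\<phi> k) = (if j = k then 1 else 0)) \<and>
    (\<forall>u\<in>L2 \<Omega>. (\<lambda>N. L2_norm \<Omega> (\<lambda>x. u x - (\<Sum>j<N. L2_inner \<Omega> u (\<phi> j) * \<phi> j x))) \<longlonglongrightarrow> 0)"

text \<open>The pair \<open>\<psi>, g\<close> is a continuously differentiable function together with its gradient, with
  compact support in \<open>\<Omega>\<close>.\<close>

definition C1_test :: "'a::euclidean_space set \<Rightarrow> ('a \<Rightarrow> real) \<Rightarrow> ('a \<Rightarrow> 'a) \<Rightarrow> bool" where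
  "C1_test \<Omega> \<psi> g \<longleftrightarrow> (\<forall>x. GDERIV \<psi> x :> g x) \<and> continuous_on UNIV g \<and>
    compact (closure {x. \<psi> x \<noteq> 0}) \<and> closure {x. \<psi> x \<noteq> 0} \<subseteq> \<Omega>"

text \<open>Membership of \<open>u\<close> in the Sobolev space of square integrable functions with square integrable
  weak gradient \<open>G\<close>.  Testing with compactly supported continuously differentiable functions is
  the usual convention for first-order weak derivatives.\<close>

definition has_weak_gradient ::
    "'a::euclidean_space set \<Rightarrow> ('a \<Rightarrow> real) \<Rightarrow> ('a \<Rightarrow> 'a) \<Rightarrow> bool" where
  "has_weak_gradient \<Omega> u G \<longleftrightarrow> u \<in> L2 \<Omega> \<and>
    G \<in> borel_measurable (lebesgue_on \<Omega>) \<and>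
    integrable (lebesgue_on \<Omega>) (\<lambda>x. (norm (G x))\<^sup>2) \<and>
    (\<forall>\<psi> g. C1_test \<Omega> \<psi> g \<longrightarrow>
      (LINT x|lebesgue_on \<Omega>. u x *\<^sub>R g x) = - (LINT x|lebesgue_on \<Omega>. \<psi> x *\<^sub>R G x))"

text \<open>The Neumann Laplacian is the self-adjoint operator generated by the Dirichlet form on the full
  first-order Sobolev space; the Neumann condition is encoded by letting the test function \<open>v\<close>
  range over that whole space.\<close>

definition neumann_eigenfunction ::
    "'a::euclidean_space set \<Rightarrow> real \<Rightarrow> ('a \<Rightarrow> real) \<Rightarrow> bool" where
  "neumann_eigenfunction \<Omega> \<mu> \<phi> \<longleftrightarrow> \<not> ae_zero \<Omega> \<phi> \<and>
    (\<exists>G. has_weak_gradient \<Omega> \<phi> G \<and>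
      (\<forall>v H. has_weak_gradient \<Omega> v H \<longrightarrow>
        (LINT x|lebesgue_on \<Omega>. G x \<bullet> H x) = \<mu> * L2_inner \<Omega> \<phi> v))"

text \<open>Since the eigenfunctions form an orthonormal basis, every eigenvalue is listed according to its
  multiplicity.\<close>

definition neumann_eigensystem ::
    "'a::euclidean_space set \<Rightarrow> (nat \<Rightarrow> real) \<Rightarrow> (nat \<Rightarrow> 'a \<Rightarrow> real) \<Rightarrow> bool" where
  "neumann_eigensystem \<Omega> lam \<phi> \<longleftrightarrow>
    lam 0 = 0 \<and> 0 < lam 1 \<and> mono lam \<and>
    (\<forall>j. neumann_eigenfunction \<Omega> (lam j) (\<phi> j)) \<and> orthonormal_basis_L2 \<Omega> \<phi>"

definition spectral_form ::
    "'a::euclidean_space set \<Rightarrow> (nat \<Rightarrow> real) \<Rightarrow> (nat \<Rightarrow> 'a \<Rightarrow> real) \<Rightarrow> real \<Rightarrow> ('a \<Rightarrow> real) \<Rightarrow> real" where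
  "spectral_form \<Omega> lam \<phi> s u = (\<Sum>j. lam (Suc j) powr s * (L2_inner \<Omega> u (\<phi> (Suc j)))\<^sup>2)"

definition Hs ::
    "'a::euclidean_space set \<Rightarrow> (nat \<Rightarrow> real) \<Rightarrow> (nat \<Rightarrow> 'a \<Rightarrow> real) \<Rightarrow> real \<Rightarrow> ('a \<Rightarrow> real) set" where
  "Hs \<Omega> lam \<phi> s =
    {u \<in> L2 \<Omega>. summable (\<lambda>j. lam (Suc j) powr s * (L2_inner \<Omega> u (\<phi> (Suc j)))\<^sup>2)}"

definition Hs_norm ::
    "'a::euclidean_space set \<Rightarrow> (nat \<Rightarrow> real) \<Rightarrow> (nat \<Rightarrow> 'a \<Rightarrow> real) \<Rightarrow> real \<Rightarrow> ('a \<Rightarrow> real) \<Rightarrow> real" where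
  "Hs_norm \<Omega> lam \<phi> s u = sqrt (spectral_form \<Omega> lam \<phi> s u + (L2_norm \<Omega> u)\<^sup>2)"

definition admissible :: "nat \<Rightarrow> real \<Rightarrow> ereal \<Rightarrow> bool" where
  "admissible n s q \<longleftrightarrow> 1 \<le> q \<and>
    (if n \<ge> 2 \<or> s < 1/2 then q \<le> ereal (2 * real n / (real n - 2 * s))
     else if s = 1/2 then q < \<infinity> else True)"

text \<open>The value is meaningful for functions with finite norm, in particular, by the Sobolev
  embedding, on \<open>Hs\<close> for admissible \<open>q\<close>.\<close>

definition Lq_norm :: "'a::euclidean_space set \<Rightarrow> ereal \<Rightarrow> ('a \<Rightarrow> real) \<Rightarrow> real" where
  "Lq_norm \<Omega> q u =
    (if q = \<infinity> then real_of_ereal (esssup (lebesgue_on \<Omega>) (\<lambda>x. ereal \<bar>u x\<bar>))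
     else (LINT x|lebesgue_on \<Omega>. \<bar>u x\<bar> powr real_of_ereal q) powr (1 / real_of_ereal q))"

definition I_quot ::
    "'a::euclidean_space set \<Rightarrow> (nat \<Rightarrow> real) \<Rightarrow> (nat \<Rightarrow> 'a \<Rightarrow> real) \<Rightarrow> real \<Rightarrow> ereal \<Rightarrow> real
      \<Rightarrow> ('a \<Rightarrow> real) \<Rightarrow> real" where
  "I_quot \<Omega> lam \<phi> s q \<epsilon> u =
    (spectral_form \<Omega> lam \<phi> s u + \<epsilon> powr (2 * s) * (L2_norm \<Omega> u)\<^sup>2) / (Lq_norm \<Omega> q u)\<^sup>2"

definition global_minimizer ::
    "'a::euclidean_space set \<Rightarrow> (nat \<Rightarrow> real) \<Rightarrow> (nat \<Rightarrow> 'a \<Rightarrow> real) \<Rightarrow> real \<Rightarrow> ereal \<Rightarrow> real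
      \<Rightarrow> ('a \<Rightarrow> real) \<Rightarrow> bool" where
  "global_minimizer \<Omega> lam \<phi> s q \<epsilon> v \<longleftrightarrow> v \<in> Hs \<Omega> lam \<phi> s \<and> \<not> ae_zero \<Omega> v \<and>
    (\<forall>u\<in>Hs \<Omega> lam \<phi> s. \<not> ae_zero \<Omega> u \<longrightarrow> I_quot \<Omega> lam \<phi> s q \<epsilon> v \<le> I_quot \<Omega> lam \<phi> s q \<epsilon> u)"

definition local_minimizer ::
    "'a::euclidean_space set \<Rightarrow> (nat \<Rightarrow> real) \<Rightarrow> (nat \<Rightarrow> 'a \<Rightarrow> real) \<Rightarrow> real \<Rightarrow> ereal \<Rightarrow> real
      \<Rightarrow> ('a \<Rightarrow> real) \<Rightarrow> bool" where
  "local_minimizer \<Omega> lam \<phi> s q \<epsilon> v \<longleftrightarrow> v \<in> Hs \<Omega> lam \<phi> s \<and> \<not> ae_zero \<Omega> v \<and>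
    (\<exists>\<delta>>0. \<forall>u\<in>Hs \<Omega> lam \<phi> s. \<not> ae_zero \<Omega> u \<longrightarrow> Hs_norm \<Omega> lam \<phi> s (\<lambda>x. u x - v x) < \<delta> \<longrightarrow>
      I_quot \<Omega> lam \<phi> s q \<epsilon> v \<le> I_quot \<Omega> lam \<phi> s q \<epsilon> u)"

text \<open>Here \<open>lam1\<close> is the first nonzero Neumann eigenvalue.\<close>

definition eps_crit :: "real \<Rightarrow> real \<Rightarrow> ereal \<Rightarrow> real" where
  "eps_crit lam1 s q =
    (if q = \<infinity> then 0 else (lam1 powr s / (real_of_ereal q - 2)) powr (1 / (2 * s)))"

end

theory Submission
  imports Defs
begin

text \<open>Expanding \<open>\<bar>1 + w\<bar> powr q\<close> around the constant reduces the statement to the sign of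
  \<open>q - 2 - \<lambda>\<^sub>1 powr s / \<epsilon> powr (2 * s)\<close>, and in the critical case to the cubic term.  Below the critical
  value the remainder must be dominated by the form, which requires the critical embedding of the
  spectral space into \<open>L\<^sub>q\<close>.

  For the embedding, let \<open>T\<^sub>r\<close> average a function over a ball of radius comparable to \<open>r\<close> inside a cone
  contained in the domain.  Since \<open>\<partial>\<^sub>r T\<^sub>r v\<close> is an average of the weak gradient, splitting a combination
  of eigenfunctions at the frequency \<open>r powr (-2)\<close> controls both the error \<open>u - T\<^sub>r u\<close> in \<open>L\<^sub>2\<close> and
  \<open>T\<^sub>r u\<close> uniformly by spectral quantities.  Estimating each level set of \<open>u\<close> by the error at
  the scale for which \<open>T\<^sub>r u\<close> stays below half the level gives the critical exponent in every dimension,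
  without a Sobolev inequality for first-order spaces and without heat kernel bounds.\<close>

section \<open>Square integrable functions and averages over balls\<close>

text \<open>The fractional space is known only through eigenvalues and coefficients, so every
  estimate rests on what these data provide: the gradients of the eigenfunctions are orthogonal,
  with squared norms \<open>lam j\<close>. Measuring low modes by r times their gradient and high
  modes by their own norm gives the exact cost sum c_j^2 min(1, r^2 lam_j) at scale r. Summed with
  weights 4^(s k) over the scales h / 2^k it returns lam_j^s for each mode; a bound taken scale by
  scale would lose a divergent factor and with it the endpoint. Smaller exponents reduce to an
  endpoint, since q is critical for the order n (1/2 - 1/q). Homogeneity of the quotient allows the
  normal form u = a (1 + w) with w of mean zero, and comparison with the constant means comparing
  the integral of |u|^q with (|u|_2^2 + form / epsilon^(2 s))^(q/2). Lower bounds of that integral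
  use only the positive part of the Taylor defect and so work with integrability of |w|^2 or |w|^3;
  upper bounds produce a term |w|^q, and there the norm inequality of the embedding enters.\<close>

lemma ident_borel_measurable_lebesgue_on [measurable]:
  "(\<lambda>x::'a::euclidean_space. x) \<in> borel_measurable (lebesgue_on S)"
  by (intro measurable_restrict_space1 measurable_completion) simp

locale bounded_open_set =
  fixes \<Omega> :: "'a::euclidean_space set"
  assumes open_dom: "open \<Omega>" and bounded_dom: "bounded \<Omega>"
begin

abbreviation "M \<equiv> lebesgue_on \<Omega>"

lemma lmeasurable_dom: "\<Omega> \<in> lmeasurable"
  using open_dom bounded_dom by (simp add: lmeasurable_open)

lemma sets_dom [measurable, simp]: "\<Omega> \<in> sets lebesgue"
  using lmeasurable_dom by blast

sublocale finite_measure M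
  using lmeasurable_dom by (rule finite_measure_lebesgue_on)

sublocale MM: pair_sigma_finite M M ..

lemma continuous_measurable:
  fixes f :: "'a \<Rightarrow> 'b::{second_countable_topology, t2_space}"
  assumes "continuous_on UNIV f"
  shows "f \<in> borel_measurable M"
  using measurable_compose[OF ident_borel_measurable_lebesgue_on borel_measurable_continuous_onI[OF assms]]
  by simp

lemma L2_measurable: "u \<in> L2 \<Omega> \<Longrightarrow> u \<in> borel_measurable M"
  by (simp add: L2_def)

lemma L2_square_integrable: "u \<in> L2 \<Omega> \<Longrightarrow> integrable M (\<lambda>x. (u x)\<^sup>2)"
  by (simp add: L2_def)

lemma L2_mult_integrable:
  assumes "u \<in> L2 \<Omega>" "v \<in> L2 \<Omega>"
  shows "integrable M (\<lambda>x. u x * v x)"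
proof (rule Bochner_Integration.integrable_bound)
  show "integrable M (\<lambda>x. (u x)\<^sup>2 + (v x)\<^sup>2)"
    using assms by (auto simp: L2_def)
  show "(\<lambda>x. u x * v x) \<in> borel_measurable M"
    using assms by (auto simp: L2_def)
  have "\<bar>a * b\<bar> \<le> a\<^sup>2 + b\<^sup>2" for a b :: real
    using sum_squares_bound[of "\<bar>a\<bar>" "\<bar>b\<bar>"] by (auto simp: abs_mult intro: order_trans[rotated])
  then show "AE x in M. norm (u x * v x) \<le> norm ((u x)\<^sup>2 + (v x)\<^sup>2)"
    by auto
qed

lemma L2_const: "(\<lambda>x. c) \<in> L2 \<Omega>"
  by (simp add: L2_def)

lemma L2_integrable: "u \<in> L2 \<Omega> \<Longrightarrow> integrable M u"
  using L2_mult_integrable[OF _ L2_const, of u 1] by simp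

lemma L2_cmult: "u \<in> L2 \<Omega> \<Longrightarrow> (\<lambda>x. c * u x) \<in> L2 \<Omega>"
  by (auto simp: L2_def power_mult_distrib)

lemma L2_add:
  assumes "u \<in> L2 \<Omega>" "v \<in> L2 \<Omega>"
  shows "(\<lambda>x. u x + v x) \<in> L2 \<Omega>"
proof -
  have "integrable M (\<lambda>x. (u x)\<^sup>2 + (v x)\<^sup>2 + 2 * (u x * v x))"
    using assms L2_mult_integrable[OF assms] by (auto simp: L2_def)
  then show ?thesis
    using assms by (auto simp: L2_def power2_sum mult.assoc)
qed

lemma L2_diff: "u \<in> L2 \<Omega> \<Longrightarrow> v \<in> L2 \<Omega> \<Longrightarrow> (\<lambda>x. u x - v x) \<in> L2 \<Omega>"
  using L2_add[of u "\<lambda>x. (-1) * v x"] L2_cmult[of v "-1"] by simp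

lemma L2_sum: "(\<And>j. j \<in> J \<Longrightarrow> f j \<in> L2 \<Omega>) \<Longrightarrow> (\<lambda>x. \<Sum>j\<in>J. f j x) \<in> L2 \<Omega>"
proof (induction J rule: infinite_finite_induct)
  case (insert j J)
  then show ?case using L2_add[of "f j" "\<lambda>x. \<Sum>j\<in>J. f j x"] by auto
qed (auto simp: L2_const)

lemma L2_inner_commute: "L2_inner \<Omega> u v = L2_inner \<Omega> v u"
  by (simp add: L2_inner_def mult.commute)

lemma L2_inner_add: "u \<in> L2 \<Omega> \<Longrightarrow> v \<in> L2 \<Omega> \<Longrightarrow> w \<in> L2 \<Omega> \<Longrightarrow>
    L2_inner \<Omega> (\<lambda>x. u x + v x) w = L2_inner \<Omega> u w + L2_inner \<Omega> v w"
  by (simp add: L2_inner_def distrib_right L2_mult_integrable)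

lemma L2_inner_cmult: "L2_inner \<Omega> (\<lambda>x. c * u x) w = c * L2_inner \<Omega> u w"
  by (simp add: L2_inner_def mult.assoc)

lemma L2_inner_diff: "u \<in> L2 \<Omega> \<Longrightarrow> v \<in> L2 \<Omega> \<Longrightarrow> w \<in> L2 \<Omega> \<Longrightarrow>
    L2_inner \<Omega> (\<lambda>x. u x - v x) w = L2_inner \<Omega> u w - L2_inner \<Omega> v w"
  by (simp add: L2_inner_def left_diff_distrib L2_mult_integrable)

lemma L2_inner_sum:
  assumes "\<And>j. j \<in> J \<Longrightarrow> f j \<in> L2 \<Omega>" "w \<in> L2 \<Omega>"
  shows "L2_inner \<Omega> (\<lambda>x. \<Sum>j\<in>J. f j x) w = (\<Sum>j\<in>J. L2_inner \<Omega> (f j) w)"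
  using assms by (simp add: L2_inner_def sum_distrib_right L2_mult_integrable)

lemma L2_inner_cong_AE:
  assumes "AE x in M. u x = v x" "u \<in> L2 \<Omega>" "v \<in> L2 \<Omega>" "w \<in> L2 \<Omega>"
  shows "L2_inner \<Omega> u w = L2_inner \<Omega> v w"
  unfolding L2_inner_def using assms L2_measurable
  by (intro integral_cong_AE) auto

lemma L2_inner_self: "L2_inner \<Omega> u u = (LINT x|M. (u x)\<^sup>2)"
  by (simp add: L2_inner_def power2_eq_square)

lemma L2_inner_self_nonneg: "0 \<le> L2_inner \<Omega> u u"
  by (simp add: L2_inner_self)

lemma L2_norm_square: "(L2_norm \<Omega> u)\<^sup>2 = L2_inner \<Omega> u u"
  by (simp add: L2_norm_def L2_inner_self_nonneg)

lemma nn_integral_square: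
  "u \<in> L2 \<Omega> \<Longrightarrow> (\<integral>\<^sup>+x. ennreal ((u x)\<^sup>2) \<partial>M) = ennreal (L2_inner \<Omega> u u)"
  by (simp add: L2_inner_self nn_integral_eq_integral L2_square_integrable)

section \<open>Integrals over balls and their mean-square bounds\<close>

lemma pair_measurable_kernel:
  fixes k :: "'a \<times> 'a \<Rightarrow> 'b::{second_countable_topology, t2_space}"
  assumes "k \<in> borel_measurable borel"
  shows "k \<in> borel_measurable (M \<Otimes>\<^sub>M M)"
proof -
  have "(\<lambda>p. (fst p, snd p)) \<in> borel_measurable (M \<Otimes>\<^sub>M M)"
    by (rule borel_measurable_Pair) measurable
  then show ?thesis
    using measurable_compose[of "\<lambda>p. (fst p, snd p)" "M \<Otimes>\<^sub>M M" borel k borel] assms by simp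
qed

text \<open>Unnormalised and with values in \<open>ennreal\<close>, so that Tonelli and
  Cauchy-Schwarz apply before any integrability is known. Points of the ball outside the domain
  contribute nothing, because the measure is restricted to it.\<close>

definition ball_int :: "real \<Rightarrow> ('a \<Rightarrow> ennreal) \<Rightarrow> 'a \<Rightarrow> ennreal" where
  "ball_int \<rho> f x = (\<integral>\<^sup>+y. indicator (ball x \<rho>) y * f y \<partial>M)"

lemma ball_pair_measurable:
  "(\<lambda>p. indicator (ball (fst p) \<rho>) (snd p) :: ennreal) \<in> borel_measurable (M \<Otimes>\<^sub>M M)"
proof (rule pair_measurable_kernel)
  have "open {p::'a \<times> 'a. dist (fst p) (snd p) < \<rho>}"
    by (intro open_Collect_less continuous_intros)
  then have "(indicator {p::'a \<times> 'a. dist (fst p) (snd p) < \<rho>} :: _ \<Rightarrow> ennreal) \<in> borel_measurable borel"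
    by (intro borel_measurable_indicator) auto
  also have "indicator {p::'a \<times> 'a. dist (fst p) (snd p) < \<rho>}
      = (\<lambda>p. indicator (ball (fst p) \<rho>) (snd p) :: ennreal)"
    by (auto simp: fun_eq_iff indicator_def)
  finally show "(\<lambda>p::'a\<times>'a. indicator (ball (fst p) \<rho>) (snd p) :: ennreal) \<in> borel_measurable borel" .
qed

lemma ball_int_measurable:
  assumes "f \<in> borel_measurable M"
  shows "ball_int \<rho> f \<in> borel_measurable M"
proof -
  note [measurable] = ball_pair_measurable assms
  have "(\<lambda>p. indicator (ball (fst p) \<rho>) (snd p) * f (snd p)) \<in> borel_measurable (M \<Otimes>\<^sub>M M)"
    by measurable
  from borel_measurable_nn_integral_fst[OF this] show ?thesis
    by (simp add: ball_int_def[abs_def])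
qed

lemma emeasure_ball_le: 
  assumes "0 \<le> \<rho>"
  shows "emeasure M (ball x \<rho> \<inter> \<Omega>) \<le> ennreal (unit_ball_vol DIM('a) * \<rho> ^ DIM('a))"
proof -
  have "emeasure M (ball x \<rho> \<inter> \<Omega>) = emeasure lebesgue (ball x \<rho> \<inter> \<Omega>)"
    by (subst emeasure_restrict_space) auto
  also have "\<dots> \<le> emeasure lebesgue (ball x \<rho>)"
    by (intro emeasure_mono) auto
  also have "\<dots> = ennreal (unit_ball_vol DIM('a) * \<rho> ^ DIM('a))"
    using assms by (simp add: emeasure_ball)
  finally show ?thesis .
qed

lemma nn_integral_ball_le:
  assumes "0 \<le> \<rho>"
  shows "(\<integral>\<^sup>+y. indicator (ball x \<rho>) y \<partial>M) \<le> ennreal (unit_ball_vol DIM('a) * \<rho> ^ DIM('a))"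
proof -
  have "(\<integral>\<^sup>+y. indicator (ball x \<rho>) y \<partial>M) = (\<integral>\<^sup>+y. indicator (ball x \<rho> \<inter> \<Omega>) y \<partial>M)"
    by (intro nn_integral_cong) (auto simp: indicator_def)
  also have "\<dots> = emeasure M (ball x \<rho> \<inter> \<Omega>)"
    by (intro nn_integral_indicator) (auto simp: sets_restrict_space_iff)
  finally show ?thesis using emeasure_ball_le[OF assms] by simp
qed

lemma ball_borel_measurable [measurable]:
  "(indicator (ball x \<rho>) :: 'a \<Rightarrow> ennreal) \<in> borel_measurable M"
  by (rule measurable_compose[OF ident_borel_measurable_lebesgue_on])
    (simp add: borel_measurable_indicator)

text \<open>Tonelli together with the symmetry of \<open>y \<in> ball x \<rho>\<close> in
  \<open>x\<close> and \<open>y\<close>: this is Young's inequality on L1 for convolution with the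
  indicator of a ball.\<close>

lemma nn_integral_ball_int:
  assumes f: "f \<in> borel_measurable M" and \<rho>: "0 \<le> \<rho>"
  shows "(\<integral>\<^sup>+x. ball_int \<rho> f x \<partial>M)
    \<le> ennreal (unit_ball_vol DIM('a) * \<rho> ^ DIM('a)) * (\<integral>\<^sup>+y. f y \<partial>M)"
proof -
  note [measurable] = ball_pair_measurable f
  have "(\<integral>\<^sup>+x. ball_int \<rho> f x \<partial>M) = (\<integral>\<^sup>+x. \<integral>\<^sup>+y. indicator (ball x \<rho>) y * f y \<partial>M \<partial>M)"
    by (simp add: ball_int_def)
  also have "\<dots> = (\<integral>\<^sup>+y. \<integral>\<^sup>+x. indicator (ball x \<rho>) y * f y \<partial>M \<partial>M)"
    using MM.Fubini'[of "\<lambda>x y. indicator (ball x \<rho>) y * f y"] by (simp add: split_beta')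
  also have "\<dots> = (\<integral>\<^sup>+y. (\<integral>\<^sup>+x. indicator (ball y \<rho>) x \<partial>M) * f y \<partial>M)"
  proof (intro nn_integral_cong)
    fix y
    have "(\<integral>\<^sup>+x. indicator (ball x \<rho>) y * f y \<partial>M) = (\<integral>\<^sup>+x. indicator (ball y \<rho>) x * f y \<partial>M)"
      by (intro nn_integral_cong) (auto simp: indicator_def dist_commute)
    then show "(\<integral>\<^sup>+x. indicator (ball x \<rho>) y * f y \<partial>M) = (\<integral>\<^sup>+x. indicator (ball y \<rho>) x \<partial>M) * f y"
      by (simp add: nn_integral_multc)
  qed
  also have "\<dots> \<le> (\<integral>\<^sup>+y. ennreal (unit_ball_vol DIM('a) * \<rho> ^ DIM('a)) * f y \<partial>M)"
    by (intro nn_integral_mono mult_right_mono nn_integral_ball_le \<rho>) auto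
  also have "\<dots> = ennreal (unit_ball_vol DIM('a) * \<rho> ^ DIM('a)) * (\<integral>\<^sup>+y. f y \<partial>M)"
    by (simp add: nn_integral_cmult)
  finally show ?thesis .
qed

text \<open>Cauchy-Schwarz, applied after writing the indicator as its own square, costs one volume
  of the ball.\<close>

lemma ball_int_square_le:
  assumes f: "f \<in> borel_measurable M" and \<rho>: "0 \<le> \<rho>"
  shows "(ball_int \<rho> f x)\<^sup>2
    \<le> ennreal (unit_ball_vol DIM('a) * \<rho> ^ DIM('a)) * ball_int \<rho> (\<lambda>y. (f y)\<^sup>2) x"
proof -
  note [measurable] = f
  let ?i = "indicator (ball x \<rho>) :: 'a \<Rightarrow> ennreal"
  have "ball_int \<rho> f x = (\<integral>\<^sup>+y. ?i y * (?i y * f y) \<partial>M)"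
    unfolding ball_int_def by (intro nn_integral_cong) (auto simp: indicator_def)
  then have "(ball_int \<rho> f x)\<^sup>2 \<le> (\<integral>\<^sup>+y. (?i y)\<^sup>2 \<partial>M) * (\<integral>\<^sup>+y. (?i y * f y)\<^sup>2 \<partial>M)"
    by (simp add: Cauchy_Schwarz_nn_integral)
  also have "(\<integral>\<^sup>+y. (?i y)\<^sup>2 \<partial>M) = (\<integral>\<^sup>+y. ?i y \<partial>M)"
    by (intro nn_integral_cong) (auto simp: indicator_def)
  also have "(\<integral>\<^sup>+y. (?i y * f y)\<^sup>2 \<partial>M) = ball_int \<rho> (\<lambda>y. (f y)\<^sup>2) x"
    unfolding ball_int_def by (intro nn_integral_cong) (auto simp: indicator_def)
  finally show ?thesis
    by (rule order_trans) (intro mult_right_mono nn_integral_ball_le \<rho>, simp)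
qed

lemma ball_int_le: "ball_int \<rho> f x \<le> (\<integral>\<^sup>+y. f y \<partial>M)"
  unfolding ball_int_def by (intro nn_integral_mono) (auto simp: indicator_def)

text \<open>Pointwise, only one factor of the volume appears, against two in the mean-square bound
  that follows. After the normalisation by \<open>\<rho> ^ DIM('a)\<close> this is the difference
  between a bound growing like \<open>1 / \<rho> ^ DIM('a)\<close> and one independent of the
  radius.\<close>

lemma ball_int_square_sup:
  assumes f: "f \<in> borel_measurable M" and \<rho>: "0 \<le> \<rho>"
  shows "(ball_int \<rho> f x)\<^sup>2
    \<le> ennreal (unit_ball_vol DIM('a) * \<rho> ^ DIM('a)) * (\<integral>\<^sup>+y. (f y)\<^sup>2 \<partial>M)"
  using ball_int_square_le[OF assms, of x] ball_int_le[of \<rho> "\<lambda>y. (f y)\<^sup>2" x]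
  by (meson mult_left_mono order_trans zero_le)

lemma nn_integral_ball_int_square:
  assumes f: "f \<in> borel_measurable M" and \<rho>: "0 \<le> \<rho>"
  shows "(\<integral>\<^sup>+x. (ball_int \<rho> f x)\<^sup>2 \<partial>M)
    \<le> (ennreal (unit_ball_vol DIM('a) * \<rho> ^ DIM('a)))\<^sup>2 * (\<integral>\<^sup>+y. (f y)\<^sup>2 \<partial>M)"
proof -
  note [measurable] = f
  let ?c = "ennreal (unit_ball_vol DIM('a) * \<rho> ^ DIM('a))"
  have [measurable]: "ball_int \<rho> (\<lambda>y. (f y)\<^sup>2) \<in> borel_measurable M"
    by (rule ball_int_measurable) measurable
  have "(\<integral>\<^sup>+x. (ball_int \<rho> f x)\<^sup>2 \<partial>M) \<le> (\<integral>\<^sup>+x. ?c * ball_int \<rho> (\<lambda>y. (f y)\<^sup>2) x \<partial>M)"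
    by (intro nn_integral_mono ball_int_square_le assms)
  also have "\<dots> = ?c * (\<integral>\<^sup>+x. ball_int \<rho> (\<lambda>y. (f y)\<^sup>2) x \<partial>M)"
    by (simp add: nn_integral_cmult)
  also have "\<dots> \<le> ?c * (?c * (\<integral>\<^sup>+y. (f y)\<^sup>2 \<partial>M))"
    by (intro mult_left_mono nn_integral_ball_int \<rho>) auto
  finally show ?thesis by (simp add: power2_eq_square mult.assoc)
qed

lemma dom_norm_bound:
  fixes x :: 'a
  obtains R where "0 < R" "\<And>y. y \<in> \<Omega> \<Longrightarrow> norm (y - x) \<le> R"
proof -
  obtain B where "0 < B" "\<And>y. y \<in> \<Omega> \<Longrightarrow> norm y \<le> B"
    using bounded_dom by (auto simp: bounded_pos)
  then show ?thesis
    by (intro that[of "B + norm x"]) (auto intro: norm_triangle_le_diff add_mono add_pos_nonneg)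
qed

lemma has_weak_gradient_L2: "has_weak_gradient \<Omega> u G \<Longrightarrow> u \<in> L2 \<Omega>"
  by (simp add: has_weak_gradient_def)

lemma norm_gradient_L2: "has_weak_gradient \<Omega> u G \<Longrightarrow> (\<lambda>x. norm (G x)) \<in> L2 \<Omega>"
  by (auto simp: has_weak_gradient_def L2_def)

lemma gradient_integrable: "has_weak_gradient \<Omega> u G \<Longrightarrow> integrable M G"
proof -
  assume G: "has_weak_gradient \<Omega> u G"
  then have "G \<in> borel_measurable M" by (simp add: has_weak_gradient_def)
  from integrable_norm_iff[OF this] L2_integrable[OF norm_gradient_L2[OF G]]
  show "integrable M G" by blast
qed

end

section \<open>Smooth averages over a cone\<close>

text \<open>The mean value inequality turns the bound \<open>g\<close> on the derivatives into a
  bound on all difference quotients, and dominated convergence along sequences gives the limit. It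
  serves twice: for averages as functions of their radius, and for translates of a test
  function.\<close>

lemma has_real_derivative_lebesgue_integral:
  fixes f f' :: "real \<Rightarrow> 'b \<Rightarrow> real"
  assumes d: "0 < d"
    and deriv: "\<And>r y. \<bar>r - r0\<bar> < d \<Longrightarrow> ((\<lambda>r. f r y) has_real_derivative f' r y) (at r)"
    and bound: "\<And>r y. \<bar>r - r0\<bar> < d \<Longrightarrow> \<bar>f' r y\<bar> \<le> g y"
    and g: "integrable M g"
    and f: "\<And>r. \<bar>r - r0\<bar> < d \<Longrightarrow> integrable M (f r)"
    and f': "f' r0 \<in> borel_measurable M"
  shows "((\<lambda>r. LINT y|M. f r y) has_real_derivative (LINT y|M. f' r0 y)) (at r0)"
  unfolding DERIV_def tendsto_at_iff_sequentially
proof (intro allI impI)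
  fix X :: "nat \<Rightarrow> real"
  assume ne: "\<forall>i. X i \<in> UNIV - {0}" and X: "X \<longlonglongrightarrow> 0"
  have "eventually (\<lambda>i. \<bar>X i\<bar> < d) sequentially"
    using X d by (metis tendsto_rabs_zero order_tendstoD(2))
  then obtain N where N: "\<And>i. i \<ge> N \<Longrightarrow> \<bar>X i\<bar> < d"
    by (auto simp: eventually_sequentially)
  let ?q = "\<lambda>i y. (f (r0 + X i) y - f r0 y) / X i"
  \<comment> \<open>Difference quotients are controlled only for increments below \<open>d\<close>,
    so the first \<open>N\<close> terms of the sequence are dropped here and restored at the
    end.\<close>
  have "(\<lambda>i. LINT y|M. ?q (i + N) y) \<longlonglongrightarrow> (LINT y|M. f' r0 y)"
  proof (rule integral_dominated_convergence[where w = g])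
    show "?q (i + N) \<in> borel_measurable M" for i
      using f[of r0] f[of "r0 + X (i + N)"] N[of "i + N"] d
      by (auto dest!: borel_measurable_integrable)
    show "AE y in M. (\<lambda>i. ?q (i + N) y) \<longlonglongrightarrow> f' r0 y"
    proof (rule AE_I2)
      fix y
      have "((\<lambda>h. (f (r0 + h) y - f r0 y) / h) \<longlongrightarrow> f' r0 y) (at 0)"
        using deriv[of r0 y] d by (simp add: DERIV_def)
      then have "(\<lambda>i. ?q i y) \<longlonglongrightarrow> f' r0 y"
        using ne X unfolding tendsto_at_iff_sequentially by (auto simp: comp_def)
      then show "(\<lambda>i. ?q (i + N) y) \<longlonglongrightarrow> f' r0 y"
        by (rule LIMSEQ_ignore_initial_segment)
    qed
    show "AE y in M. norm (?q (i + N) y) \<le> g y" for i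
    proof (rule AE_I2)
      fix y
      let ?x = "X (i + N)"
      have "norm (f (r0 + ?x) y - f r0 y) \<le> g y * norm (r0 + ?x - r0)"
      proof (rule field_differentiable_bound[of "{r. \<bar>r - r0\<bar> < d}"])
        have "{r. \<bar>r - r0\<bar> < d} = ball r0 d"
          by (auto simp: dist_real_def)
        then show "convex {r. \<bar>r - r0\<bar> < d}" by simp
        show "((\<lambda>r. f r y) has_field_derivative f' r y) (at r within {r. \<bar>r - r0\<bar> < d})"
          if "r \<in> {r. \<bar>r - r0\<bar> < d}" for r
          using deriv that by (auto intro: has_field_derivative_at_within)
        show "norm (f' r y) \<le> g y" if "r \<in> {r. \<bar>r - r0\<bar> < d}" for r
          using bound that by auto
      qed (use d N in auto)
      then show "norm (?q (i + N) y) \<le> g y"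
        using ne[rule_format, of "i + N"] by (simp add: divide_le_eq)
    qed
  qed (use f' g in auto)
  moreover have "(LINT y|M. ?q (i + N) y)
      = ((LINT y|M. f (r0 + X (i + N)) y) - (LINT y|M. f r0 y)) / X (i + N)" for i
    using f[of r0] f[of "r0 + X (i + N)"] N[of "i + N"] d by simp
  ultimately have "(\<lambda>i. ((LINT y|M. f (r0 + X (i + N)) y) - (LINT y|M. f r0 y)) / X (i + N))
      \<longlonglongrightarrow> (LINT y|M. f' r0 y)"
    by (simp only:)
  then show "((\<lambda>h. ((LINT y|M. f (r0 + h) y) - (LINT y|M. f r0 y)) / h) \<circ> X)
      \<longlonglongrightarrow> (LINT y|M. f' r0 y)"
    using LIMSEQ_offset[of "\<lambda>i. ((LINT y|M. f (r0 + X i) y) - (LINT y|M. f r0 y)) / X i" N]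
    by (simp add: comp_def)
qed

text \<open>At the corner the difference quotient is at most \<open>\<bar>h\<bar>\<close>, so
  squaring the positive part makes it continuously differentiable. The bump below gets from this the
  regularity demanded by \<open>C1_test\<close>.\<close>

lemma has_real_derivative_max_0_square:
  "((\<lambda>s::real. (max 0 s)\<^sup>2) has_real_derivative 2 * max 0 x) (at x)"
proof (cases "x = 0")
  case True
  have "((\<lambda>h::real. (max 0 h)\<^sup>2 / h) \<longlongrightarrow> 0) (at 0)"
  proof (rule Lim_null_comparison)
    have "\<bar>(max 0 h)\<^sup>2 / h\<bar> \<le> \<bar>h\<bar>" for h :: real
      by (cases "h > 0") (auto simp: max_def power2_eq_square)
    then show "\<forall>\<^sub>F h in at 0. norm ((max 0 h)\<^sup>2 / h :: real) \<le> \<bar>h\<bar>"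
      by simp
    show "((\<lambda>h::real. \<bar>h\<bar>) \<longlongrightarrow> 0) (at 0)"
      by (intro tendsto_rabs_zero tendsto_ident_at)
  qed
  then show ?thesis using True by (simp add: DERIV_def)
next
  case False
  show ?thesis
  proof (cases "x > 0")
    case True
    have "((\<lambda>s::real. s\<^sup>2) has_real_derivative 2 * x) (at x)"
      by (auto intro!: derivative_eq_intros)
    then have "((\<lambda>s::real. (max 0 s)\<^sup>2) has_real_derivative 2 * x) (at x)"
      by (rule DERIV_cong_ev[THEN iffD1, rotated -1])
        (use eventually_nhds_in_open[of "{0<..}" x] True in \<open>auto elim!: eventually_mono\<close>)
    then show ?thesis using True by simp
  next
    case neg: False
    have "((\<lambda>s::real. 0) has_real_derivative 0) (at x)"
      by simp
    then have "((\<lambda>s::real. (max 0 s)\<^sup>2) has_real_derivative 0) (at x)"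
      by (rule DERIV_cong_ev[THEN iffD1, rotated -1])
        (use eventually_nhds_in_open[of "{..<0}" x] False neg in \<open>auto elim!: eventually_mono\<close>)
    then show ?thesis using neg by simp
  qed
qed

text \<open>A uniform interior cone condition: one direction \<open>e\<close> serves all points of
  \<open>U\<close>, and the balls \<open>cball (x + \<rho> *\<^sub>R e) (\<rho> * \<delta>)\<close>
  stay in the domain. Averages over such balls approximate the value at \<open>x\<close> without
  extending the function across the boundary.\<close>

locale cone_piece = bounded_open_set \<Omega> for \<Omega> :: "'a::euclidean_space set" +
  fixes U :: "'a set" and e :: 'a and \<delta> h :: real
  assumes norm_e: "norm e = 1" and \<delta>_pos: "0 < \<delta>" and \<delta>_le: "\<delta> \<le> 1" and h_pos: "0 < h"
    and U_sets [measurable]: "U \<in> sets lebesgue" and U_sub: "U \<subseteq> \<Omega>"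
    and cone: "\<And>x \<rho> w. x \<in> U \<Longrightarrow> 0 < \<rho> \<Longrightarrow> \<rho> \<le> h \<Longrightarrow> norm w \<le> \<delta> \<Longrightarrow> x + \<rho> *\<^sub>R (e + w) \<in> \<Omega>"
begin

text \<open>The kernel is off-centre: scaled to radius \<open>\<rho>\<close> and placed at
  \<open>x\<close>, it lives on the ball about \<open>x + \<rho> *\<^sub>R e\<close> that the cone
  condition keeps inside the domain.\<close>

definition bump :: "'a \<Rightarrow> real" where
  "bump z = (max 0 (\<delta>\<^sup>2 - (norm (z - e))\<^sup>2))\<^sup>2"

definition bump_grad :: "'a \<Rightarrow> 'a" where
  "bump_grad z = (- 4 * max 0 (\<delta>\<^sup>2 - (norm (z - e))\<^sup>2)) *\<^sub>R (z - e)"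

lemma bump_has_derivative: "(bump has_derivative (\<lambda>k. k \<bullet> bump_grad z)) (at z)"
proof -
  have "((\<lambda>z. \<delta>\<^sup>2 - (norm (z - e))\<^sup>2) has_derivative (\<lambda>k. - 2 * (k \<bullet> (z - e)))) (at z)"
    unfolding power2_norm_eq_inner
    by (auto intro!: derivative_eq_intros simp: inner_commute fun_eq_iff)
  from has_derivative_compose[OF this
      has_real_derivative_max_0_square[unfolded has_field_derivative_def]]
  show ?thesis
    by (simp add: bump_def[abs_def] bump_grad_def mult.commute mult.left_commute)
qed

lemma bump_continuous: "continuous_on UNIV bump"
  unfolding bump_def[abs_def] by (intro continuous_intros)

lemma bump_grad_continuous: "continuous_on UNIV bump_grad"
  unfolding bump_grad_def[abs_def] by (intro continuous_intros)

lemma bump_nonneg: "0 \<le> bump z"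
  by (simp add: bump_def)

lemma max_bump_le: "max 0 (\<delta>\<^sup>2 - (norm (z - e))\<^sup>2) \<le> 1"
  using \<delta>_pos \<delta>_le power_le_one[of \<delta> 2] zero_le_power2[of "norm (z - e)"]
  by (simp del: zero_le_power2 add: diff_le_eq add_increasing2)

lemma bump_le_1: "bump z \<le> 1"
  unfolding bump_def using max_bump_le[of z] by (intro power_le_one) auto

lemma bump_support:
  assumes "\<delta> \<le> norm (z - e)"
  shows "bump z = 0" "bump_grad z = 0"
  using power_mono[OF assms, of 2] \<delta>_pos by (auto simp: bump_def bump_grad_def)

text \<open>Source of the radius \<open>2 * \<rho>\<close> in the ball integrals that bound
  averages: the support lies within distance \<open>norm e + \<delta> \<le> 2\<close> of the
  origin.\<close>

lemma norm_less_2: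
  assumes "norm (z - e) < \<delta>"
  shows "norm z < 2"
  using assms norm_triangle_ineq[of "z - e" e] norm_e \<delta>_le by simp

lemma norm_bump_grad_le: "norm (bump_grad z) \<le> 4"
proof (cases "\<delta> \<le> norm (z - e)")
  case False
  have "max 0 (\<delta>\<^sup>2 - (norm (z - e))\<^sup>2) * norm (z - e) \<le> 1 * 1"
    using False \<delta>_le max_bump_le[of z] by (intro mult_mono) auto
  then show ?thesis by (simp add: bump_grad_def abs_mult)
qed (simp add: bump_support)

lemma inner_bump_grad_le: "\<bar>z \<bullet> bump_grad z\<bar> \<le> 8"
proof (cases "\<delta> \<le> norm (z - e)")
  case False
  have "\<bar>z \<bullet> bump_grad z\<bar> \<le> norm z * norm (bump_grad z)"
    by (rule Cauchy_Schwarz_ineq2)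
  also have "\<dots> \<le> 2 * 4"
    using norm_less_2[of z] False norm_bump_grad_le[of z] by (intro mult_mono) auto
  finally show ?thesis by simp
qed (simp add: bump_support)

lemma comp_continuous:
  fixes f :: "'a \<Rightarrow> 'b::topological_space" and x :: 'a
  assumes "continuous_on UNIV f"
  shows "continuous_on UNIV (\<lambda>y. f ((1 / \<rho>) *\<^sub>R (y - x)))"
  by (rule continuous_on_compose2[OF assms, where s = UNIV])
    (auto intro!: continuous_on_scaleR continuous_on_diff)

lemma bump_comp_measurable [measurable]: "(\<lambda>y. bump ((1 / \<rho>) *\<^sub>R (y - x))) \<in> borel_measurable M"
  by (intro continuous_measurable comp_continuous bump_continuous)

lemma bump_grad_comp_measurable [measurable]:
  "(\<lambda>y. bump_grad ((1 / \<rho>) *\<^sub>R (y - x))) \<in> borel_measurable M"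
  by (intro continuous_measurable comp_continuous bump_grad_continuous)

lemma bump_comp_integrable:
  assumes "integrable M v"
  shows "integrable M (\<lambda>y. v y * bump ((1 / \<rho>) *\<^sub>R (y - x)))"
proof (rule Bochner_Integration.integrable_bound[OF assms])
  show "(\<lambda>y. v y * bump ((1 / \<rho>) *\<^sub>R (y - x))) \<in> borel_measurable M"
    using assms by measurable
  show "AE y in M. norm (v y * bump ((1 / \<rho>) *\<^sub>R (y - x))) \<le> norm (v y)"
    using bump_nonneg bump_le_1 by (auto simp: abs_mult intro!: mult_left_le)
qed

text \<open>The kernel is left unnormalised: at points of \<open>U\<close> and radii up to
  \<open>h\<close> the average of a constant \<open>c\<close> is \<open>bump_mass * c\<close>, and
  this factor accompanies comparisons with the function itself.\<close>

definition smooth_avg :: "real \<Rightarrow> ('a \<Rightarrow> real) \<Rightarrow> 'a \<Rightarrow> real" where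
  "smooth_avg \<rho> v x = (LINT y|M. v y * bump ((1 / \<rho>) *\<^sub>R (y - x))) / \<rho> ^ DIM('a)"

lemma bump_comp_eq_0:
  assumes "0 < \<rho>" "y \<notin> ball x (2 * \<rho>)"
  shows "bump ((1 / \<rho>) *\<^sub>R (y - x)) = 0"
proof -
  have "2 * \<rho> \<le> norm (y - x)"
    using assms(2) by (simp add: dist_norm norm_minus_commute)
  then have "2 \<le> norm ((1 / \<rho>) *\<^sub>R (y - x))"
    using assms(1) by (simp add: pos_le_divide_eq)
  then show ?thesis
    using norm_less_2[of "(1 / \<rho>) *\<^sub>R (y - x)"] bump_support(1) by force
qed

lemma abs_smooth_avg_le:
  assumes v: "integrable M v" and \<rho>: "0 < \<rho>"
  shows "ennreal \<bar>smooth_avg \<rho> v x\<bar> \<le> ennreal (1 / \<rho> ^ DIM('a)) * ball_int (2 * \<rho>) (\<lambda>y. ennreal \<bar>v y\<bar>) x"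
proof -
  let ?I = "LINT y|M. v y * bump ((1 / \<rho>) *\<^sub>R (y - x))"
  have "ennreal \<bar>?I\<bar> \<le> (\<integral>\<^sup>+y. ennreal (norm (v y * bump ((1 / \<rho>) *\<^sub>R (y - x)))) \<partial>M)"
    using integral_norm_bound_ennreal[OF bump_comp_integrable[OF v, of \<rho> x]] by simp
  also have "\<dots> \<le> ball_int (2 * \<rho>) (\<lambda>y. ennreal \<bar>v y\<bar>) x"
    unfolding ball_int_def
  proof (intro nn_integral_mono)
    fix y
    show "ennreal (norm (v y * bump ((1 / \<rho>) *\<^sub>R (y - x)))) \<le> indicator (ball x (2 * \<rho>)) y * ennreal \<bar>v y\<bar>"
    proof (cases "y \<in> ball x (2 * \<rho>)")
      case True
      then show ?thesis
        using bump_nonneg bump_le_1 by (auto simp: abs_mult intro!: mult_left_le ennreal_leI)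
    qed (simp add: bump_comp_eq_0 \<rho>)
  qed
  finally have "ennreal \<bar>?I\<bar> \<le> ball_int (2 * \<rho>) (\<lambda>y. ennreal \<bar>v y\<bar>) x" .
  then have "ennreal (1 / \<rho> ^ DIM('a)) * ennreal \<bar>?I\<bar>
      \<le> ennreal (1 / \<rho> ^ DIM('a)) * ball_int (2 * \<rho>) (\<lambda>y. ennreal \<bar>v y\<bar>) x"
    by (rule mult_left_mono) simp
  then show ?thesis
    using \<rho> by (simp add: smooth_avg_def abs_divide flip: ennreal_mult')
qed

text \<open>These are the components of the vector field \<open>y - x\<close> times the scaled bump.
  The divergence of that field is \<open>- \<rho> ^ (DIM('a) + 1)\<close> times the derivative in
  \<open>\<rho>\<close> of the scaled bump divided by \<open>\<rho> ^ DIM('a)\<close>. The cone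
  condition keeps the supports in the domain.\<close>

lemma C1_test_radial:
  assumes x: "x \<in> U" and \<rho>: "0 < \<rho>" "\<rho> \<le> h"
  shows "C1_test \<Omega> (\<lambda>y. ((y - x) \<bullet> b) * bump ((1 / \<rho>) *\<^sub>R (y - x)))
    (\<lambda>y. bump ((1 / \<rho>) *\<^sub>R (y - x)) *\<^sub>R b
        + (((y - x) \<bullet> b) / \<rho>) *\<^sub>R bump_grad ((1 / \<rho>) *\<^sub>R (y - x)))"
    (is "C1_test \<Omega> ?\<psi> ?g")
  unfolding C1_test_def
proof (intro conjI allI)
  show "GDERIV ?\<psi> y :> ?g y" for y
  proof -
    have "((\<lambda>y. (1 / \<rho>) *\<^sub>R (y - x)) has_derivative (\<lambda>k. (1 / \<rho>) *\<^sub>R k)) (at y)"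
      by (auto intro!: derivative_eq_intros)
    note * = has_derivative_compose[OF this bump_has_derivative]
    have "((\<lambda>y. (y - x) \<bullet> b) has_derivative (\<lambda>k. k \<bullet> b)) (at y)"
      by (auto intro!: derivative_eq_intros)
    from has_derivative_mult[OF this *] show ?thesis
      unfolding gderiv_def by (simp add: inner_add_right inner_commute algebra_simps)
  qed
  show "continuous_on UNIV ?g"
    using \<rho> by (intro continuous_intros comp_continuous bump_continuous bump_grad_continuous) auto
  let ?K = "cball (x + \<rho> *\<^sub>R e) (\<rho> * \<delta>)"
  have "{y. ?\<psi> y \<noteq> 0} \<subseteq> ?K"
  proof safe
    fix y assume "?\<psi> y \<noteq> 0"
    then have "norm ((1 / \<rho>) *\<^sub>R (y - x) - e) < \<delta>"
      using bump_support(1) by force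
    moreover have "(1 / \<rho>) *\<^sub>R (y - x) - e = (1 / \<rho>) *\<^sub>R (y - (x + \<rho> *\<^sub>R e))"
      using \<rho> by (simp add: algebra_simps)
    ultimately have "norm (y - (x + \<rho> *\<^sub>R e)) / \<rho> < \<delta>"
      using \<rho> by simp
    then have "norm (y - (x + \<rho> *\<^sub>R e)) < \<rho> * \<delta>"
      using \<rho> by (simp add: pos_divide_less_eq mult.commute)
    then show "y \<in> ?K" by (simp add: dist_norm norm_minus_commute)
  qed
  then have sub: "closure {y. ?\<psi> y \<noteq> 0} \<subseteq> ?K"
    by (simp add: closure_minimal)
  then show "compact (closure {y. ?\<psi> y \<noteq> 0})"
    by (meson bounded_cball bounded_subset closed_closure compact_eq_bounded_closed)
  have "?K \<subseteq> \<Omega>"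
  proof
    fix y assume "y \<in> ?K"
    then have "norm (y - (x + \<rho> *\<^sub>R e)) \<le> \<rho> * \<delta>"
      by (simp add: dist_norm norm_minus_commute)
    then have "norm ((1 / \<rho>) *\<^sub>R (y - (x + \<rho> *\<^sub>R e))) \<le> \<delta>"
      using \<rho> by (simp add: pos_divide_le_eq mult.commute)
    from cone[OF x \<rho> this] have "x + \<rho> *\<^sub>R (e + (1 / \<rho>) *\<^sub>R (y - (x + \<rho> *\<^sub>R e))) \<in> \<Omega>" .
    then show "y \<in> \<Omega>"
      using \<rho> by (simp add: algebra_simps)
  qed
  with sub show "closure {y. ?\<psi> y \<noteq> 0} \<subseteq> \<Omega>" by simp
qed

text \<open>The weak gradient is tested with each component field, the matching coordinate of the
  resulting vector identity is read off, and the coordinates are summed: the divergence theorem for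
  the field \<open>y - x\<close> times the bump.\<close>

lemma integral_divergence:
  assumes G: "has_weak_gradient \<Omega> v G" and x: "x \<in> U" and \<rho>: "0 < \<rho>" "\<rho> \<le> h"
  shows "(LINT y|M. v y * (real DIM('a) * bump ((1 / \<rho>) *\<^sub>R (y - x))
        + ((1 / \<rho>) *\<^sub>R (y - x)) \<bullet> bump_grad ((1 / \<rho>) *\<^sub>R (y - x))))
    = - (LINT y|M. bump ((1 / \<rho>) *\<^sub>R (y - x)) * ((y - x) \<bullet> G y))"
proof -
  let ?\<zeta> = "\<lambda>y. (1 / \<rho>) *\<^sub>R (y - x)"
  let ?\<psi> = "\<lambda>b y. ((y - x) \<bullet> b) * bump (?\<zeta> y)"
  let ?g = "\<lambda>b y. bump (?\<zeta> y) *\<^sub>R b + (((y - x) \<bullet> b) / \<rho>) *\<^sub>R bump_grad (?\<zeta> y)"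
  have vL: "v \<in> L2 \<Omega>" and mG [measurable]: "G \<in> borel_measurable M"
    using G by (auto simp: has_weak_gradient_def)
  have v: "integrable M v" using vL by (rule L2_integrable)
  obtain R where R: "0 < R" "\<And>y. y \<in> \<Omega> \<Longrightarrow> norm (y - x) \<le> R"
    using dom_norm_bound[of x] by blast
  have [measurable]: "(\<lambda>y. (y - x) \<bullet> b) \<in> borel_measurable M" for b
    by (rule continuous_measurable) (intro continuous_intros)
  have \<psi>i: "integrable M (\<lambda>y. ?\<psi> b y *\<^sub>R G y)" if b: "b \<in> Basis" for b
  proof (rule Bochner_Integration.integrable_bound)
    show "integrable M (\<lambda>y. R * norm (G y))"
      using L2_integrable[OF norm_gradient_L2[OF G]] by simp
    show "AE y in M. norm (?\<psi> b y *\<^sub>R G y) \<le> norm (R * norm (G y))"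
    proof (rule AE_I2)
      fix y assume "y \<in> space M"
      then have "\<bar>(y - x) \<bullet> b\<bar> \<le> R"
        using R(2)[of y] Basis_le_norm[OF b, of "y - x"] by simp
      then have "\<bar>(y - x) \<bullet> b\<bar> * \<bar>bump (?\<zeta> y)\<bar> \<le> R * 1"
        using R(1) bump_nonneg bump_le_1 by (intro mult_mono) auto
      then show "norm (?\<psi> b y *\<^sub>R G y) \<le> norm (R * norm (G y))"
        using R(1) by (auto simp: abs_mult intro!: mult_right_mono)
    qed
  qed measurable
  have gi: "integrable M (\<lambda>y. v y *\<^sub>R ?g b y)" if b: "b \<in> Basis" for b
  proof (rule Bochner_Integration.integrable_bound)
    show "integrable M (\<lambda>y. (1 + R / \<rho> * 4) * v y)"
      using v by simp
    show "(\<lambda>y. v y *\<^sub>R ?g b y) \<in> borel_measurable M"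
      using v by measurable
    show "AE y in M. norm (v y *\<^sub>R ?g b y) \<le> norm ((1 + R / \<rho> * 4) * v y)"
    proof (rule AE_I2)
      fix y assume "y \<in> space M"
      then have "\<bar>(y - x) \<bullet> b\<bar> \<le> R"
        using R(2)[of y] Basis_le_norm[OF b, of "y - x"] by simp
      then have *: "\<bar>(y - x) \<bullet> b\<bar> / \<rho> * norm (bump_grad (?\<zeta> y)) \<le> R / \<rho> * 4"
        using R(1) \<rho> norm_bump_grad_le by (intro mult_mono divide_right_mono) auto
      have "norm (?g b y) \<le> norm (bump (?\<zeta> y) *\<^sub>R b) + norm ((((y - x) \<bullet> b) / \<rho>) *\<^sub>R bump_grad (?\<zeta> y))"
        by (rule norm_triangle_ineq)
      also have "\<dots> \<le> 1 + R / \<rho> * 4"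
        using * b \<rho> bump_nonneg[of "?\<zeta> y"] bump_le_1[of "?\<zeta> y"] by (simp add: abs_divide)
      finally have "norm (?g b y) \<le> 1 + R / \<rho> * 4" .
      then show "norm (v y *\<^sub>R ?g b y) \<le> norm ((1 + R / \<rho> * 4) * v y)"
        using R(1) \<rho> by (auto simp: abs_mult mult.commute intro!: mult_left_mono)
    qed
  qed
  have eq: "(LINT y|M. (v y *\<^sub>R ?g b y) \<bullet> b) = - (LINT y|M. (?\<psi> b y *\<^sub>R G y) \<bullet> b)"
    if b: "b \<in> Basis" for b
  proof -
    have "(LINT y|M. v y *\<^sub>R ?g b y) = - (LINT y|M. ?\<psi> b y *\<^sub>R G y)"
      using G C1_test_radial[OF x \<rho>, of b] by (auto simp: has_weak_gradient_def)
    then show ?thesis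
      using integral_inner_left[of b, OF gi[OF b]] integral_inner_left[of b, OF \<psi>i[OF b]]
      by (simp add: b)
  qed
  \<comment> \<open>Taking the trace over \<open>Basis\<close>: every basis vector contributes
    \<open>bump\<close> once, and the remaining terms assemble to the inner product of
    \<open>?\<zeta> y\<close> with the gradient of the bump.\<close>
  have "v y * (real DIM('a) * bump (?\<zeta> y) + ?\<zeta> y \<bullet> bump_grad (?\<zeta> y))
      = (\<Sum>b\<in>Basis. (v y *\<^sub>R ?g b y) \<bullet> b)" for y
  proof -
    have "(\<Sum>b\<in>Basis. ?g b y \<bullet> b)
        = (\<Sum>b\<in>Basis. bump (?\<zeta> y) + (?\<zeta> y \<bullet> b) * (bump_grad (?\<zeta> y) \<bullet> b))"
      by (intro sum.cong) (auto simp: inner_add_left inner_diff_left)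
    also have "\<dots> = real DIM('a) * bump (?\<zeta> y) + ?\<zeta> y \<bullet> bump_grad (?\<zeta> y)"
      by (simp only: sum.distrib euclidean_inner[of "?\<zeta> y" "bump_grad (?\<zeta> y)"] sum_constant)
    finally show ?thesis
      by (simp only: inner_scaleR_left flip: sum_distrib_left)
  qed
  then have "(LINT y|M. v y * (real DIM('a) * bump (?\<zeta> y) + ?\<zeta> y \<bullet> bump_grad (?\<zeta> y)))
      = (\<Sum>b\<in>Basis. LINT y|M. (v y *\<^sub>R ?g b y) \<bullet> b)"
    using gi by (simp only:) (intro Bochner_Integration.integral_sum integrable_inner_left, auto)
  also have "\<dots> = - (\<Sum>b\<in>Basis. LINT y|M. (?\<psi> b y *\<^sub>R G y) \<bullet> b)"
    by (simp only: eq sum_negf cong: sum.cong)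
  also have "(\<Sum>b\<in>Basis. LINT y|M. (?\<psi> b y *\<^sub>R G y) \<bullet> b)
      = (LINT y|M. (\<Sum>b\<in>Basis. (?\<psi> b y *\<^sub>R G y) \<bullet> b))"
    using \<psi>i by (intro Bochner_Integration.integral_sum[symmetric] integrable_inner_left) auto
  also have "(\<lambda>y. \<Sum>b\<in>Basis. (?\<psi> b y *\<^sub>R G y) \<bullet> b) = (\<lambda>y. bump (?\<zeta> y) * ((y - x) \<bullet> G y))"
    by (subst euclidean_inner) (auto simp: sum_distrib_left mult_ac intro!: sum.cong)
  finally show ?thesis .
qed

text \<open>The derivative of the scaled kernel combines \<open>bump\<close> and its radial
  derivative in exactly the proportion that occurs in \<open>integral_divergence\<close>, with one
  further factor \<open>1 / \<rho>\<close>.\<close>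

lemma smooth_avg_has_derivative:
  assumes G: "has_weak_gradient \<Omega> v G" and x: "x \<in> U" and \<rho>: "0 < \<rho>" "\<rho> \<le> h"
  shows "((\<lambda>\<rho>. smooth_avg \<rho> v x) has_real_derivative
    (LINT y|M. bump ((1 / \<rho>) *\<^sub>R (y - x)) * ((y - x) \<bullet> G y)) / \<rho> ^ (DIM('a) + 1)) (at \<rho>)"
proof -
  let ?\<zeta> = "\<lambda>\<rho> y. (1 / \<rho>) *\<^sub>R (y - x)"
  let ?f' = "\<lambda>\<rho> y. - (v y * (?\<zeta> \<rho> y \<bullet> bump_grad (?\<zeta> \<rho> y))) / \<rho>"
  let ?n = "DIM('a)"
  have vL: "v \<in> L2 \<Omega>"
    using G by (auto simp: has_weak_gradient_def)
  have v: "integrable M v" using vL by (rule L2_integrable)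
  have [measurable]: "?\<zeta> r \<in> borel_measurable M" for r
    by (rule continuous_measurable) (intro continuous_intros)
  have gi: "integrable M (\<lambda>y. v y * (?\<zeta> \<rho> y \<bullet> bump_grad (?\<zeta> \<rho> y)))"
  proof (rule Bochner_Integration.integrable_bound)
    show "integrable M (\<lambda>y. 8 * v y)" using v by simp
    show "(\<lambda>y. v y * (?\<zeta> \<rho> y \<bullet> bump_grad (?\<zeta> \<rho> y))) \<in> borel_measurable M"
      using v by measurable
    show "AE y in M. norm (v y * (?\<zeta> \<rho> y \<bullet> bump_grad (?\<zeta> \<rho> y))) \<le> norm (8 * v y)"
    proof (rule AE_I2)
      fix y
      have "\<bar>v y\<bar> * \<bar>?\<zeta> \<rho> y \<bullet> bump_grad (?\<zeta> \<rho> y)\<bar> \<le> \<bar>v y\<bar> * 8"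
        by (intro mult_left_mono inner_bump_grad_le) auto
      then show "norm (v y * (?\<zeta> \<rho> y \<bullet> bump_grad (?\<zeta> \<rho> y))) \<le> norm (8 * v y)"
        unfolding real_norm_def abs_mult by simp
    qed
  qed
  have "((\<lambda>\<rho>. LINT y|M. v y * bump (?\<zeta> \<rho> y)) has_real_derivative (LINT y|M. ?f' \<rho> y)) (at \<rho>)"
  \<comment> \<open>Radii within \<open>\<rho> / 2\<close> of \<open>\<rho>\<close> satisfy
    \<open>r \<ge> \<rho> / 2\<close>, whence \<open>8 / r \<le> 16 / \<rho>\<close>. Radii above
    \<open>h\<close> may occur here; the cone enters only at \<open>\<rho>\<close> itself, through
    \<open>integral_divergence\<close>.\<close>
  proof (rule has_real_derivative_lebesgue_integral[where d = "\<rho> / 2" and g = "\<lambda>y. 16 / \<rho> * \<bar>v y\<bar>"])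
    show "((\<lambda>r. v y * bump (?\<zeta> r y)) has_real_derivative ?f' r y) (at r)"
      if "\<bar>r - \<rho>\<bar> < \<rho> / 2" for r y
    proof -
      have r: "0 < r" using that \<rho> by linarith
      have "((\<lambda>r. (1 / r) *\<^sub>R (y - x)) has_derivative (\<lambda>k. (- k / r\<^sup>2) *\<^sub>R (y - x))) (at r)"
        using r by (auto intro!: derivative_eq_intros simp: power2_eq_square)
      from has_derivative_mult_right[OF has_derivative_compose[OF this bump_has_derivative], of "v y"]
      show ?thesis
        unfolding has_field_derivative_def
        by (rule has_derivative_eq_rhs)
          (use r in \<open>auto simp: fun_eq_iff power2_eq_square\<close>)
    qed
    show "\<bar>?f' r y\<bar> \<le> 16 / \<rho> * \<bar>v y\<bar>" if "\<bar>r - \<rho>\<bar> < \<rho> / 2" for r y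
    proof -
      have r: "\<rho> / 2 \<le> r" "0 < r" using that \<rho> by linarith+
      have "\<bar>?f' r y\<bar> = \<bar>v y\<bar> * (\<bar>?\<zeta> r y \<bullet> bump_grad (?\<zeta> r y)\<bar> / r)"
        using r by (simp only: abs_divide abs_minus abs_mult) simp
      also have "\<dots> \<le> \<bar>v y\<bar> * (8 / (\<rho> / 2))"
        using r \<rho> by (intro mult_left_mono frac_le inner_bump_grad_le) auto
      finally show ?thesis by (simp add: mult.commute)
    qed
    show "integrable M (\<lambda>y. v y * bump (?\<zeta> r y))" for r
      by (rule bump_comp_integrable[OF v])
    show "?f' \<rho> \<in> borel_measurable M"
      using v by measurable
  qed (use \<rho> v in auto)
  then have "((\<lambda>\<rho>. smooth_avg \<rho> v x) has_real_derivative
      ((LINT y|M. ?f' \<rho> y) * \<rho> ^ ?n - (LINT y|M. v y * bump (?\<zeta> \<rho> y)) * (real ?n * \<rho> ^ (?n - 1)))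
        / (\<rho> ^ ?n * \<rho> ^ ?n)) (at \<rho>)"
    unfolding smooth_avg_def using \<rho>
    by (intro DERIV_divide) (auto intro!: derivative_eq_intros)
  moreover have "((LINT y|M. ?f' \<rho> y) * \<rho> ^ ?n - (LINT y|M. v y * bump (?\<zeta> \<rho> y)) * (real ?n * \<rho> ^ (?n - 1)))
        / (\<rho> ^ ?n * \<rho> ^ ?n) = (LINT y|M. bump (?\<zeta> \<rho> y) * ((y - x) \<bullet> G y)) / \<rho> ^ (?n + 1)"
  proof -
    let ?a = "LINT y|M. v y * bump (?\<zeta> \<rho> y)"
    let ?b = "LINT y|M. v y * (?\<zeta> \<rho> y \<bullet> bump_grad (?\<zeta> \<rho> y))"
    have 1: "(LINT y|M. ?f' \<rho> y) = - ?b / \<rho>"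
      by simp
    have "(LINT y|M. v y * (real ?n * bump (?\<zeta> \<rho> y) + ?\<zeta> \<rho> y \<bullet> bump_grad (?\<zeta> \<rho> y)))
        = (LINT y|M. real ?n * (v y * bump (?\<zeta> \<rho> y)) + v y * (?\<zeta> \<rho> y \<bullet> bump_grad (?\<zeta> \<rho> y)))"
      by (intro Bochner_Integration.integral_cong) (auto simp: algebra_simps)
    also have "\<dots> = real ?n * ?a + ?b"
      using gi bump_comp_integrable[OF v, of \<rho> x] by simp
    finally have 2: "(LINT y|M. bump (?\<zeta> \<rho> y) * ((y - x) \<bullet> G y)) = - (real ?n * ?a + ?b)"
      using integral_divergence[OF assms] by simp
    have 3: "\<rho> ^ ?n = \<rho> * \<rho> ^ (?n - 1)"
      using DIM_positive[where 'a = 'a] by (metis Suc_diff_1 power_Suc)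
    have "((- ?b / \<rho>) * \<rho> ^ ?n - ?a * (real ?n * \<rho> ^ (?n - 1))) / (\<rho> ^ ?n * \<rho> ^ ?n)
        = - (real ?n * ?a + ?b) / \<rho> ^ (?n + 1)"
      using \<rho> unfolding power_add power_one_right 3 by (simp add: divide_simps) (simp add: algebra_simps)
    then show ?thesis unfolding 1 2 .
  qed
  ultimately show ?thesis by simp
qed

text \<open>A mean value estimate over \<open>{r / 2..r}\<close>: on that range the rate of change
  is bounded through a single integral of the gradient over the largest ball. The bound
  \<open>2 * (2 / r) ^ DIM('a)\<close> on the rate times the length \<open>r / 2\<close> gives the
  constant.\<close>

lemma smooth_avg_diff_le:
  assumes G: "has_weak_gradient \<Omega> v G" and x: "x \<in> U" and r: "0 < r" "r \<le> h"
  shows "ennreal \<bar>smooth_avg r v x - smooth_avg (r / 2) v x\<bar>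
    \<le> ennreal ((2 / r) ^ DIM('a) * r) * ball_int (2 * r) (\<lambda>y. ennreal (norm (G y))) x"
proof -
  let ?n = "DIM('a)"
  let ?D = "\<lambda>\<rho>. (LINT y|M. bump ((1 / \<rho>) *\<^sub>R (y - x)) * ((y - x) \<bullet> G y)) / \<rho> ^ (?n + 1)"
  have mG [measurable]: "G \<in> borel_measurable M"
    using G by (auto simp: has_weak_gradient_def)
  have [measurable]: "(\<lambda>y. (y - x)) \<in> borel_measurable M"
    by (rule continuous_measurable) (intro continuous_intros)
  let ?J = "LINT y|M. indicator (ball x (2 * r)) y * norm (G y)"
  have Ji: "integrable M (\<lambda>y. indicator (ball x (2 * r)) y * norm (G y))"
  proof (rule Bochner_Integration.integrable_bound)
    show "integrable M (\<lambda>y. norm (G y))" using L2_integrable[OF norm_gradient_L2[OF G]] by simp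
    have "(indicator (ball x (2 * r)) :: 'a \<Rightarrow> real) \<in> borel_measurable M"
      by (rule measurable_compose[OF ident_borel_measurable_lebesgue_on])
        (simp add: borel_measurable_indicator)
    then show "(\<lambda>y. indicator (ball x (2 * r)) y * norm (G y)) \<in> borel_measurable M" by measurable
  qed (auto simp: indicator_def)
  have bound: "\<bar>?D \<rho>\<bar> \<le> 2 * (2 / r) ^ ?n * ?J" if \<rho>: "r / 2 \<le> \<rho>" "\<rho> \<le> r" for \<rho>
  proof -
    have \<rho>0: "0 < \<rho>" using r \<rho> by linarith
    \<comment> \<open>The factor \<open>2 * \<rho>\<close> bounds \<open>norm (y - x)\<close> on the
      support of the kernel and cancels one power of the radius in \<open>?D\<close>.\<close>
    have pw: "\<bar>bump ((1 / \<rho>) *\<^sub>R (y - x)) * ((y - x) \<bullet> G y)\<bar>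
        \<le> 2 * \<rho> * (indicator (ball x (2 * r)) y * norm (G y))" for y
    proof (cases "y \<in> ball x (2 * \<rho>)")
      case True
      then have n: "norm (y - x) \<le> 2 * \<rho>" by (simp add: dist_norm norm_minus_commute)
      have "\<bar>bump ((1 / \<rho>) *\<^sub>R (y - x)) * ((y - x) \<bullet> G y)\<bar> \<le> 1 * (norm (y - x) * norm (G y))"
        unfolding abs_mult using bump_nonneg bump_le_1
        by (intro mult_mono Cauchy_Schwarz_ineq2) auto
      also have "\<dots> \<le> 2 * \<rho> * norm (G y)"
        using n by (auto intro!: mult_right_mono)
      finally show ?thesis using True \<rho> by (auto simp: indicator_def)
    qed (use \<rho>0 bump_comp_eq_0 in auto)
    have "\<bar>LINT y|M. bump ((1 / \<rho>) *\<^sub>R (y - x)) * ((y - x) \<bullet> G y)\<bar>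
        \<le> (LINT y|M. \<bar>bump ((1 / \<rho>) *\<^sub>R (y - x)) * ((y - x) \<bullet> G y)\<bar>)"
      by (rule integral_abs_bound)
    also have "\<dots> \<le> (LINT y|M. 2 * \<rho> * (indicator (ball x (2 * r)) y * norm (G y)))"
    proof (rule Bochner_Integration.integral_mono)
      show "integrable M (\<lambda>y. 2 * \<rho> * (indicator (ball x (2 * r)) y * norm (G y)))"
        using Ji by simp
      then show "integrable M (\<lambda>y. \<bar>bump ((1 / \<rho>) *\<^sub>R (y - x)) * ((y - x) \<bullet> G y)\<bar>)"
      proof (rule Bochner_Integration.integrable_bound)
        show "AE y in M. norm \<bar>bump ((1 / \<rho>) *\<^sub>R (y - x)) * ((y - x) \<bullet> G y)\<bar>
            \<le> norm (2 * \<rho> * (indicator (ball x (2 * r)) y * norm (G y)))"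
          using pw by (auto intro!: AE_I2 intro: order_trans[OF _ abs_ge_self])
      qed measurable
    qed (rule pw)
    also have "\<dots> = 2 * \<rho> * ?J" by simp
    finally have "\<bar>?D \<rho>\<bar> \<le> 2 * \<rho> * ?J / \<rho> ^ (?n + 1)"
      unfolding abs_divide abs_of_pos[OF zero_less_power[OF \<rho>0, of "?n + 1"]]
      using \<rho>0 by (intro divide_right_mono) auto
    also have "\<dots> = 2 * (1 / \<rho>) ^ ?n * ?J"
      using \<rho>0 by (simp add: power_divide)
    also have "\<dots> \<le> 2 * (2 / r) ^ ?n * ?J"
    proof -
      have "1 / \<rho> \<le> 2 / r"
        using \<rho> r \<rho>0 by (simp add: field_simps)
      then have "(1 / \<rho>) ^ ?n \<le> (2 / r) ^ ?n"
        using \<rho>0 by (intro power_mono) auto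
      moreover have "0 \<le> ?J" by (rule Bochner_Integration.integral_nonneg) simp
      ultimately show ?thesis by (intro mult_right_mono mult_left_mono) auto
    qed
    finally show ?thesis .
  qed
  have "norm (smooth_avg r v x - smooth_avg (r / 2) v x) \<le> (2 * (2 / r) ^ ?n * ?J) * norm (r - r / 2)"
  proof (rule field_differentiable_bound[of "{r / 2..r}" "\<lambda>\<rho>. smooth_avg \<rho> v x" ?D])
    show "((\<lambda>\<rho>. smooth_avg \<rho> v x) has_field_derivative ?D \<rho>) (at \<rho> within {r / 2..r})"
      if "\<rho> \<in> {r / 2..r}" for \<rho>
      by (rule has_field_derivative_at_within, rule smooth_avg_has_derivative[OF G x])
        (use that r in auto)
    show "norm (?D \<rho>) \<le> 2 * (2 / r) ^ ?n * ?J" if "\<rho> \<in> {r / 2..r}" for \<rho>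
      using bound[of \<rho>] that by auto
  qed (use r in auto)
  also have "\<dots> = (2 / r) ^ ?n * r * ?J" using r by simp
  finally have "ennreal \<bar>smooth_avg r v x - smooth_avg (r / 2) v x\<bar> \<le> ennreal ((2 / r) ^ ?n * r * ?J)"
    by (simp add: ennreal_leI)
  also have "\<dots> = ennreal ((2 / r) ^ ?n * r) * ennreal ?J"
    using r by (intro ennreal_mult) (simp_all add: Bochner_Integration.integral_nonneg)
  also have "ennreal ?J = (\<integral>\<^sup>+y. ennreal (indicator (ball x (2 * r)) y * norm (G y)) \<partial>M)"
    using Ji by (intro nn_integral_eq_integral[symmetric]) auto
  also have "\<dots> = ball_int (2 * r) (\<lambda>y. ennreal (norm (G y))) x"
    unfolding ball_int_def by (intro nn_integral_cong) (auto simp: indicator_def)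
  finally show ?thesis .
qed

end

section \<open>Approximation of integrable functions by continuous ones\<close>

context bounded_open_set
begin

text \<open>A measurable function is an almost everywhere limit of continuous functions
  \<open>g k\<close>. Truncating it and them at a common level \<open>m\<close> supplies the
  dominating constant under which this becomes convergence in L1.\<close>

lemma L1_approx_continuous:
  fixes v :: "'a \<Rightarrow> real"
  assumes v: "integrable M v" and \<epsilon>: "0 < \<epsilon>"
  obtains g B where "continuous_on UNIV g" "\<And>x. \<bar>g x\<bar> \<le> B"
    "(\<integral>\<^sup>+x. ennreal \<bar>v x - g x\<bar> \<partial>M) < ennreal \<epsilon>"
proof -
  define c where "c n t = max (- real n) (min (real n) t)" for n and t :: real
  have c_abs: "\<bar>c n t\<bar> \<le> real n" for n t by (auto simp: c_def)
  have c_le: "\<bar>c n t\<bar> \<le> \<bar>t\<bar>" for n t by (auto simp: c_def)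
  have cm [measurable]: "c n \<in> borel_measurable borel" for n
    unfolding c_def[abs_def] by measurable
  have [measurable]: "v \<in> borel_measurable M" using v by simp
  have "(\<lambda>n. LINT x|M. \<bar>v x - c n (v x)\<bar>) \<longlonglongrightarrow> (LINT x|M. 0)"
  proof (rule integral_dominated_convergence[where w = "\<lambda>x. 2 * \<bar>v x\<bar>"])
    show "integrable M (\<lambda>x. 2 * \<bar>v x\<bar>)" using v by simp
    show "AE x in M. (\<lambda>n. \<bar>v x - c n (v x)\<bar>) \<longlonglongrightarrow> 0"
    proof (rule AE_I2)
      fix x
      have "eventually (\<lambda>n. \<bar>v x - c n (v x)\<bar> = 0) sequentially"
        using eventually_ge_at_top[of "nat \<lceil>\<bar>v x\<bar>\<rceil>"]
      proof eventually_elim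
        case (elim n)
        then have "\<bar>v x\<bar> \<le> real n" by linarith
        then show ?case by (auto simp: c_def)
      qed
      then show "(\<lambda>n. \<bar>v x - c n (v x)\<bar>) \<longlonglongrightarrow> 0"
        by (rule tendsto_eventually)
    qed
    show "AE x in M. norm \<bar>v x - c n (v x)\<bar> \<le> 2 * \<bar>v x\<bar>" for n
      using c_le[of n] by (intro AE_I2) (smt (verit) real_norm_def)
  qed measurable
  from order_tendstoD(2)[OF this, of "\<epsilon> / 2"] \<epsilon>
  have "eventually (\<lambda>n. (LINT x|M. \<bar>v x - c n (v x)\<bar>) < \<epsilon> / 2) sequentially"
    by simp
  then obtain m where m: "(LINT x|M. \<bar>v x - c m (v x)\<bar>) < \<epsilon> / 2"
    by (auto simp: eventually_sequentially)
  have "(\<lambda>x. c m (v x)) \<in> borel_measurable M" by measurable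
  then have "(\<lambda>x. c m (v x)) measurable_on \<Omega>"
    by (simp add: measurable_on_iff_borel_measurable)
  then obtain N g where N: "negligible N" and g: "\<And>k. continuous_on UNIV (g k)"
    and lim: "\<And>x. x \<notin> N \<Longrightarrow> (\<lambda>k. g k x) \<longlonglongrightarrow> (if x \<in> \<Omega> then c m (v x) else 0)"
    unfolding measurable_on_def by blast
  have gm [measurable]: "g k \<in> borel_measurable M" for k
    by (rule continuous_measurable[OF g])
  have ci: "integrable M (\<lambda>x. c m (v x))"
    by (rule Bochner_Integration.integrable_bound[OF v]) (use c_le in auto)
  have "(\<lambda>k. LINT x|M. \<bar>c m (v x) - c m (g k x)\<bar>) \<longlonglongrightarrow> (LINT x|M. 0)"
  proof (rule integral_dominated_convergence[where w = "\<lambda>x. 2 * real m"])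
    have "AE x in lebesgue. x \<notin> N"
      using N by (simp add: negligible_iff_null_sets AE_not_in)
    then have "AE x in M. x \<notin> N"
      by (subst AE_restrict_space_iff) (auto elim: AE_mp)
    then show "AE x in M. (\<lambda>k. \<bar>c m (v x) - c m (g k x)\<bar>) \<longlonglongrightarrow> 0"
    proof (rule AE_mp, intro AE_I2 impI)
      fix x assume x: "x \<in> space M" "x \<notin> N"
      \<comment> \<open>The approximants converge to the truncated function; truncating once more
        does not move the limit, as \<open>c m\<close> is idempotent.\<close>
      have "(\<lambda>k. c m (g k x)) \<longlonglongrightarrow> c m (c m (v x))"
        using lim[OF x(2)] x(1) unfolding c_def by (intro tendsto_intros) auto
      also have "c m (c m (v x)) = c m (v x)" by (auto simp: c_def)
      finally show "(\<lambda>k. \<bar>c m (v x) - c m (g k x)\<bar>) \<longlonglongrightarrow> 0"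
        using tendsto_diff[of "\<lambda>k. c m (v x)" "c m (v x)" sequentially "\<lambda>k. c m (g k x)" "c m (v x)"]
        by (simp add: tendsto_rabs_zero_iff)
    qed
    show "AE x in M. norm \<bar>c m (v x) - c m (g k x)\<bar> \<le> 2 * real m" for k
      using c_abs[of m] by (intro AE_I2) (smt (verit) real_norm_def)
  qed (simp, measurable)
  from order_tendstoD(2)[OF this, of "\<epsilon> / 2"] \<epsilon>
  have "eventually (\<lambda>k. (LINT x|M. \<bar>c m (v x) - c m (g k x)\<bar>) < \<epsilon> / 2) sequentially"
    by simp
  then obtain k where k: "(LINT x|M. \<bar>c m (v x) - c m (g k x)\<bar>) < \<epsilon> / 2"
    by (auto simp: eventually_sequentially)
  let ?g = "\<lambda>x. c m (g k x)"
  have gi: "integrable M ?g"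
    by (rule integrable_const_bound[where B = "real m"]) (use c_abs in auto)
  show ?thesis
  proof (rule that[of ?g "real m"])
    show "continuous_on UNIV ?g"
      unfolding c_def using g by (intro continuous_intros) auto
    show "\<bar>?g x\<bar> \<le> real m" for x by (rule c_abs)
    have "(\<integral>\<^sup>+x. ennreal \<bar>v x - ?g x\<bar> \<partial>M) = ennreal (LINT x|M. \<bar>v x - ?g x\<bar>)"
      using v gi by (intro nn_integral_eq_integral) auto
    also have "\<dots> < ennreal \<epsilon>"
    proof (rule ennreal_lessI[OF \<epsilon>])
      have "(LINT x|M. \<bar>v x - ?g x\<bar>) \<le> (LINT x|M. \<bar>v x - c m (v x)\<bar> + \<bar>c m (v x) - ?g x\<bar>)"
        using v gi ci by (intro Bochner_Integration.integral_mono) auto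
      also have "\<dots> < \<epsilon>"
        using v gi ci m k by (subst Bochner_Integration.integral_add) auto
      finally show "(LINT x|M. \<bar>v x - ?g x\<bar>) < \<epsilon>" .
    qed
    finally show "(\<integral>\<^sup>+x. ennreal \<bar>v x - ?g x\<bar> \<partial>M) < ennreal \<epsilon>" .
  qed
qed

end

lemma ennreal_square_mult:
  assumes "0 \<le> c" "0 \<le> u" "0 \<le> g"
  shows "ennreal c * ((ennreal u)\<^sup>2 * ennreal g) = ennreal (c * u\<^sup>2 * g)"
    "(ennreal c)\<^sup>2 * (ennreal u * ennreal g) = ennreal (c\<^sup>2 * (u * g))"
    "(ennreal c)\<^sup>2 * ((ennreal u)\<^sup>2 * ennreal g) = ennreal (c\<^sup>2 * (u\<^sup>2 * g))"
  using assms by (simp_all add: ennreal_power ennreal_mult mult.assoc)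

section \<open>Limits of the averages as the radius tends to zero\<close>

context cone_piece
begin

definition bump_mass :: real where
  "bump_mass = (LINT z|lborel. bump z)"

lemma bump_borel [measurable]: "bump \<in> borel_measurable borel"
  by (rule borel_measurable_continuous_onI[OF bump_continuous])

lemma bump_integrable: "integrable lborel bump"
proof (rule Bochner_Integration.integrable_bound)
  show "integrable lborel (indicator (cball e \<delta>) :: 'a \<Rightarrow> real)"
    by (rule integrable_real_indicator, simp, rule emeasure_bounded_finite, simp)
  show "AE z in lborel. norm (bump z) \<le> norm (indicator (cball e \<delta>) z :: real)"
    using bump_support(1) bump_nonneg bump_le_1
    by (intro AE_I2) (auto simp: indicator_def dist_norm norm_minus_commute)
qed simp

lemma bump_mass_pos: "0 < bump_mass"
proof -
  have "0 \<le> bump_mass"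
    unfolding bump_mass_def by (rule Bochner_Integration.integral_nonneg) (rule bump_nonneg)
  moreover have "bump_mass \<noteq> 0"
  proof
    assume "bump_mass = 0"
    then have "AE z in lborel. bump z = 0"
      using integral_nonneg_eq_0_iff_AE[OF bump_integrable] bump_nonneg by (simp add: bump_mass_def)
    then have "AE z in lborel. z \<notin> ball e \<delta>"
    proof (rule AE_mp, intro AE_I2 impI)
      fix z assume "bump z = 0"
      then have "\<delta>\<^sup>2 - (norm (z - e))\<^sup>2 \<le> 0"
        by (simp add: bump_def max_def split: if_splits)
      then have "\<delta> \<le> norm (z - e)"
        using abs_le_square_iff[of \<delta> "norm (z - e)"] \<delta>_pos by simp
      then show "z \<notin> ball e \<delta>" by (simp add: dist_norm norm_minus_commute)
    qed
    then have "ball e \<delta> \<in> null_sets lborel"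
      by (subst AE_iff_null_sets) simp_all
    then have "emeasure lborel (ball e \<delta>) = 0" by auto
    then show False
      using \<delta>_pos unit_ball_vol_pos[of "real DIM('a)"] by (simp add: emeasure_ball)
  qed
  ultimately show ?thesis by simp
qed

lemma bump_comp_support:
  assumes x: "x \<in> U" and \<rho>: "0 < \<rho>" "\<rho> \<le> h" and y: "y \<notin> \<Omega>"
  shows "bump ((1 / \<rho>) *\<^sub>R (y - x)) = 0"
proof (rule ccontr)
  assume "bump ((1 / \<rho>) *\<^sub>R (y - x)) \<noteq> 0"
  then have "norm ((1 / \<rho>) *\<^sub>R (y - x) - e) \<le> \<delta>"
    using bump_support(1) by force
  from cone[OF x \<rho> this] show False using y \<rho> by simp
qed

text \<open>Because the scaled bump vanishes outside the domain, the restricted integral equals the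
  one over the whole space. The affine change of variables then gives a mass that is the same for
  all points of \<open>U\<close>, however close to the boundary.\<close>

lemma bump_comp_integral:
  assumes x: "x \<in> U" and \<rho>: "0 < \<rho>" "\<rho> \<le> h"
  shows "(LINT y|M. bump ((1 / \<rho>) *\<^sub>R (y - x))) = \<rho> ^ DIM('a) * bump_mass"
proof -
  let ?f = "\<lambda>y. bump ((1 / \<rho>) *\<^sub>R (y - x))"
  have "bump_mass = (LINT z|density (distr lborel borel (\<lambda>y. - (1 / \<rho>) *\<^sub>R x + (1 / \<rho>) *\<^sub>R y))
      (\<lambda>_. \<bar>1 / \<rho>\<bar> ^ DIM('a)). bump z)"
    unfolding bump_mass_def using lborel_affine[of "1 / \<rho>" "- (1 / \<rho>) *\<^sub>R x"] \<rho> by simp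
  also have "\<dots> = (LINT y|lborel. \<bar>1 / \<rho>\<bar> ^ DIM('a) * bump (- (1 / \<rho>) *\<^sub>R x + (1 / \<rho>) *\<^sub>R y))"
    by (subst integral_density) (auto simp: integral_distr)
  also have "\<dots> = (1 / \<rho>) ^ DIM('a) * (LINT y|lborel. ?f y)"
    using \<rho> by (simp add: scaleR_diff_right)
  also have "(LINT y|lborel. ?f y) = (LINT y|lebesgue. ?f y)"
    by (rule integral_completion[symmetric]) simp
  also have "\<dots> = (LINT y|lebesgue. indicator \<Omega> y *\<^sub>R ?f y)"
    by (intro Bochner_Integration.integral_cong) (auto simp: indicator_def bump_comp_support[OF assms])
  also have "\<dots> = (LINT y|M. ?f y)"
    by (rule integral_restrict_space[symmetric]) simp
  finally show ?thesis using \<rho> by (simp add: power_divide)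
qed

lemma smooth_avg_measurable [measurable]:
  assumes "v \<in> borel_measurable M"
  shows "smooth_avg \<rho> v \<in> borel_measurable M"
proof -
  note [measurable] = assms
  have "continuous_on UNIV (\<lambda>p::'a\<times>'a. bump ((1 / \<rho>) *\<^sub>R (snd p - fst p)))"
    by (rule continuous_on_compose2[OF bump_continuous, where s = UNIV])
      (auto intro!: continuous_on_scaleR continuous_on_diff continuous_on_fst continuous_on_snd)
  then have [measurable]: "(\<lambda>p. bump ((1 / \<rho>) *\<^sub>R (snd p - fst p))) \<in> borel_measurable (M \<Otimes>\<^sub>M M)"
    by (intro pair_measurable_kernel borel_measurable_continuous_onI)
  have "(\<lambda>p. v (snd p) * bump ((1 / \<rho>) *\<^sub>R (snd p - fst p))) \<in> borel_measurable (M \<Otimes>\<^sub>M M)"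
    by measurable
  then have "(\<lambda>x. LINT y|M. v y * bump ((1 / \<rho>) *\<^sub>R (y - x))) \<in> borel_measurable M"
    by (intro borel_measurable_lebesgue_integral) (simp add: split_beta')
  then show ?thesis
    unfolding smooth_avg_def[abs_def] by measurable
qed

lemma smooth_avg_add:
  assumes "integrable M v" "integrable M w"
  shows "smooth_avg \<rho> (\<lambda>x. v x + w x) x = smooth_avg \<rho> v x + smooth_avg \<rho> w x"
  using bump_comp_integrable[OF assms(1)] bump_comp_integrable[OF assms(2)]
  by (simp add: smooth_avg_def distrib_right add_divide_distrib)

lemma smooth_avg_diff:
  assumes "integrable M v" "integrable M w"
  shows "smooth_avg \<rho> (\<lambda>x. v x - w x) x = smooth_avg \<rho> v x - smooth_avg \<rho> w x"
  using bump_comp_integrable[OF assms(1)] bump_comp_integrable[OF assms(2)]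
  by (simp add: smooth_avg_def left_diff_distrib diff_divide_distrib)

lemma smooth_avg_const:
  assumes "x \<in> U" "0 < \<rho>" "\<rho> \<le> h"
  shows "smooth_avg \<rho> (\<lambda>y. c) x = bump_mass * c"
  using assms by (simp add: smooth_avg_def bump_comp_integral)

text \<open>The kernel is nonnegative with total mass \<open>bump_mass\<close> after normalisation,
  so a deviation of at most \<open>\<eta>\<close> on its support is inherited by the average. With
  \<open>c = 0\<close> this is a supremum bound, with \<open>c = g x\<close> it gives convergence at
  points of continuity.\<close>

lemma smooth_avg_deviation:
  assumes x: "x \<in> U" and \<rho>: "0 < \<rho>" "\<rho> \<le> h" and g: "integrable M g"
    and bound: "\<And>y. dist x y < 2 * \<rho> \<Longrightarrow> \<bar>g y - c\<bar> \<le> \<eta>"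
  shows "\<bar>smooth_avg \<rho> g x - bump_mass * c\<bar> \<le> bump_mass * \<eta>"
proof -
  let ?b = "\<lambda>y. bump ((1 / \<rho>) *\<^sub>R (y - x))"
  have ci: "integrable M (\<lambda>y. c)" by simp
  have "\<bar>LINT y|M. (g y - c) * ?b y\<bar> \<le> (LINT y|M. \<bar>(g y - c) * ?b y\<bar>)"
    by (rule integral_abs_bound)
  also have "\<dots> \<le> (LINT y|M. \<eta> * ?b y)"
  proof (rule Bochner_Integration.integral_mono)
    show "integrable M (\<lambda>y. \<bar>(g y - c) * ?b y\<bar>)"
      using bump_comp_integrable[of "\<lambda>y. g y - c"] g by auto
    show "integrable M (\<lambda>y. \<eta> * ?b y)"
      using bump_comp_integrable[of "\<lambda>y. \<eta>"] by auto
    show "\<bar>(g y - c) * ?b y\<bar> \<le> \<eta> * ?b y" for y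
    proof (cases "dist x y < 2 * \<rho>")
      case True
      then show ?thesis
        using bound[OF True] bump_nonneg by (auto simp: abs_mult intro!: mult_right_mono)
    next
      case False
      then have "?b y = 0" using \<rho> by (intro bump_comp_eq_0) auto
      then show ?thesis by simp
    qed
  qed
  also have "\<dots> = \<eta> * (\<rho> ^ DIM('a) * bump_mass)"
    using assms by (simp add: bump_comp_integral)
  finally have "\<bar>smooth_avg \<rho> (\<lambda>y. g y - c) x\<bar> \<le> bump_mass * \<eta>"
    using \<rho> by (simp add: smooth_avg_def abs_divide pos_divide_le_eq mult_ac)
  then show ?thesis
    by (simp add: smooth_avg_diff[OF g ci] smooth_avg_const[OF x \<rho>])
qed

text \<open>The constant does not depend on \<open>\<rho>\<close>; this uniformity carries
  convergence from continuous functions over to all integrable ones.\<close>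

lemma nn_integral_smooth_avg_le:
  assumes v: "integrable M v" and \<rho>: "0 < \<rho>"
  shows "(\<integral>\<^sup>+x. ennreal \<bar>smooth_avg \<rho> v x\<bar> \<partial>M)
    \<le> ennreal (unit_ball_vol DIM('a) * 2 ^ DIM('a)) * (\<integral>\<^sup>+y. ennreal \<bar>v y\<bar> \<partial>M)"
proof -
  have [measurable]: "v \<in> borel_measurable M" using v by simp
  have [measurable]: "ball_int (2 * \<rho>) (\<lambda>y. ennreal \<bar>v y\<bar>) \<in> borel_measurable M"
    by (rule ball_int_measurable) measurable
  have "(\<integral>\<^sup>+x. ennreal \<bar>smooth_avg \<rho> v x\<bar> \<partial>M)
      \<le> (\<integral>\<^sup>+x. ennreal (1 / \<rho> ^ DIM('a)) * ball_int (2 * \<rho>) (\<lambda>y. ennreal \<bar>v y\<bar>) x \<partial>M)"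
    by (intro nn_integral_mono abs_smooth_avg_le assms)
  also have "\<dots> = ennreal (1 / \<rho> ^ DIM('a)) * (\<integral>\<^sup>+x. ball_int (2 * \<rho>) (\<lambda>y. ennreal \<bar>v y\<bar>) x \<partial>M)"
    by (rule nn_integral_cmult) measurable
  also have "\<dots> \<le> ennreal (1 / \<rho> ^ DIM('a)) *
      (ennreal (unit_ball_vol DIM('a) * (2 * \<rho>) ^ DIM('a)) * (\<integral>\<^sup>+y. ennreal \<bar>v y\<bar> \<partial>M))"
    using \<rho> by (intro mult_left_mono nn_integral_ball_int) auto
  also have "\<dots> = ennreal (1 / \<rho> ^ DIM('a) * (unit_ball_vol DIM('a) * (2 * \<rho>) ^ DIM('a)))
      * (\<integral>\<^sup>+y. ennreal \<bar>v y\<bar> \<partial>M)"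
    using \<rho> by (subst ennreal_mult) (auto simp: mult.assoc)
  also have "1 / \<rho> ^ DIM('a) * (unit_ball_vol DIM('a) * (2 * \<rho>) ^ DIM('a)) = unit_ball_vol DIM('a) * 2 ^ DIM('a)"
    using \<rho> by (simp add: power_mult_distrib)
  finally show ?thesis .
qed

lemma smooth_avg_tendsto:
  fixes g :: "'a \<Rightarrow> real"
  assumes r: "\<And>k. 0 < r k" "\<And>k. r k \<le> h" "r \<longlonglongrightarrow> 0"
    and g: "continuous_on UNIV g" "integrable M g" and x: "x \<in> U"
  shows "(\<lambda>k. smooth_avg (r k) g x) \<longlonglongrightarrow> bump_mass * g x"
  unfolding lim_sequentially dist_real_def
proof (intro allI impI)
  fix \<epsilon> :: real assume "0 < \<epsilon>"
  define \<eta> where "\<eta> = \<epsilon> / (2 * bump_mass)"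
  have \<eta>: "0 < \<eta>" "bump_mass * \<eta> < \<epsilon>"
    using \<open>0 < \<epsilon>\<close> bump_mass_pos by (auto simp: \<eta>_def)
  have "isCont g x" using g by (simp add: continuous_on_eq_continuous_at)
  then obtain d where d: "0 < d" "\<And>y. dist y x < d \<Longrightarrow> dist (g y) (g x) < \<eta>"
    using \<eta>(1) unfolding continuous_at_eps_delta by (metis dist_commute)
  have "eventually (\<lambda>k. r k < d / 2) sequentially"
    using r(3) d(1) by (intro order_tendstoD(2)) auto
  then obtain N where N: "\<And>k. k \<ge> N \<Longrightarrow> r k < d / 2"
    by (auto simp: eventually_sequentially)
  have "\<bar>smooth_avg (r k) g x - bump_mass * g x\<bar> < \<epsilon>" if "k \<ge> N" for k
  proof -
    have "\<bar>smooth_avg (r k) g x - bump_mass * g x\<bar> \<le> bump_mass * \<eta>"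
    proof (rule smooth_avg_deviation[OF x r(1,2) g(2)])
      fix y assume "dist x y < 2 * r k"
      then have "dist y x < d" using N[OF that] by (simp add: dist_commute)
      then show "\<bar>g y - g x\<bar> \<le> \<eta>" using d(2)[of y] by (simp add: dist_real_def)
    qed
    then show ?thesis using \<eta>(2) by simp
  qed
  then show "\<exists>N. \<forall>k\<ge>N. \<bar>smooth_avg (r k) g x - bump_mass * g x\<bar> < \<epsilon>" by blast
qed

lemma U_measurable [measurable]: "U \<in> sets M"
  using U_sub U_sets by (simp add: sets_restrict_space_iff)

text \<open>Convergence for a continuous approximant \<open>g\<close>, combined with the uniform L1
  bound applied to \<open>v - g\<close>. Convergence in L1 identifies the limit of the averages
  almost everywhere along a subsequence, which is how it will be used.\<close>

lemma smooth_avg_tendsto_L1: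
  assumes r: "\<And>k. 0 < r k" "\<And>k. r k \<le> h" "r \<longlonglongrightarrow> 0" and v: "integrable M v"
  shows "(\<lambda>k. \<integral>\<^sup>+x. indicator U x * ennreal \<bar>smooth_avg (r k) v x - bump_mass * v x\<bar> \<partial>M) \<longlonglongrightarrow> 0"
proof (rule order_tendstoI)
  fix a :: ennreal assume "0 < a"
  then obtain b where b: "0 < b" "b < a" using dense by blast
  define e0 where "e0 = enn2real b"
  have e0: "0 < e0" "ennreal e0 < a"
  proof -
    have "b < top" using b(2) by (meson order_less_le_trans top_greatest)
    then have "ennreal e0 = b" by (simp add: e0_def)
    then show "ennreal e0 < a" using b by simp
    show "0 < e0" using b(1) \<open>b < top\<close> by (simp add: e0_def enn2real_positive_iff)
  qed
  define W where "W = unit_ball_vol DIM('a) * 2 ^ DIM('a)"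
  have W: "0 \<le> W" by (simp add: W_def)
  \<comment> \<open>The average of \<open>v - g\<close> and \<open>bump_mass\<close> times
    \<open>v - g\<close> together cost \<open>e0 / 2\<close>; the other half of \<open>e0\<close> is
    reserved for the continuous function.\<close>
  define \<epsilon> where "\<epsilon> = e0 / (2 * (W + bump_mass))"
  have \<epsilon>: "0 < \<epsilon>" "(W + bump_mass) * \<epsilon> = e0 / 2"
  proof -
    have "0 < e0 / (2 * D) \<and> D * (e0 / (2 * D)) = e0 / 2" if "0 < D" for D
      using that e0 by simp
    then show "0 < \<epsilon>" "(W + bump_mass) * \<epsilon> = e0 / 2"
      unfolding \<epsilon>_def using W bump_mass_pos by (meson add_nonneg_pos)+
  qed
  obtain g B where g: "continuous_on UNIV g" and B: "\<And>x. \<bar>g x\<bar> \<le> B"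
    and vg: "(\<integral>\<^sup>+x. ennreal \<bar>v x - g x\<bar> \<partial>M) < ennreal \<epsilon>"
    using L1_approx_continuous[OF v \<epsilon>(1)] by blast
  have [measurable]: "g \<in> borel_measurable M" by (rule continuous_measurable[OF g])
  have [measurable]: "v \<in> borel_measurable M" using v by simp
  have gi: "integrable M g"
    by (rule integrable_const_bound[where B = B]) (use B in auto)
  have B0: "0 \<le> B" using B[of undefined] by linarith
  have "(\<lambda>k. \<integral>\<^sup>+x. indicator U x * ennreal \<bar>smooth_avg (r k) g x - bump_mass * g x\<bar> \<partial>M)
      \<longlonglongrightarrow> (\<integral>\<^sup>+x. 0 \<partial>M)"
  proof (rule nn_integral_dominated_convergence[where w = "\<lambda>x. ennreal (2 * (bump_mass * B))"])
    show "AE x in M. indicator U x * ennreal \<bar>smooth_avg (r k) g x - bump_mass * g x\<bar>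
        \<le> ennreal (2 * (bump_mass * B))" for k
    proof (rule AE_I2)
      fix x
      show "indicator U x * ennreal \<bar>smooth_avg (r k) g x - bump_mass * g x\<bar>
          \<le> ennreal (2 * (bump_mass * B))"
      proof (cases "x \<in> U")
        case True
        have "\<bar>smooth_avg (r k) g x\<bar> \<le> bump_mass * B"
          using smooth_avg_deviation[OF True r(1)[of k] r(2)[of k] gi, of 0 B] B by simp
        moreover have "\<bar>bump_mass * g x\<bar> \<le> bump_mass * B"
          using bump_mass_pos B by (simp add: abs_mult)
        ultimately have "\<bar>smooth_avg (r k) g x - bump_mass * g x\<bar> \<le> 2 * (bump_mass * B)" by linarith
        then show ?thesis using True by (simp add: ennreal_leI)
      qed simp
    qed
    show "AE x in M. (\<lambda>k. indicator U x * ennreal \<bar>smooth_avg (r k) g x - bump_mass * g x\<bar>)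
        \<longlonglongrightarrow> 0"
    proof (rule AE_I2)
      fix x
      show "(\<lambda>k. indicator U x * ennreal \<bar>smooth_avg (r k) g x - bump_mass * g x\<bar>) \<longlonglongrightarrow> 0"
      proof (cases "x \<in> U")
        case True
        have "(\<lambda>k. \<bar>smooth_avg (r k) g x - bump_mass * g x\<bar>) \<longlonglongrightarrow> 0"
          using tendsto_diff[OF smooth_avg_tendsto[OF r g gi True] tendsto_const[of "bump_mass * g x"]]
          by (simp add: tendsto_rabs_zero)
        from tendsto_ennrealI[OF this] show ?thesis using True by simp
      qed simp
    qed
    show "(\<integral>\<^sup>+x. ennreal (2 * (bump_mass * B)) \<partial>M) < \<infinity>"
      by (simp add: ennreal_mult_eq_top_iff less_top[symmetric])
  qed measurable
  from order_tendstoD(2)[OF this, of "ennreal (e0 / 2)"] e0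
  have "\<forall>\<^sub>F k in sequentially. (\<integral>\<^sup>+x. indicator U x * ennreal \<bar>smooth_avg (r k) g x - bump_mass * g x\<bar> \<partial>M)
      < ennreal (e0 / 2)" by simp
  then show "\<forall>\<^sub>F k in sequentially. (\<integral>\<^sup>+x. indicator U x * ennreal \<bar>smooth_avg (r k) v x - bump_mass * v x\<bar> \<partial>M) < a"
  proof eventually_elim
    case (elim k)
    have vgi: "integrable M (\<lambda>x. v x - g x)" using v gi by simp
    have "(\<integral>\<^sup>+x. indicator U x * ennreal \<bar>smooth_avg (r k) v x - bump_mass * v x\<bar> \<partial>M)
      \<le> (\<integral>\<^sup>+x. ennreal \<bar>smooth_avg (r k) (\<lambda>x. v x - g x) x\<bar>
          + (indicator U x * ennreal \<bar>smooth_avg (r k) g x - bump_mass * g x\<bar>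
            + ennreal bump_mass * ennreal \<bar>v x - g x\<bar>) \<partial>M)"
    proof (rule nn_integral_mono)
      fix x
      have "\<bar>smooth_avg (r k) v x - bump_mass * v x\<bar>
          \<le> \<bar>smooth_avg (r k) v x - smooth_avg (r k) g x\<bar>
            + (\<bar>smooth_avg (r k) g x - bump_mass * g x\<bar> + \<bar>bump_mass * (v x - g x)\<bar>)"
        unfolding right_diff_distrib by linarith
      then have "ennreal \<bar>smooth_avg (r k) v x - bump_mass * v x\<bar>
          \<le> ennreal \<bar>smooth_avg (r k) (\<lambda>x. v x - g x) x\<bar>
            + (ennreal \<bar>smooth_avg (r k) g x - bump_mass * g x\<bar> + ennreal bump_mass * ennreal \<bar>v x - g x\<bar>)"
        using bump_mass_pos
        by (simp add: smooth_avg_diff v gi abs_mult flip: ennreal_mult' ennreal_plus)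
      then show "indicator U x * ennreal \<bar>smooth_avg (r k) v x - bump_mass * v x\<bar>
          \<le> ennreal \<bar>smooth_avg (r k) (\<lambda>x. v x - g x) x\<bar>
            + (indicator U x * ennreal \<bar>smooth_avg (r k) g x - bump_mass * g x\<bar>
              + ennreal bump_mass * ennreal \<bar>v x - g x\<bar>)"
        by (auto simp: indicator_def)
    qed
    also have "\<dots> = (\<integral>\<^sup>+x. ennreal \<bar>smooth_avg (r k) (\<lambda>x. v x - g x) x\<bar> \<partial>M)
        + ((\<integral>\<^sup>+x. indicator U x * ennreal \<bar>smooth_avg (r k) g x - bump_mass * g x\<bar> \<partial>M)
        + ennreal bump_mass * (\<integral>\<^sup>+x. ennreal \<bar>v x - g x\<bar> \<partial>M))"
      by (simp add: nn_integral_add nn_integral_cmult)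
    also have "\<dots> \<le> ennreal W * ennreal \<epsilon> + (ennreal (e0 / 2) + ennreal bump_mass * ennreal \<epsilon>)"
    proof (intro add_mono mult_left_mono)
      have "(\<integral>\<^sup>+x. ennreal \<bar>smooth_avg (r k) (\<lambda>x. v x - g x) x\<bar> \<partial>M)
          \<le> ennreal W * (\<integral>\<^sup>+x. ennreal \<bar>v x - g x\<bar> \<partial>M)"
        unfolding W_def by (rule nn_integral_smooth_avg_le[OF vgi r(1)])
      also have "\<dots> \<le> ennreal W * ennreal \<epsilon>"
        using vg by (intro mult_left_mono) auto
      finally show "(\<integral>\<^sup>+x. ennreal \<bar>smooth_avg (r k) (\<lambda>x. v x - g x) x\<bar> \<partial>M) \<le> ennreal W * ennreal \<epsilon>" .
    qed (use elim vg in auto)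
    also have "\<dots> = ennreal (W * \<epsilon> + (e0 / 2 + bump_mass * \<epsilon>))"
      using W \<epsilon> e0 bump_mass_pos by (simp add: ennreal_mult ennreal_plus)
    also have "W * \<epsilon> + (e0 / 2 + bump_mass * \<epsilon>) = e0"
      using \<epsilon>(2) by (simp add: distrib_right)
    finally show ?case using e0(2) by simp
  qed
qed simp

section \<open>Mean-square and pointwise estimates of the averages\<close>

lemma sum_half_powers_square:
  fixes b :: "nat \<Rightarrow> real"
  shows "(\<Sum>i<k. (1/2) ^ i * b i)\<^sup>2 \<le> 2 * (\<Sum>i<k. (1/2) ^ i * (b i)\<^sup>2)"
proof (induction k arbitrary: b)
  case (Suc k)
  let ?Y = "\<Sum>i<k. (1/2) ^ i * b (Suc i)" and ?S = "\<Sum>i<k. (1/2) ^ i * (b (Suc i))\<^sup>2"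
  have 1: "(\<Sum>i<Suc k. (1/2) ^ i * b i) = b 0 + ?Y / 2"
    by (simp add: sum.lessThan_Suc_shift sum_divide_distrib del: sum.lessThan_Suc)
  have 2: "(\<Sum>i<Suc k. (1/2) ^ i * (b i)\<^sup>2) = (b 0)\<^sup>2 + ?S / 2"
    by (simp add: sum.lessThan_Suc_shift sum_divide_distrib del: sum.lessThan_Suc)
  have "?Y\<^sup>2 \<le> 2 * ?S" by (rule Suc.IH)
  \<comment> \<open>The claim is Cauchy-Schwarz for the weights \<open>(1/2) ^ i\<close>, whose sum
    stays below 2. With the index 0 split off, halving the remaining weights reduces it to this
    inequality between two numbers.\<close>
  moreover have "(b 0 + ?Y / 2)\<^sup>2 \<le> 2 * (b 0)\<^sup>2 + ?Y\<^sup>2 / 2"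
    using zero_le_power2[of "b 0 - ?Y / 2"] by (simp add: power2_eq_square field_simps)
  ultimately show ?case unfolding 1 2 by simp
qed simp

text \<open>Telescoping over dyadic scales, with the convergence of the averages identifying the limit.\<close>

lemma smooth_avg_error_square:
  assumes G: "has_weak_gradient \<Omega> v G" and r: "0 < r" "r \<le> h"
  shows "(\<integral>\<^sup>+x. indicator U x * ennreal ((bump_mass * v x - smooth_avg r v x)\<^sup>2) \<partial>M)
    \<le> ennreal (4 * (4 ^ DIM('a) * unit_ball_vol DIM('a) * r)\<^sup>2 * (LINT x|M. (norm (G x))\<^sup>2))"
proof -
  let ?n = "DIM('a)"
  let ?K = "4 ^ ?n * unit_ball_vol ?n * r"
  let ?g = "LINT x|M. (norm (G x))\<^sup>2"
  have v: "integrable M v"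
    using G L2_integrable by (auto simp: has_weak_gradient_def)
  have [measurable]: "v \<in> borel_measurable M" "G \<in> borel_measurable M"
    using G by (auto simp: has_weak_gradient_def L2_def)
  have Gi: "(\<integral>\<^sup>+y. ennreal (norm (G y)) \<partial>M) < \<infinity>"
    using L2_integrable[OF norm_gradient_L2[OF G]] by (simp add: integrable_iff_bounded)
  define ri where "ri i = r / 2 ^ i" for i :: nat
  have ri: "0 < ri i" "ri i \<le> h" "ri (Suc i) = ri i / 2" "ri 0 = r" for i
  proof -
    show "0 < ri i" "ri (Suc i) = ri i / 2" "ri 0 = r" using r by (auto simp: ri_def)
    have "ri i \<le> r / 1" unfolding ri_def using r by (intro divide_left_mono) auto
    then show "ri i \<le> h" using r by simp
  qed
  define J where "J i = ball_int (2 * ri i) (\<lambda>y. ennreal (norm (G y)))" for i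
  have J_fin: "J i x < \<infinity>" for i x
    unfolding J_def using ball_int_le Gi by (rule order_le_less_trans)
  have J_meas [measurable]: "J i \<in> borel_measurable M" for i
    unfolding J_def by (rule ball_int_measurable) measurable
  \<comment> \<open>Normalised with \<open>r\<close> and not with \<open>ri i\<close>: the factor
    \<open>ri i = r / 2 ^ i\<close> of the increment estimate is split into a summable weight
    \<open>(1/2) ^ i\<close> and a function whose mean square is bounded independently of
    \<open>i\<close>.\<close>
  define b where "b i x = (2 / ri i) ^ ?n * r * enn2real (J i x)" for i x
  have b_nonneg: "0 \<le> b i x" for i x using r ri by (auto simp: b_def less_imp_le)
  have [measurable]: "b i \<in> borel_measurable M" for i unfolding b_def[abs_def] by measurable
  have b_int: "(\<integral>\<^sup>+x. ennreal ((b i x)\<^sup>2) \<partial>M) \<le> ennreal (?K\<^sup>2 * ?g)" for i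
  proof -
    let ?c = "((2 / ri i) ^ ?n * r)\<^sup>2"
    have "(\<integral>\<^sup>+x. ennreal ((b i x)\<^sup>2) \<partial>M) = (\<integral>\<^sup>+x. ennreal ?c * (J i x)\<^sup>2 \<partial>M)"
    proof (rule nn_integral_cong)
      fix x
      have "J i x = ennreal (enn2real (J i x))" using J_fin[of i x] by simp
      then have "(J i x)\<^sup>2 = ennreal ((enn2real (J i x))\<^sup>2)"
        by (metis ennreal_power enn2real_nonneg)
      then show "ennreal ((b i x)\<^sup>2) = ennreal ?c * (J i x)\<^sup>2"
        by (simp add: b_def power_mult_distrib ennreal_mult)
    qed
    also have "\<dots> = ennreal ?c * (\<integral>\<^sup>+x. (J i x)\<^sup>2 \<partial>M)"
      by (rule nn_integral_cmult) measurable
    also have "\<dots> \<le> ennreal ?c * ((ennreal (unit_ball_vol ?n * (2 * ri i) ^ ?n))\<^sup>2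
        * (\<integral>\<^sup>+y. (ennreal (norm (G y)))\<^sup>2 \<partial>M))"
      unfolding J_def using ri(1)[of i]
      by (intro mult_left_mono nn_integral_ball_int_square) auto
    also have "(\<integral>\<^sup>+y. (ennreal (norm (G y)))\<^sup>2 \<partial>M) = ennreal ?g"
      using G by (simp add: ennreal_power nn_integral_eq_integral has_weak_gradient_def)
    also have "ennreal ?c * ((ennreal (unit_ball_vol ?n * (2 * ri i) ^ ?n))\<^sup>2 * ennreal ?g)
        = ennreal (?c * (unit_ball_vol ?n * (2 * ri i) ^ ?n)\<^sup>2 * ?g)"
      using ri(1)[of i] by (intro ennreal_square_mult) (auto intro!: Bochner_Integration.integral_nonneg)
    also have "?c * (unit_ball_vol ?n * (2 * ri i) ^ ?n)\<^sup>2
        = ((2 / ri i * (2 * ri i)) ^ ?n * unit_ball_vol ?n * r)\<^sup>2"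
      by (simp only: power_mult_distrib mult_ac)
    also have "2 / ri i * (2 * ri i) = 4" using ri(1)[of i] by simp
    finally show ?thesis .
  qed
  have step: "\<bar>smooth_avg (ri i) v x - smooth_avg (ri (Suc i)) v x\<bar> \<le> (1/2) ^ i * b i x"
    if x: "x \<in> U" for i x
  proof -
    have "J i x = ennreal (enn2real (J i x))" using J_fin[of i x] by simp
    then have "ennreal \<bar>smooth_avg (ri i) v x - smooth_avg (ri (Suc i)) v x\<bar>
        \<le> ennreal ((2 / ri i) ^ ?n * ri i * enn2real (J i x))"
      using smooth_avg_diff_le[OF G x ri(1,2), of i] ri(1)[of i]
      by (simp add: ri(3) J_def ennreal_mult)
    then have "\<bar>smooth_avg (ri i) v x - smooth_avg (ri (Suc i)) v x\<bar>
        \<le> (2 / ri i) ^ ?n * ri i * enn2real (J i x)"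
      using ri(1)[of i] by (subst (asm) ennreal_le_iff) auto
    also have "\<dots> = (1/2) ^ i * b i x"
      by (simp add: b_def ri_def power_one_over field_simps)
    finally show ?thesis .
  qed
  have partial: "ennreal ((smooth_avg (ri k) v x - smooth_avg r v x)\<^sup>2)
      \<le> (\<Sum>i. ennreal (2 * (1/2) ^ i) * ennreal ((b i x)\<^sup>2))" if x: "x \<in> U" for x k
  proof -
    have "\<bar>smooth_avg r v x - smooth_avg (ri k) v x\<bar> \<le> (\<Sum>i<k. (1/2) ^ i * b i x)"
    proof (induction k)
      case (Suc k)
      then show ?case using step[OF x, of k] by simp
    qed (simp add: ri)
    then have "\<bar>smooth_avg r v x - smooth_avg (ri k) v x\<bar>\<^sup>2 \<le> (\<Sum>i<k. (1/2) ^ i * b i x)\<^sup>2"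
      by (rule power_mono) simp
    also have "\<dots> \<le> 2 * (\<Sum>i<k. (1/2) ^ i * (b i x)\<^sup>2)" by (rule sum_half_powers_square)
    finally have "ennreal ((smooth_avg (ri k) v x - smooth_avg r v x)\<^sup>2)
        \<le> ennreal (\<Sum>i<k. 2 * (1/2) ^ i * (b i x)\<^sup>2)"
      by (simp add: power2_commute sum_distrib_left mult.assoc ennreal_leI)
    also have "\<dots> = (\<Sum>i<k. ennreal (2 * (1/2) ^ i * (b i x)\<^sup>2))"
      by (rule sum_ennreal[symmetric]) auto
    also have "\<dots> = (\<Sum>i<k. ennreal (2 * (1/2) ^ i) * ennreal ((b i x)\<^sup>2))"
      by (intro sum.cong refl ennreal_mult) auto
    also have "\<dots> \<le> (\<Sum>i. ennreal (2 * (1/2) ^ i) * ennreal ((b i x)\<^sup>2))"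
      by (rule sum_le_suminf) auto
    finally show ?thesis .
  qed
  have "ri \<longlonglongrightarrow> 0"
    unfolding ri_def[abs_def] by (rule LIMSEQ_divide_realpow_zero) simp
  note conv = smooth_avg_tendsto_L1[OF ri(1,2) this v]
  define f where "f k x = indicator U x * (smooth_avg (ri k) v x - bump_mass * v x)" for k x
  have nn_f: "(\<integral>\<^sup>+x. ennreal (norm (f k x)) \<partial>M)
      = (\<integral>\<^sup>+x. indicator U x * ennreal \<bar>smooth_avg (ri k) v x - bump_mass * v x\<bar> \<partial>M)" for k
    by (intro nn_integral_cong) (auto simp: f_def indicator_def)
  have [measurable]: "f k \<in> borel_measurable M" for k unfolding f_def[abs_def] by measurable
  have f_int: "integrable M (f k)" for k
  proof (subst integrable_iff_bounded, intro conjI)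
    have "integrable M (\<lambda>x. bump_mass * v x)" using v by simp
    from this[unfolded integrable_iff_bounded]
    have "(\<integral>\<^sup>+x. ennreal \<bar>bump_mass * v x\<bar> \<partial>M) < \<infinity>"
      unfolding real_norm_def by blast
    moreover have "(\<integral>\<^sup>+x. ennreal \<bar>smooth_avg (ri k) v x\<bar> \<partial>M) < \<infinity>"
      using nn_integral_smooth_avg_le[OF v ri(1), of k] v
      by (auto simp: integrable_iff_bounded ennreal_mult_less_top elim: order_le_less_trans)
    moreover have "(\<integral>\<^sup>+x. ennreal (norm (f k x)) \<partial>M)
        \<le> (\<integral>\<^sup>+x. ennreal \<bar>smooth_avg (ri k) v x\<bar> + ennreal \<bar>bump_mass * v x\<bar> \<partial>M)"
      by (intro nn_integral_mono) (auto simp: f_def indicator_def simp flip: ennreal_plus intro!: ennreal_leI)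
    ultimately show "(\<integral>\<^sup>+x. ennreal (norm (f k x)) \<partial>M) < \<infinity>"
      by (subst (asm) nn_integral_add) (auto elim!: order_le_less_trans)
  qed measurable
  have "(\<lambda>k. ennreal (LINT x|M. norm (f k x))) \<longlonglongrightarrow> ennreal 0"
    using conv unfolding nn_f[symmetric] nn_integral_eq_integral[OF integrable_norm[OF f_int] AE_I2[OF norm_ge_zero]]
    by simp
  then have "(\<lambda>k. LINT x|M. norm (f k x)) \<longlonglongrightarrow> 0"
    by (subst (asm) tendsto_ennreal_iff) auto
  \<comment> \<open>Along a subsequence the averages converge almost everywhere on \<open>U\<close>,
    so the bound for partial telescoping sums passes to the limit pointwise.\<close>
  from tendsto_L1_AE_subseq[OF f_int this] obtain \<sigma> :: "nat \<Rightarrow> nat" where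
    \<sigma>: "AE x in M. (\<lambda>k. f (\<sigma> k) x) \<longlonglongrightarrow> 0"
    by blast
  have "AE x in M. indicator U x * ennreal ((bump_mass * v x - smooth_avg r v x)\<^sup>2)
      \<le> (\<Sum>i. ennreal (2 * (1/2) ^ i) * ennreal ((b i x)\<^sup>2))"
    using \<sigma>
  proof (rule AE_mp, intro AE_I2 impI)
    fix x assume lim: "(\<lambda>k. f (\<sigma> k) x) \<longlonglongrightarrow> 0"
    show "indicator U x * ennreal ((bump_mass * v x - smooth_avg r v x)\<^sup>2)
      \<le> (\<Sum>i. ennreal (2 * (1/2) ^ i) * ennreal ((b i x)\<^sup>2))"
    proof (cases "x \<in> U")
      case True
      have "(\<lambda>k. smooth_avg (ri (\<sigma> k)) v x) \<longlonglongrightarrow> bump_mass * v x"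
        using lim True by (simp add: f_def LIM_zero_iff)
      then have "(\<lambda>k. ennreal ((smooth_avg (ri (\<sigma> k)) v x - smooth_avg r v x)\<^sup>2))
          \<longlonglongrightarrow> ennreal ((bump_mass * v x - smooth_avg r v x)\<^sup>2)"
        by (intro tendsto_ennrealI tendsto_intros)
      then show ?thesis
        using partial[OF True] True by (auto intro: LIMSEQ_le_const2)
    qed simp
  qed
  then have "(\<integral>\<^sup>+x. indicator U x * ennreal ((bump_mass * v x - smooth_avg r v x)\<^sup>2) \<partial>M)
      \<le> (\<integral>\<^sup>+x. (\<Sum>i. ennreal (2 * (1/2) ^ i) * ennreal ((b i x)\<^sup>2)) \<partial>M)"
    by (rule nn_integral_mono_AE)
  also have "\<dots> = (\<Sum>i. \<integral>\<^sup>+x. ennreal (2 * (1/2) ^ i) * ennreal ((b i x)\<^sup>2) \<partial>M)"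
    by (rule nn_integral_suminf) measurable
  also have "\<dots> = (\<Sum>i. ennreal (2 * (1/2) ^ i) * (\<integral>\<^sup>+x. ennreal ((b i x)\<^sup>2) \<partial>M))"
    by (intro suminf_cong nn_integral_cmult) measurable
  also have "\<dots> \<le> (\<Sum>i. ennreal (2 * (1/2) ^ i) * ennreal (?K\<^sup>2 * ?g))"
    by (intro suminf_le mult_left_mono b_int) auto
  also have "\<dots> = (\<Sum>i. ennreal (2 * (1/2) ^ i * (?K\<^sup>2 * ?g)))"
    by (intro suminf_cong ennreal_mult[symmetric]) (auto intro!: mult_nonneg_nonneg Bochner_Integration.integral_nonneg)
  \<comment> \<open>The weights \<open>2 * (1/2) ^ i\<close> sum to 4.\<close>
  also have "\<dots> = ennreal (4 * ?K\<^sup>2 * ?g)"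
  proof (rule suminf_ennreal_eq)
    show "0 \<le> 2 * (1/2) ^ i * (?K\<^sup>2 * ?g)" for i
      by (auto intro!: mult_nonneg_nonneg Bochner_Integration.integral_nonneg)
    show "(\<lambda>i. 2 * (1/2) ^ i * (?K\<^sup>2 * ?g)) sums (4 * ?K\<^sup>2 * ?g)"
      using sums_mult2[OF sums_mult[OF geometric_sums[of "1/2 :: real"], of 2], of "?K\<^sup>2 * ?g"]
      by (simp add: mult.assoc)
  qed
  finally show ?thesis by simp
qed

text \<open>One volume factor \<open>(2 * r) ^ DIM('a)\<close> meets two factors
  \<open>(2 / r) ^ DIM('a)\<close>, which leaves \<open>r ^ DIM('a)\<close> in the denominator and
  the base \<open>8 = 2 * 2 * 2\<close>. The factor \<open>r\<^sup>2\<close> stays with the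
  gradient.\<close>

lemma smooth_avg_diff_square_le:
  assumes G: "has_weak_gradient \<Omega> v G" and x: "x \<in> U" and r: "0 < r" "r \<le> h"
  shows "(smooth_avg r v x - smooth_avg (r / 2) v x)\<^sup>2
    \<le> 8 ^ DIM('a) * unit_ball_vol DIM('a) / r ^ DIM('a) * (r\<^sup>2 * (LINT x|M. (norm (G x))\<^sup>2))"
proof -
  let ?n = "DIM('a)"
  let ?g = "LINT x|M. (norm (G x))\<^sup>2"
  have [measurable]: "G \<in> borel_measurable M"
    using G by (auto simp: has_weak_gradient_def)
  have g0: "0 \<le> ?g" by (rule Bochner_Integration.integral_nonneg) simp
  let ?d = "smooth_avg r v x - smooth_avg (r / 2) v x"
  have "ennreal (?d\<^sup>2) = (ennreal \<bar>?d\<bar>)\<^sup>2" by (simp add: ennreal_power)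
  also have "\<dots> \<le> (ennreal ((2 / r) ^ ?n * r) * ball_int (2 * r) (\<lambda>y. ennreal (norm (G y))) x)\<^sup>2"
    by (intro power_mono smooth_avg_diff_le assms) simp
  also have "\<dots> = (ennreal ((2 / r) ^ ?n * r))\<^sup>2 * (ball_int (2 * r) (\<lambda>y. ennreal (norm (G y))) x)\<^sup>2"
    by (rule power_mult_distrib)
  also have "\<dots> \<le> (ennreal ((2 / r) ^ ?n * r))\<^sup>2 * (ennreal (unit_ball_vol ?n * (2 * r) ^ ?n)
      * (\<integral>\<^sup>+y. (ennreal (norm (G y)))\<^sup>2 \<partial>M))"
    using r by (intro mult_left_mono ball_int_square_sup) auto
  also have "(\<integral>\<^sup>+y. (ennreal (norm (G y)))\<^sup>2 \<partial>M) = ennreal ?g"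
    using G by (simp add: ennreal_power nn_integral_eq_integral has_weak_gradient_def)
  also have "(ennreal ((2 / r) ^ ?n * r))\<^sup>2 * (ennreal (unit_ball_vol ?n * (2 * r) ^ ?n) * ennreal ?g)
      = ennreal (((2 / r) ^ ?n * r)\<^sup>2 * (unit_ball_vol ?n * (2 * r) ^ ?n * ?g))"
    using r g0 by (intro ennreal_square_mult) auto
  finally have "?d\<^sup>2 \<le> ((2 / r) ^ ?n * r)\<^sup>2 * (unit_ball_vol ?n * (2 * r) ^ ?n * ?g)"
    using r g0 by (subst (asm) ennreal_le_iff) auto
  also have "\<dots> = (2 / r * (2 / r) * (2 * r)) ^ ?n * unit_ball_vol ?n * (r\<^sup>2 * ?g)"
    by (simp only: power_mult_distrib power2_eq_square mult_ac)
  also have "2 / r * (2 / r) * (2 * r) = 8 / r" using r by simp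
  finally show ?thesis by (simp add: power_divide)
qed

lemma smooth_avg_square_le:
  assumes w: "w \<in> L2 \<Omega>" and r: "0 < r"
  shows "(smooth_avg r w x)\<^sup>2 \<le> 2 ^ DIM('a) * unit_ball_vol DIM('a) / r ^ DIM('a) * L2_inner \<Omega> w w"
proof -
  let ?n = "DIM('a)"
  have [measurable]: "w \<in> borel_measurable M" using w by (rule L2_measurable)
  have "ennreal ((smooth_avg r w x)\<^sup>2) = (ennreal \<bar>smooth_avg r w x\<bar>)\<^sup>2" by (simp add: ennreal_power)
  also have "\<dots> \<le> (ennreal (1 / r ^ ?n) * ball_int (2 * r) (\<lambda>y. ennreal \<bar>w y\<bar>) x)\<^sup>2"
    using r w by (intro power_mono abs_smooth_avg_le L2_integrable) auto
  also have "\<dots> = (ennreal (1 / r ^ ?n))\<^sup>2 * (ball_int (2 * r) (\<lambda>y. ennreal \<bar>w y\<bar>) x)\<^sup>2"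
    by (rule power_mult_distrib)
  also have "\<dots> \<le> (ennreal (1 / r ^ ?n))\<^sup>2 * (ennreal (unit_ball_vol ?n * (2 * r) ^ ?n)
      * (\<integral>\<^sup>+y. (ennreal \<bar>w y\<bar>)\<^sup>2 \<partial>M))"
    using r by (intro mult_left_mono ball_int_square_sup) auto
  also have "(\<integral>\<^sup>+y. (ennreal \<bar>w y\<bar>)\<^sup>2 \<partial>M) = ennreal (L2_inner \<Omega> w w)"
    using nn_integral_square[OF w] by (simp add: ennreal_power)
  also have "(ennreal (1 / r ^ ?n))\<^sup>2 * (ennreal (unit_ball_vol ?n * (2 * r) ^ ?n) * ennreal (L2_inner \<Omega> w w))
      = ennreal ((1 / r ^ ?n)\<^sup>2 * (unit_ball_vol ?n * (2 * r) ^ ?n * L2_inner \<Omega> w w))"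
    using r L2_inner_self_nonneg by (intro ennreal_square_mult) auto
  finally have "(smooth_avg r w x)\<^sup>2 \<le> (1 / r ^ ?n)\<^sup>2 * (unit_ball_vol ?n * (2 * r) ^ ?n * L2_inner \<Omega> w w)"
    using r L2_inner_self_nonneg[of w] by (subst (asm) ennreal_le_iff) auto
  also have "\<dots> = 2 ^ ?n * unit_ball_vol ?n / r ^ ?n * L2_inner \<Omega> w w"
    using r by (simp add: power_mult_distrib power2_eq_square)
  finally show ?thesis .
qed

text \<open>Two volume factors cancel the normalisation, so a part with no control on its gradient
  can be averaged at every scale at bounded cost.\<close>

lemma nn_integral_smooth_avg_square_le:
  assumes w: "w \<in> L2 \<Omega>" and r: "0 < r"
  shows "(\<integral>\<^sup>+x. ennreal ((smooth_avg r w x)\<^sup>2) \<partial>M)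
    \<le> ennreal ((2 ^ DIM('a) * unit_ball_vol DIM('a))\<^sup>2 * L2_inner \<Omega> w w)"
proof -
  let ?n = "DIM('a)"
  have [measurable]: "w \<in> borel_measurable M" using w by (rule L2_measurable)
  let ?J = "ball_int (2 * r) (\<lambda>y. ennreal \<bar>w y\<bar>)"
  have [measurable]: "?J \<in> borel_measurable M"
    by (rule ball_int_measurable) measurable
  have "(\<integral>\<^sup>+x. ennreal ((smooth_avg r w x)\<^sup>2) \<partial>M) \<le> (\<integral>\<^sup>+x. (ennreal (1 / r ^ ?n))\<^sup>2 * (?J x)\<^sup>2 \<partial>M)"
  proof (rule nn_integral_mono)
    fix x
    have "ennreal ((smooth_avg r w x)\<^sup>2) = (ennreal \<bar>smooth_avg r w x\<bar>)\<^sup>2" by (simp add: ennreal_power)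
    also have "\<dots> \<le> (ennreal (1 / r ^ ?n) * ?J x)\<^sup>2"
      using r w by (intro power_mono abs_smooth_avg_le L2_integrable) auto
    finally show "ennreal ((smooth_avg r w x)\<^sup>2) \<le> (ennreal (1 / r ^ ?n))\<^sup>2 * (?J x)\<^sup>2"
      by (simp add: power_mult_distrib)
  qed
  also have "\<dots> = (ennreal (1 / r ^ ?n))\<^sup>2 * (\<integral>\<^sup>+x. (?J x)\<^sup>2 \<partial>M)"
    by (rule nn_integral_cmult) measurable
  also have "\<dots> \<le> (ennreal (1 / r ^ ?n))\<^sup>2 * ((ennreal (unit_ball_vol ?n * (2 * r) ^ ?n))\<^sup>2
      * (\<integral>\<^sup>+y. (ennreal \<bar>w y\<bar>)\<^sup>2 \<partial>M))"
    using r by (intro mult_left_mono nn_integral_ball_int_square) auto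
  also have "(\<integral>\<^sup>+y. (ennreal \<bar>w y\<bar>)\<^sup>2 \<partial>M) = ennreal (L2_inner \<Omega> w w)"
    using nn_integral_square[OF w] by (simp add: ennreal_power)
  also have "(ennreal (1 / r ^ ?n))\<^sup>2 * ((ennreal (unit_ball_vol ?n * (2 * r) ^ ?n))\<^sup>2 * ennreal (L2_inner \<Omega> w w))
      = ennreal ((1 / r ^ ?n)\<^sup>2 * ((unit_ball_vol ?n * (2 * r) ^ ?n)\<^sup>2 * L2_inner \<Omega> w w))"
    using r L2_inner_self_nonneg by (intro ennreal_square_mult) auto
  also have "(1 / r ^ ?n)\<^sup>2 * ((unit_ball_vol ?n * (2 * r) ^ ?n)\<^sup>2 * L2_inner \<Omega> w w)
      = (2 ^ ?n * unit_ball_vol ?n)\<^sup>2 * L2_inner \<Omega> w w"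
    using r by (simp add: power_mult_distrib power2_eq_square)
  finally show ?thesis .
qed

end

section \<open>Weak gradients and combinations of eigenfunctions\<close>

text \<open>While \<open>4 ^ k \<le> \<mu>\<close> the terms grow with ratio
  \<open>4 powr s > 1\<close>; afterwards they shrink with ratio \<open>4 powr (s - 1) < 1\<close>.
  Both geometric sums are therefore controlled by the terms with \<open>4 ^ k\<close> near
  \<open>\<mu>\<close>, which have size \<open>\<mu> powr s\<close>, uniformly in
  \<open>K\<close>.\<close>

lemma geometric_min_sum_le:
  fixes s \<mu> :: real
  assumes s: "0 < s" "s < 1" and \<mu>: "0 \<le> \<mu>"
  shows "(\<Sum>k<K. (4 powr s) ^ k * min 1 (\<mu> / 4 ^ k))
    \<le> (4 powr s / (4 powr s - 1) + 1 / (1 - 4 powr (s - 1))) * \<mu> powr s"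
proof (cases "\<mu> = 0")
  case False
  define P where "P = 4 powr s"
  define p where "p = 4 powr (s - 1)"
  have P: "1 < P" using s by (simp add: P_def)
  have p: "p < 1" "0 < p" using powr_less_mono[of "s - 1" 0 4] s by (auto simp: p_def)
  have Pp: "P = 4 * p" by (simp add: P_def p_def powr_diff)
  have Pk: "P ^ k = (4 ^ k) powr s" "p ^ k = (4 ^ k) powr (s - 1)" for k
    by (simp_all add: P_def p_def powr_powr mult.commute flip: powr_realpow)
  have split: "P ^ k * min 1 (\<mu> / 4 ^ k)
      = (if 4 ^ k \<le> \<mu> then P ^ k else 0) + (if 4 ^ k \<le> \<mu> then 0 else p ^ k) * \<mu>" for k
    by (auto simp: min_def Pp power_mult_distrib field_simps)
  have A: "(\<Sum>k<K. if 4 ^ k \<le> \<mu> then P ^ k else 0) \<le> P / (P - 1) * \<mu> powr s" for K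
  proof (induction K)
    case 0
    then show ?case using P by simp
  next
    case (Suc K)
    show ?case
    proof (cases "4 ^ K \<le> \<mu>")
      case True
      have "(\<Sum>k<Suc K. if 4 ^ k \<le> \<mu> then P ^ k else 0) \<le> (\<Sum>k<Suc K. P ^ k)"
        using P by (intro sum_mono) auto
      also have "\<dots> = (P ^ Suc K - 1) / (P - 1)"
        using P by (subst geometric_sum) auto
      also have "\<dots> \<le> (P * P ^ K) / (P - 1)"
        using P by (intro divide_right_mono) auto
      also have "\<dots> \<le> (P * \<mu> powr s) / (P - 1)"
        unfolding Pk using P s True by (intro divide_right_mono mult_left_mono powr_mono2) auto
      finally show ?thesis by simp
    next
      case False
      then show ?thesis using Suc by simp
    qed
  qed
  let ?S = "\<lambda>K. \<Sum>k<K. if 4 ^ k \<le> \<mu> then 0 else p ^ k"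
  have S0: "?S K = 0" if "4 ^ K \<le> \<mu>" for K
  proof (intro sum.neutral ballI)
    fix k assume "k \<in> {..<K}"
    then have "(4::real) ^ k \<le> 4 ^ K" by (intro power_increasing) auto
    then have "4 ^ k \<le> \<mu>" using that by linarith
    then show "(if 4 ^ k \<le> \<mu> then 0 else p ^ k) = 0" by simp
  qed
  have pK: "p ^ K \<le> \<mu> powr (s - 1)" if "\<mu> < 4 ^ K" for K
    unfolding Pk using that s \<mu> False by (intro powr_mono2') auto
  \<comment> \<open>The induction carries the tail \<open>p ^ K\<close> along, as
    \<open>(1 - p) * p ^ K + p ^ Suc K = p ^ K\<close>. The sum starts at the first index whose
    power of 4 exceeds \<open>\<mu>\<close>, where \<open>pK\<close> bounds that tail.\<close>
  have B: "(1 - p) * ?S K + p ^ K \<le> \<mu> powr (s - 1)" if "\<mu> < 4 ^ K" for K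
    using that
  proof (induction K)
    case 0
    then show ?case using pK[of 0] by simp
  next
    case (Suc K)
    show ?case
    proof (cases "\<mu> < 4 ^ K")
      case True
      then have "?S (Suc K) = ?S K + p ^ K" by simp
      then have "(1 - p) * ?S (Suc K) + p ^ Suc K = (1 - p) * ?S K + p ^ K"
        by (simp only:) (simp add: algebra_simps)
      then show ?thesis using Suc.IH[OF True] by simp
    next
      case False
      then have "?S (Suc K) = 0" using S0[of K] by simp
      then show ?thesis using pK[OF Suc.prems] by (simp only:)
    qed
  qed
  have "?S K \<le> \<mu> powr (s - 1) / (1 - p)" for K
  proof (cases "\<mu> < 4 ^ K")
    case True
    have "0 \<le> p ^ K" using p by simp
    then have "(1 - p) * ?S K \<le> \<mu> powr (s - 1)" using B[OF True] by linarith
    then show ?thesis using p by (simp add: pos_le_divide_eq mult.commute)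
  next
    case False
    then show ?thesis using p S0[of K] by simp
  qed
  then have "?S K * \<mu> \<le> \<mu> powr (s - 1) / (1 - p) * \<mu>"
    using \<mu> by (intro mult_right_mono)
  also have "\<dots> = 1 / (1 - p) * \<mu> powr s"
    using \<mu> False by (simp add: powr_diff)
  finally have S: "?S K * \<mu> \<le> 1 / (1 - p) * \<mu> powr s" .
  have "(\<Sum>k<K. P ^ k * min 1 (\<mu> / 4 ^ k)) = (\<Sum>k<K. if 4 ^ k \<le> \<mu> then P ^ k else 0) + ?S K * \<mu>"
    unfolding split by (simp add: sum.distrib sum_distrib_right)
  then show ?thesis
    using A[of K] S unfolding P_def p_def distrib_right by linarith
qed simp

lemma ennreal_le_suminf:
  fixes f :: "nat \<Rightarrow> ennreal"
  shows "f k \<le> suminf f"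
  using sum_le_suminf[of f "{k}"] by simp

text \<open>Pointwise form of the level-set argument, with levels \<open>B * (2 powr a) ^ k\<close>.
  If \<open>l = Suc k\<close> is the first index for which \<open>\<bar>y\<bar>\<close> is at most
  twice the level, then at index \<open>k\<close> it exceeds twice the level, while
  \<open>T k\<close> stays below the level. So \<open>(y - T k)\<^sup>2\<close> divided by the
  squared level is at least 1 and may be inserted as a factor. Bounding this one term by the whole
  series removes the dependence of \<open>k\<close> on \<open>y\<close>.\<close>

lemma dyadic_level_bound:
  fixes y B a q :: real and T :: "nat \<Rightarrow> real"
  assumes B: "0 < B" and a: "0 < a" and q: "0 < q" and T: "\<And>k. \<bar>T k\<bar> \<le> B * (2 powr a) ^ k"
  shows "ennreal (\<bar>y\<bar> powr q) \<le> ennreal ((2 * B) powr q)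
    + (\<Sum>k. ennreal ((2 * (B * (2 powr a) ^ Suc k)) powr q / (B * (2 powr a) ^ k)\<^sup>2 * (y - T k)\<^sup>2))"
    (is "_ \<le> _ + (\<Sum>k. ?t k)")
proof (cases "\<bar>y\<bar> \<le> 2 * B")
  case True
  then show ?thesis
    using q by (intro order_trans[OF _ add_increasing2[OF _ order_refl]] ennreal_leI powr_mono2) auto
next
  case False
  let ?\<tau> = "\<lambda>k. B * (2 powr a) ^ k"
  have \<tau>: "0 < ?\<tau> k" for k using B by simp
  have "1 < 2 powr a" using a by simp
  then obtain m where "\<bar>y\<bar> / (2 * B) < (2 powr a) ^ m"
    using real_arch_pow by blast
  then have m: "\<bar>y\<bar> \<le> 2 * ?\<tau> m" using B by (simp add: pos_divide_less_eq mult_ac)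
  define l where "l = (LEAST m. \<bar>y\<bar> \<le> 2 * ?\<tau> m)"
  have l: "\<bar>y\<bar> \<le> 2 * ?\<tau> l" unfolding l_def by (rule LeastI) (rule m)
  have "l \<noteq> 0" using l False by (intro notI) simp
  then obtain k where k: "l = Suc k" by (cases l) auto
  have yk: "2 * ?\<tau> k < \<bar>y\<bar>"
    using not_less_Least[of k "\<lambda>m. \<bar>y\<bar> \<le> 2 * ?\<tau> m"] k by (simp add: l_def[symmetric])
  have "?\<tau> k \<le> \<bar>y - T k\<bar>" using yk T[of k] by linarith
  then have "(?\<tau> k)\<^sup>2 \<le> (y - T k)\<^sup>2" using \<tau>[of k] by (subst abs_le_square_iff[symmetric]) linarith
  then have ge: "1 \<le> (y - T k)\<^sup>2 / (?\<tau> k)\<^sup>2"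
    using \<tau>[of k] by (subst le_divide_eq_1_pos) (auto simp del: zero_less_mult_iff)
  have "\<bar>y\<bar> powr q \<le> (2 * ?\<tau> l) powr q"
    using l q by (intro powr_mono2) auto
  also have "\<dots> \<le> (2 * ?\<tau> l) powr q * ((y - T k)\<^sup>2 / (?\<tau> k)\<^sup>2)"
    using mult_left_mono[OF ge, of "(2 * ?\<tau> l) powr q"] by simp
  finally have "ennreal (\<bar>y\<bar> powr q) \<le> ?t k"
    unfolding k times_divide_eq_right times_divide_eq_left by (rule ennreal_leI)
  also have "\<dots> \<le> (\<Sum>k. ?t k)"
    by (rule ennreal_le_suminf)
  finally show ?thesis by (simp add: add_increasing)
qed

section \<open>Linearity of weak gradients\<close>

context bounded_open_set
begin

lemma C1_test_bounded:
  assumes "C1_test \<Omega> \<psi> g"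
  obtains B where "\<And>x. x \<in> \<Omega> \<Longrightarrow> \<bar>\<psi> x\<bar> \<le> B" "\<And>x. x \<in> \<Omega> \<Longrightarrow> norm (g x) \<le> B"
    "\<psi> \<in> borel_measurable M" "g \<in> borel_measurable M"
proof -
  have g: "continuous_on UNIV g" and d: "\<And>x. GDERIV \<psi> x :> g x"
    using assms by (auto simp: C1_test_def)
  have \<psi>: "continuous_on UNIV \<psi>"
    by (intro continuous_at_imp_continuous_on ballI has_derivative_continuous[OF d[unfolded gderiv_def]])
  have K: "compact (closure \<Omega>)" using bounded_dom by (simp add: compact_closure)
  have "bounded (\<psi> ` closure \<Omega>)" "bounded (g ` closure \<Omega>)"
    using K g \<psi> by (meson compact_continuous_image compact_imp_bounded continuous_on_subset subset_UNIV)+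
  then obtain B1 B2 where B: "\<And>x. x \<in> closure \<Omega> \<Longrightarrow> norm (\<psi> x) \<le> B1" "\<And>x. x \<in> closure \<Omega> \<Longrightarrow> norm (g x) \<le> B2"
    unfolding bounded_iff by (auto simp: image_iff)
  show ?thesis
  proof (rule that[of "max B1 B2"])
    show "\<bar>\<psi> x\<bar> \<le> max B1 B2" if "x \<in> \<Omega>" for x
      using B(1)[of x] that closure_subset[of \<Omega>] by fastforce
    show "norm (g x) \<le> max B1 B2" if "x \<in> \<Omega>" for x
      using B(2)[of x] that closure_subset[of \<Omega>] by fastforce
  qed (use continuous_measurable g \<psi> in auto)
qed

lemma gradient_inner_integrable:
  assumes "has_weak_gradient \<Omega> u G" "has_weak_gradient \<Omega> v H"
  shows "integrable M (\<lambda>x. G x \<bullet> H x)"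
proof (rule Bochner_Integration.integrable_bound)
  show "integrable M (\<lambda>x. norm (G x) * norm (H x))"
    using L2_mult_integrable assms norm_gradient_L2 by blast
  show "(\<lambda>x. G x \<bullet> H x) \<in> borel_measurable M"
    using assms by (auto simp: has_weak_gradient_def)
qed (auto simp: Cauchy_Schwarz_ineq2)

lemma C1_test_integrable:
  assumes "C1_test \<Omega> \<psi> g" "has_weak_gradient \<Omega> u G"
  shows "integrable M (\<lambda>x. u x *\<^sub>R g x)" "integrable M (\<lambda>x. \<psi> x *\<^sub>R G x)"
proof -
  obtain B where B: "\<And>x. x \<in> \<Omega> \<Longrightarrow> \<bar>\<psi> x\<bar> \<le> B" "\<And>x. x \<in> \<Omega> \<Longrightarrow> norm (g x) \<le> B"
    and [measurable]: "\<psi> \<in> borel_measurable M" "g \<in> borel_measurable M"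
    using C1_test_bounded[OF assms(1)] by blast
  have [measurable]: "u \<in> borel_measurable M" "G \<in> borel_measurable M"
    using assms(2) by (auto simp: has_weak_gradient_def L2_def)
  have "integrable M u" using assms(2) by (intro L2_integrable has_weak_gradient_L2)
  then have i: "integrable M (\<lambda>x. B * u x)" "integrable M (\<lambda>x. B *\<^sub>R G x)"
    using gradient_integrable[OF assms(2)] by simp_all
  show "integrable M (\<lambda>x. u x *\<^sub>R g x)"
  proof (rule Bochner_Integration.integrable_bound[OF i(1)])
    show "AE x in M. norm (u x *\<^sub>R g x) \<le> norm (B * u x)"
    proof (rule AE_I2)
      fix x assume "x \<in> space M"
      then have "norm (g x) \<le> \<bar>B\<bar>" using B(2)[of x] by simp
      from mult_right_mono[OF this, of "\<bar>u x\<bar>"]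
      show "norm (u x *\<^sub>R g x) \<le> norm (B * u x)" by (simp add: abs_mult mult.commute)
    qed
  qed measurable
  show "integrable M (\<lambda>x. \<psi> x *\<^sub>R G x)"
  proof (rule Bochner_Integration.integrable_bound[OF i(2)])
    show "AE x in M. norm (\<psi> x *\<^sub>R G x) \<le> norm (B *\<^sub>R G x)"
    proof (rule AE_I2)
      fix x assume "x \<in> space M"
      then have "\<bar>\<psi> x\<bar> \<le> \<bar>B\<bar>" using B(1)[of x] by simp
      then show "norm (\<psi> x *\<^sub>R G x) \<le> norm (B *\<^sub>R G x)"
        by (auto intro!: mult_right_mono)
    qed
  qed measurable
qed

lemma has_weak_gradient_cmult:
  assumes "has_weak_gradient \<Omega> u G"
  shows "has_weak_gradient \<Omega> (\<lambda>x. c * u x) (\<lambda>x. c *\<^sub>R G x)"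
  unfolding has_weak_gradient_def
proof (intro conjI allI impI)
  show "(\<lambda>x. c * u x) \<in> L2 \<Omega>" "(\<lambda>x. c *\<^sub>R G x) \<in> borel_measurable M"
    "integrable M (\<lambda>x. (norm (c *\<^sub>R G x))\<^sup>2)"
    using assms L2_cmult[of u c] by (auto simp: has_weak_gradient_def power_mult_distrib)
  fix \<psi> g assume "C1_test \<Omega> \<psi> g"
  then have "(LINT x|M. u x *\<^sub>R g x) = - (LINT x|M. \<psi> x *\<^sub>R G x)"
    using assms by (auto simp: has_weak_gradient_def)
  moreover have "(LINT x|M. (c * u x) *\<^sub>R g x) = c *\<^sub>R (LINT x|M. u x *\<^sub>R g x)"
    by (simp flip: scaleR_scaleR)
  moreover have "(LINT x|M. \<psi> x *\<^sub>R c *\<^sub>R G x) = c *\<^sub>R (LINT x|M. \<psi> x *\<^sub>R G x)"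
    by (simp only: scaleR_left_commute[of _ c] integral_scaleR_right)
  ultimately show "(LINT x|M. (c * u x) *\<^sub>R g x) = - (LINT x|M. \<psi> x *\<^sub>R c *\<^sub>R G x)"
    by simp
qed

lemma has_weak_gradient_add:
  assumes u: "has_weak_gradient \<Omega> u G" and v: "has_weak_gradient \<Omega> v H"
  shows "has_weak_gradient \<Omega> (\<lambda>x. u x + v x) (\<lambda>x. G x + H x)"
  unfolding has_weak_gradient_def
proof (intro conjI allI impI)
  show "(\<lambda>x. u x + v x) \<in> L2 \<Omega>"
    using assms by (intro L2_add has_weak_gradient_L2)
  show "(\<lambda>x. G x + H x) \<in> borel_measurable M"
    using assms by (auto simp: has_weak_gradient_def)
  have "integrable M (\<lambda>x. (norm (G x))\<^sup>2 + (norm (H x))\<^sup>2 + 2 * (G x \<bullet> H x))"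
    using assms gradient_inner_integrable[OF assms] by (simp add: has_weak_gradient_def)
  then show "integrable M (\<lambda>x. (norm (G x + H x))\<^sup>2)"
    by (simp add: power2_norm_eq_inner inner_add_left inner_add_right inner_commute algebra_simps)
  fix \<psi> g assume t: "C1_test \<Omega> \<psi> g"
  then have "(LINT x|M. u x *\<^sub>R g x) = - (LINT x|M. \<psi> x *\<^sub>R G x)"
    "(LINT x|M. v x *\<^sub>R g x) = - (LINT x|M. \<psi> x *\<^sub>R H x)"
    using assms by (auto simp: has_weak_gradient_def)
  then show "(LINT x|M. (u x + v x) *\<^sub>R g x) = - (LINT x|M. \<psi> x *\<^sub>R (G x + H x))"
    using C1_test_integrable[OF t u] C1_test_integrable[OF t v]
    by (simp add: scaleR_add_left scaleR_add_right)
qed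

lemma has_weak_gradient_sum:
  assumes "finite J" "\<And>j. j \<in> J \<Longrightarrow> has_weak_gradient \<Omega> (u j) (G j)"
  shows "has_weak_gradient \<Omega> (\<lambda>x. \<Sum>j\<in>J. c j * u j x) (\<lambda>x. \<Sum>j\<in>J. c j *\<^sub>R G j x)"
  using assms
proof (induction J)
  case empty
  then show ?case by (simp add: has_weak_gradient_def L2_const)
next
  case (insert j J)
  then show ?case
    using has_weak_gradient_add[OF has_weak_gradient_cmult[of "u j" "G j" "c j"]] by simp
qed

end

section \<open>Orthogonality of the eigenfunctions and of their gradients\<close>

locale neumann_system = bounded_open_set \<Omega> for \<Omega> :: "'a::euclidean_space set" +
  fixes lam :: "nat \<Rightarrow> real" and \<phi> :: "nat \<Rightarrow> 'a \<Rightarrow> real"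
  assumes system: "neumann_eigensystem \<Omega> lam \<phi>"
begin

lemma lam_0: "lam 0 = 0" and lam_1_pos: "0 < lam 1" and lam_mono: "mono lam"
  and eigenfunction: "neumann_eigenfunction \<Omega> (lam j) (\<phi> j)"
  and basis: "orthonormal_basis_L2 \<Omega> \<phi>"
  using system by (auto simp: neumann_eigensystem_def)

lemma lam_nonneg: "0 \<le> lam j"
  using monoD[OF lam_mono, of 0 j] lam_0 by simp

lemma \<phi>_L2: "\<phi> j \<in> L2 \<Omega>"
  and \<phi>_inner: "L2_inner \<Omega> (\<phi> j) (\<phi> k) = (if j = k then 1 else 0)"
  and partial_sums_tendsto: "u \<in> L2 \<Omega> \<Longrightarrow>
    (\<lambda>N. L2_norm \<Omega> (\<lambda>x. u x - (\<Sum>j<N. L2_inner \<Omega> u (\<phi> j) * \<phi> j x))) \<longlonglongrightarrow> 0"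
  using basis by (auto simp: orthonormal_basis_L2_def)

text \<open>One gradient per eigenfunction is fixed, chosen together with the eigenvalue equation so
  that both facts concern the same function.\<close>

definition \<phi>_grad :: "nat \<Rightarrow> 'a \<Rightarrow> 'a" where
  "\<phi>_grad j = (SOME G. has_weak_gradient \<Omega> (\<phi> j) G \<and>
      (\<forall>v H. has_weak_gradient \<Omega> v H \<longrightarrow>
        (LINT x|M. G x \<bullet> H x) = lam j * L2_inner \<Omega> (\<phi> j) v))"

lemma \<phi>_grad: "has_weak_gradient \<Omega> (\<phi> j) (\<phi>_grad j)"
  and \<phi>_grad_inner: "has_weak_gradient \<Omega> v H \<Longrightarrow>
    (LINT x|M. \<phi>_grad j x \<bullet> H x) = lam j * L2_inner \<Omega> (\<phi> j) v"
  using someI_ex[OF conjunct2[OF eigenfunction[of j, unfolded neumann_eigenfunction_def]]]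
  unfolding \<phi>_grad_def by blast+

lemma inner_combination:
  assumes "finite J"
  shows "L2_inner \<Omega> (\<lambda>x. \<Sum>j\<in>J. c j * \<phi> j x) (\<phi> k) = (if k \<in> J then c k else 0)"
proof -
  have "L2_inner \<Omega> (\<lambda>x. \<Sum>j\<in>J. c j * \<phi> j x) (\<phi> k) = (\<Sum>j\<in>J. L2_inner \<Omega> (\<lambda>x. c j * \<phi> j x) (\<phi> k))"
    by (rule L2_inner_sum) (auto intro: L2_cmult \<phi>_L2)
  also have "\<dots> = (\<Sum>j\<in>J. if j = k then c j else 0)"
    by (intro sum.cong) (auto simp: L2_inner_cmult \<phi>_inner)
  finally show ?thesis using assms by simp
qed

lemma combination_L2: "(\<lambda>x. \<Sum>j\<in>J. c j * \<phi> j x) \<in> L2 \<Omega>"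
  by (intro L2_sum L2_cmult \<phi>_L2)

lemma inner_combination_self:
  assumes "finite J"
  shows "L2_inner \<Omega> (\<lambda>x. \<Sum>j\<in>J. c j * \<phi> j x) (\<lambda>x. \<Sum>j\<in>J. c j * \<phi> j x) = (\<Sum>j\<in>J. (c j)\<^sup>2)"
proof -
  let ?u = "\<lambda>x. \<Sum>j\<in>J. c j * \<phi> j x"
  have "L2_inner \<Omega> ?u ?u = (\<Sum>j\<in>J. L2_inner \<Omega> (\<lambda>x. c j * \<phi> j x) ?u)"
    by (rule L2_inner_sum) (auto intro: L2_cmult \<phi>_L2 combination_L2)
  also have "\<dots> = (\<Sum>j\<in>J. c j * L2_inner \<Omega> ?u (\<phi> j))"
    by (simp add: L2_inner_cmult L2_inner_commute[of "\<phi> _" ?u])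
  also have "\<dots> = (\<Sum>j\<in>J. (c j)\<^sup>2)"
    using assms by (intro sum.cong) (auto simp: inner_combination power2_eq_square)
  finally show ?thesis .
qed

lemma gradient_combination:
  assumes "finite J"
  shows "has_weak_gradient \<Omega> (\<lambda>x. \<Sum>j\<in>J. c j * \<phi> j x) (\<lambda>x. \<Sum>j\<in>J. c j *\<^sub>R \<phi>_grad j x)"
  using has_weak_gradient_sum[OF assms] \<phi>_grad by blast

text \<open>The combination is itself an admissible test function, so the eigenvalue equation
  applies to each of its terms and diagonalises the Dirichlet form.\<close>

lemma gradient_combination_square:
  assumes J: "finite J"
  shows "(LINT x|M. (norm (\<Sum>j\<in>J. c j *\<^sub>R \<phi>_grad j x))\<^sup>2) = (\<Sum>j\<in>J. lam j * (c j)\<^sup>2)"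
proof -
  let ?u = "\<lambda>x. \<Sum>j\<in>J. c j * \<phi> j x"
  let ?G = "\<lambda>x. \<Sum>j\<in>J. c j *\<^sub>R \<phi>_grad j x"
  note G = gradient_combination[OF J, of c]
  have "(LINT x|M. (norm (?G x))\<^sup>2) = (LINT x|M. (\<Sum>j\<in>J. c j * (\<phi>_grad j x \<bullet> ?G x)))"
    by (intro Bochner_Integration.integral_cong refl) (simp add: power2_norm_eq_inner inner_sum_left)
  also have "\<dots> = (\<Sum>j\<in>J. LINT x|M. c j * (\<phi>_grad j x \<bullet> ?G x))"
    using gradient_inner_integrable[OF \<phi>_grad G] by (intro Bochner_Integration.integral_sum) auto
  also have "\<dots> = (\<Sum>j\<in>J. c j * (lam j * L2_inner \<Omega> (\<phi> j) ?u))"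
    using \<phi>_grad_inner[OF G] by simp
  also have "\<dots> = (\<Sum>j\<in>J. lam j * (c j)\<^sup>2)"
    using J by (intro sum.cong) (auto simp: L2_inner_commute[of _ ?u] inner_combination power2_eq_square)
  finally show ?thesis .
qed

end

section \<open>Local fractional Sobolev inequality\<close>

lemma min_1_le_powr:
  fixes x s :: real
  assumes "0 \<le> x" "0 < s" "s < 1"
  shows "min 1 x \<le> x powr s"
proof (cases "1 \<le> x")
  case True
  then show ?thesis using assms ge_one_powr_ge_zero[of x s] by simp
next
  case False
  then show ?thesis using assms powr_mono'[of s 1 x] by (cases "x = 0") auto
qed

lemma square_sum3_le:
  fixes a b c :: real
  shows "(a + b + c)\<^sup>2 \<le> 3 * (a\<^sup>2 + b\<^sup>2 + c\<^sup>2)"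
  using zero_le_power2[of "a - b"] zero_le_power2[of "b - c"] zero_le_power2[of "a - c"]
  by (simp add: power2_eq_square algebra_simps)

locale neumann_piece = neumann_system \<Omega> lam \<phi> + cone_piece \<Omega> U e \<delta> h
  for \<Omega> :: "'a::euclidean_space set" and lam :: "nat \<Rightarrow> real" and \<phi> :: "nat \<Rightarrow> 'a \<Rightarrow> real"
    and U :: "'a set" and e :: 'a and \<delta> h :: real
begin

text \<open>The cut is at \<open>r\<^sup>2 * lam j = 1\<close>. Modes below it are measured by their
  gradient and enter with weight \<open>r\<^sup>2 * lam j\<close>, those above it by their L2 norm
  with weight 1; this is where the minimum comes from. Orthogonality on both sides makes the cost an
  identity.\<close>

lemma spectral_split:
  fixes c :: "nat \<Rightarrow> real"
  assumes r: "0 < r"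
  obtains v w G where "(\<lambda>x. \<Sum>j<N. c j * \<phi> j x) = (\<lambda>x. v x + w x)"
    "has_weak_gradient \<Omega> v G" "w \<in> L2 \<Omega>"
    "r\<^sup>2 * (LINT x|M. (norm (G x))\<^sup>2) + L2_inner \<Omega> w w = (\<Sum>j<N. (c j)\<^sup>2 * min 1 (r\<^sup>2 * lam j))"
proof -
  define J where "J = {j \<in> {..<N}. r\<^sup>2 * lam j \<le> 1}"
  define J' where "J' = {j \<in> {..<N}. \<not> r\<^sup>2 * lam j \<le> 1}"
  have fin: "finite J" "finite J'" "J \<inter> J' = {}" and un: "{..<N} = J \<union> J'"
    by (auto simp: J_def J'_def)
  show ?thesis
  proof (rule that)
    show "(\<lambda>x. \<Sum>j<N. c j * \<phi> j x) = (\<lambda>x. (\<Sum>j\<in>J. c j * \<phi> j x) + (\<Sum>j\<in>J'. c j * \<phi> j x))"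
      unfolding un using fin by (simp add: sum.union_disjoint)
    show "has_weak_gradient \<Omega> (\<lambda>x. \<Sum>j\<in>J. c j * \<phi> j x) (\<lambda>x. \<Sum>j\<in>J. c j *\<^sub>R \<phi>_grad j x)"
      by (rule gradient_combination) fact
    show "(\<lambda>x. \<Sum>j\<in>J'. c j * \<phi> j x) \<in> L2 \<Omega>" by (rule combination_L2)
    have "(\<Sum>j<N. (c j)\<^sup>2 * min 1 (r\<^sup>2 * lam j))
        = (\<Sum>j\<in>J. (c j)\<^sup>2 * min 1 (r\<^sup>2 * lam j)) + (\<Sum>j\<in>J'. (c j)\<^sup>2 * min 1 (r\<^sup>2 * lam j))"
      unfolding un using fin by (simp add: sum.union_disjoint)
    also have "(\<Sum>j\<in>J. (c j)\<^sup>2 * min 1 (r\<^sup>2 * lam j)) = r\<^sup>2 * (\<Sum>j\<in>J. lam j * (c j)\<^sup>2)"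
      unfolding sum_distrib_left by (intro sum.cong) (auto simp: J_def)
    also have "(\<Sum>j\<in>J'. (c j)\<^sup>2 * min 1 (r\<^sup>2 * lam j)) = (\<Sum>j\<in>J'. (c j)\<^sup>2)"
      by (intro sum.cong) (auto simp: J'_def)
    finally show "r\<^sup>2 * (LINT x|M. (norm (\<Sum>j\<in>J. c j *\<^sub>R \<phi>_grad j x))\<^sup>2)
        + L2_inner \<Omega> (\<lambda>x. \<Sum>j\<in>J'. c j * \<phi> j x) (\<lambda>x. \<Sum>j\<in>J'. c j * \<phi> j x)
        = (\<Sum>j<N. (c j)\<^sup>2 * min 1 (r\<^sup>2 * lam j))"
      using fin by (simp add: gradient_combination_square inner_combination_self)
  qed
qed

text \<open>The low part changes little between the radii \<open>r\<close> and \<open>r / 2\<close>,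
  whereas the high part is bounded at each radius separately. The factor 6 is 3 from squaring a sum
  of three terms, times 2 for the two high-frequency terms.\<close>

lemma combination_avg_step:
  assumes x: "x \<in> U" and r: "0 < r" "r \<le> h"
  shows "(smooth_avg r (\<lambda>x. \<Sum>j<N. c j * \<phi> j x) x - smooth_avg (r / 2) (\<lambda>x. \<Sum>j<N. c j * \<phi> j x) x)\<^sup>2
    \<le> 6 * 8 ^ DIM('a) * unit_ball_vol DIM('a) / r ^ DIM('a) * (\<Sum>j<N. (c j)\<^sup>2 * min 1 (r\<^sup>2 * lam j))"
proof -
  let ?n = "DIM('a)" let ?\<omega> = "unit_ball_vol DIM('a)"
  obtain v w G where u: "(\<lambda>x. \<Sum>j<N. c j * \<phi> j x) = (\<lambda>x. v x + w x)"
    and G: "has_weak_gradient \<Omega> v G" and w: "w \<in> L2 \<Omega>"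
    and D: "r\<^sup>2 * (LINT x|M. (norm (G x))\<^sup>2) + L2_inner \<Omega> w w = (\<Sum>j<N. (c j)\<^sup>2 * min 1 (r\<^sup>2 * lam j))"
    by (rule spectral_split[OF r(1), of c N])
  let ?g = "LINT x|M. (norm (G x))\<^sup>2"
  have g0: "0 \<le> ?g" by (rule Bochner_Integration.integral_nonneg) simp
  have vi: "integrable M v" "integrable M w"
    using has_weak_gradient_L2[OF G] w by (auto intro: L2_integrable)
  let ?a = "smooth_avg r v x - smooth_avg (r / 2) v x"
  let ?K = "8 ^ ?n * ?\<omega> / r ^ ?n"
  have K0: "0 \<le> ?K" using r by simp
  have a: "?a\<^sup>2 \<le> ?K * (r\<^sup>2 * ?g)"
    by (rule smooth_avg_diff_square_le[OF G x r])
  have "2 ^ ?n * ?\<omega> / r ^ ?n \<le> ?K"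
    using r by (intro divide_right_mono mult_right_mono power_mono) auto
  then have b: "(smooth_avg r w x)\<^sup>2 \<le> ?K * L2_inner \<Omega> w w"
    using smooth_avg_square_le[OF w r(1), of x] L2_inner_self_nonneg[of w]
    by (meson mult_right_mono order_trans)
  have "2 ^ ?n * ?\<omega> / (r / 2) ^ ?n = 4 ^ ?n * ?\<omega> / r ^ ?n"
    by (simp add: power_divide flip: power_mult_distrib)
  also have "\<dots> \<le> ?K"
    using r by (intro divide_right_mono mult_right_mono power_mono) auto
  finally have c: "(smooth_avg (r / 2) w x)\<^sup>2 \<le> ?K * L2_inner \<Omega> w w"
    using smooth_avg_square_le[OF w, of "r / 2" x] L2_inner_self_nonneg[of w] r
    by (meson half_gt_zero mult_right_mono order_trans)
  have "(smooth_avg r (\<lambda>x. v x + w x) x - smooth_avg (r / 2) (\<lambda>x. v x + w x) x)\<^sup>2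
      = (?a + smooth_avg r w x + - smooth_avg (r / 2) w x)\<^sup>2"
    by (simp add: smooth_avg_add vi algebra_simps)
  also have "\<dots> \<le> 3 * (?a\<^sup>2 + (smooth_avg r w x)\<^sup>2 + (- smooth_avg (r / 2) w x)\<^sup>2)"
    by (rule square_sum3_le)
  also have "\<dots> \<le> 3 * (?K * (r\<^sup>2 * ?g) + ?K * L2_inner \<Omega> w w + ?K * L2_inner \<Omega> w w)"
    unfolding power2_minus by (intro mult_left_mono add_mono a b c) simp
  also have "\<dots> \<le> 6 * (?K * (r\<^sup>2 * ?g + L2_inner \<Omega> w w))"
    using mult_nonneg_nonneg[OF K0 mult_nonneg_nonneg[OF zero_le_power2[of r] g0]]
    by (simp only: distrib_left)
  finally show ?thesis unfolding u D by (simp add: mult.assoc)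
qed

text \<open>The low part is compared with its average through the gradient. For the high part the
  function and its average are estimated separately, both in L2 with constants independent of
  \<open>r\<close>.\<close>

lemma combination_avg_error:
  assumes r: "0 < r" "r \<le> h"
  shows "(\<integral>\<^sup>+x. indicator U x * ennreal ((bump_mass * (\<Sum>j<N. c j * \<phi> j x)
      - smooth_avg r (\<lambda>x. \<Sum>j<N. c j * \<phi> j x) x)\<^sup>2) \<partial>M)
    \<le> ennreal (3 * (4 * (4 ^ DIM('a) * unit_ball_vol DIM('a))\<^sup>2 + bump_mass\<^sup>2
        + (2 ^ DIM('a) * unit_ball_vol DIM('a))\<^sup>2) * (\<Sum>j<N. (c j)\<^sup>2 * min 1 (r\<^sup>2 * lam j)))"
proof -
  let ?n = "DIM('a)" let ?\<omega> = "unit_ball_vol DIM('a)"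
  obtain v w G where u: "(\<lambda>x. \<Sum>j<N. c j * \<phi> j x) = (\<lambda>x. v x + w x)"
    and G: "has_weak_gradient \<Omega> v G" and w: "w \<in> L2 \<Omega>"
    and D: "r\<^sup>2 * (LINT x|M. (norm (G x))\<^sup>2) + L2_inner \<Omega> w w = (\<Sum>j<N. (c j)\<^sup>2 * min 1 (r\<^sup>2 * lam j))"
    by (rule spectral_split[OF r(1), of c N])
  let ?g = "LINT x|M. (norm (G x))\<^sup>2"
  have g0: "0 \<le> ?g" by (rule Bochner_Integration.integral_nonneg) simp
  note w0 = L2_inner_self_nonneg[of w]
  have vi: "integrable M v" "integrable M w"
    using has_weak_gradient_L2[OF G] w by (auto intro: L2_integrable)
  have [measurable]: "v \<in> borel_measurable M" "w \<in> borel_measurable M"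
    using has_weak_gradient_L2[OF G] w by (auto intro: L2_measurable)
  let ?T = "smooth_avg r"
  have "(\<integral>\<^sup>+x. indicator U x * ennreal ((bump_mass * (v x + w x) - ?T (\<lambda>x. v x + w x) x)\<^sup>2) \<partial>M)
      \<le> (\<integral>\<^sup>+x. 3 * (indicator U x * ennreal ((bump_mass * v x - ?T v x)\<^sup>2)
          + ennreal (bump_mass\<^sup>2) * ennreal ((w x)\<^sup>2) + ennreal ((?T w x)\<^sup>2)) \<partial>M)"
  proof (rule nn_integral_mono)
    fix x
    have "(bump_mass * (v x + w x) - ?T (\<lambda>x. v x + w x) x)\<^sup>2
        = ((bump_mass * v x - ?T v x) + bump_mass * w x + - ?T w x)\<^sup>2"
      by (simp add: smooth_avg_add vi algebra_simps)
    also have "\<dots> \<le> 3 * ((bump_mass * v x - ?T v x)\<^sup>2 + (bump_mass * w x)\<^sup>2 + (- ?T w x)\<^sup>2)"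
      by (rule square_sum3_le)
    finally have "ennreal ((bump_mass * (v x + w x) - ?T (\<lambda>x. v x + w x) x)\<^sup>2)
        \<le> ennreal (3 * ((bump_mass * v x - ?T v x)\<^sup>2 + bump_mass\<^sup>2 * (w x)\<^sup>2 + (?T w x)\<^sup>2))"
      unfolding power2_minus power_mult_distrib by (rule ennreal_leI)
    also have "\<dots> = 3 * (ennreal ((bump_mass * v x - ?T v x)\<^sup>2)
          + ennreal (bump_mass\<^sup>2) * ennreal ((w x)\<^sup>2) + ennreal ((?T w x)\<^sup>2))"
      by (simp add: ennreal_mult)
    finally show "indicator U x * ennreal ((bump_mass * (v x + w x) - ?T (\<lambda>x. v x + w x) x)\<^sup>2)
        \<le> 3 * (indicator U x * ennreal ((bump_mass * v x - ?T v x)\<^sup>2)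
          + ennreal (bump_mass\<^sup>2) * ennreal ((w x)\<^sup>2) + ennreal ((?T w x)\<^sup>2))"
      by (auto simp: indicator_def)
  qed
  also have "\<dots> = 3 * ((\<integral>\<^sup>+x. indicator U x * ennreal ((bump_mass * v x - ?T v x)\<^sup>2) \<partial>M)
      + ennreal (bump_mass\<^sup>2) * (\<integral>\<^sup>+x. ennreal ((w x)\<^sup>2) \<partial>M) + (\<integral>\<^sup>+x. ennreal ((?T w x)\<^sup>2) \<partial>M))"
    by (simp add: nn_integral_cmult nn_integral_add)
  also have "\<dots> \<le> 3 * (ennreal (4 * (4 ^ ?n * ?\<omega> * r)\<^sup>2 * ?g)
      + ennreal (bump_mass\<^sup>2) * ennreal (L2_inner \<Omega> w w)
      + ennreal ((2 ^ ?n * ?\<omega>)\<^sup>2 * L2_inner \<Omega> w w))"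
    by (intro mult_left_mono add_mono smooth_avg_error_square[OF G r]
        nn_integral_smooth_avg_square_le[OF w r(1)]) (auto simp: nn_integral_square[OF w])
  also have "\<dots> = ennreal (3 * (4 * (4 ^ ?n * ?\<omega> * r)\<^sup>2 * ?g + bump_mass\<^sup>2 * L2_inner \<Omega> w w
      + (2 ^ ?n * ?\<omega>)\<^sup>2 * L2_inner \<Omega> w w))"
  proof -
    have "3 * (ennreal a + ennreal b * ennreal c + ennreal d) = ennreal (3 * (a + b * c + d))"
      if "0 \<le> a" "0 \<le> b" "0 \<le> c" "0 \<le> d" for a b c d :: real
      using that by (simp add: ennreal_mult)
    then show ?thesis
      using g0 w0 by simp
  qed
  also have "\<dots> \<le> ennreal (3 * (4 * (4 ^ ?n * ?\<omega>)\<^sup>2 + bump_mass\<^sup>2 + (2 ^ ?n * ?\<omega>)\<^sup>2)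
      * (r\<^sup>2 * ?g + L2_inner \<Omega> w w))"
  proof (rule ennreal_leI)
    define A B C where "A = 4 * (4 ^ ?n * ?\<omega>)\<^sup>2" and "B = bump_mass\<^sup>2" and "C = (2 ^ ?n * ?\<omega>)\<^sup>2"
    have nn: "0 \<le> A" "0 \<le> B" "0 \<le> C" "0 \<le> r\<^sup>2 * ?g" using g0 by (auto simp: A_def B_def C_def)
    have eq: "4 * (4 ^ ?n * ?\<omega> * r)\<^sup>2 * ?g = A * (r\<^sup>2 * ?g)"
      by (simp add: A_def power_mult_distrib)
    have "0 \<le> A * L2_inner \<Omega> w w" "0 \<le> B * (r\<^sup>2 * ?g)" "0 \<le> C * (r\<^sup>2 * ?g)"
      using nn w0 by simp_all
    then show "3 * (4 * (4 ^ ?n * ?\<omega> * r)\<^sup>2 * ?g + bump_mass\<^sup>2 * L2_inner \<Omega> w w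
        + (2 ^ ?n * ?\<omega>)\<^sup>2 * L2_inner \<Omega> w w)
      \<le> 3 * (4 * (4 ^ ?n * ?\<omega>)\<^sup>2 + bump_mass\<^sup>2 + (2 ^ ?n * ?\<omega>)\<^sup>2) * (r\<^sup>2 * ?g + L2_inner \<Omega> w w)"
      unfolding eq A_def[symmetric] B_def[symmetric] C_def[symmetric] distrib_left distrib_right
      by linarith
  qed
  also have "\<dots> = ennreal (3 * (4 * (4 ^ ?n * ?\<omega>)\<^sup>2 + bump_mass\<^sup>2 + (2 ^ ?n * ?\<omega>)\<^sup>2)
      * (\<Sum>j<N. (c j)\<^sup>2 * min 1 (r\<^sup>2 * lam j)))"
    unfolding D ..
  finally show ?thesis using u by (simp add: fun_eq_iff)
qed

text \<open>The Chemin--Xu argument: at the level \<open>\<tau> k = B * 2 powr (a * k)\<close> only the part of the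
  function oscillating below the scale \<open>h / 2 ^ k\<close> matters.\<close>

lemma local_embedding:
  fixes s E :: real
  assumes s: "0 < s" "s < 1" "2 * s < DIM('a)" and E: "0 \<le> E"
  defines "q \<equiv> 2 * real DIM('a) / (real DIM('a) - 2 * s)"
  obtains C where "0 \<le> C" "\<And>N c. (\<Sum>j<N. (c j)\<^sup>2) \<le> E \<Longrightarrow> (\<Sum>j<N. lam j powr s * (c j)\<^sup>2) \<le> E \<Longrightarrow>
    (\<integral>\<^sup>+x. indicator U x * ennreal (\<bar>\<Sum>j<N. c j * \<phi> j x\<bar> powr q) \<partial>M) \<le> ennreal C"
proof -
  let ?n = "DIM('a)" let ?\<omega> = "unit_ball_vol DIM('a)"
  \<comment> \<open>Averages at scale \<open>h / 2 ^ k\<close> may grow like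
    \<open>2 powr (a * k)\<close>, since their squared increments carry
    \<open>1 / r ^ DIM('a)\<close> against a cost of order \<open>r powr (2 * s)\<close>. The
    critical exponent is the one with \<open>a * (q - 2) = 2 * s\<close>.\<close>
  define a where "a = real ?n / 2 - s"
  have a: "0 < a" using s by (simp add: a_def)
  define t where "t = 2 powr a"
  have t: "1 < t" using a by (simp add: t_def)
  have q: "0 < q" and aq: "a * (q - 2) = 2 * s"
    using s by (auto simp: q_def a_def field_simps)
  define K1 where "K1 = 6 * 8 ^ ?n * ?\<omega>"
  define K2 where "K2 = 3 * (4 * (4 ^ ?n * ?\<omega>)\<^sup>2 + bump_mass\<^sup>2 + (2 ^ ?n * ?\<omega>)\<^sup>2)"
  have K: "0 \<le> K1" "0 \<le> K2" by (auto simp: K1_def K2_def)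
  \<comment> \<open>\<open>B1\<close> covers the average at the coarsest scale and
    \<open>B2 * (t - 1)\<close> the increments. Since
    \<open>B * t ^ k + B * (t - 1) * t ^ k = B * t ^ Suc k\<close>, the bound
    \<open>B * t ^ k\<close> propagates to all scales; the entry 1 keeps \<open>B\<close>
    positive.\<close>
  define B1 where "B1 = sqrt (2 ^ ?n * ?\<omega> / h ^ ?n * E)"
  define B2 where "B2 = sqrt (K1 * E) * h powr (- a) / (t - 1)"
  define B where "B = max 1 (max B1 B2)"
  have B: "0 < B" "B1 \<le> B" "B2 \<le> B" by (auto simp: B_def)
  define K3 where "K3 = (2 * B * t) powr q / B\<^sup>2"
  have K3: "0 \<le> K3" by (simp add: K3_def)
  define C4 where "C4 = 4 powr s / (4 powr s - 1) + 1 / (1 - 4 powr (s - 1))"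
  have C4: "0 \<le> C4"
    using s powr_less_mono[of "s - 1" 0 4] ge_one_powr_ge_zero[of 4 s] by (auto simp: C4_def intro!: add_nonneg_nonneg divide_nonneg_nonneg)
  define R where "R = (2 * B) powr q * measure M (space M) + K3 * K2 * (C4 * (h\<^sup>2 powr s * E))"
  have R: "0 \<le> R"
    using K K3 C4 E by (auto simp: R_def intro!: add_nonneg_nonneg mult_nonneg_nonneg)
  define rk where "rk k = h / 2 ^ k" for k :: nat
  have rk: "0 < rk k" "rk k \<le> h" "rk (Suc k) = rk k / 2" "rk 0 = h" "(rk k)\<^sup>2 = h\<^sup>2 / 4 ^ k" for k
  proof -
    show "0 < rk k" "rk (Suc k) = rk k / 2" "rk 0 = h" using h_pos by (auto simp: rk_def)
    have "rk k \<le> h / 1" unfolding rk_def using h_pos by (intro divide_left_mono) auto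
    then show "rk k \<le> h" by simp
    have "((2::real) ^ k)\<^sup>2 = 4 ^ k"
      by (simp add: power2_eq_square flip: power_mult_distrib)
    then show "(rk k)\<^sup>2 = h\<^sup>2 / 4 ^ k" by (simp add: rk_def power_divide)
  qed
  \<comment> \<open>Criticality enters here: the weights grow exactly like
    \<open>(4 powr s) ^ k\<close>, the inverse of the decay of the spectral cost at scale
    \<open>h / 2 ^ k\<close>.\<close>
  have w_eq: "(2 * (B * t ^ Suc k)) powr q / (B * t ^ k)\<^sup>2 = K3 * (4 powr s) ^ k" for k
  proof -
    have "(2 * (B * t ^ Suc k)) powr q = (2 * B * t) powr q * (t ^ k) powr q"
      using B t by (simp add: powr_mult[symmetric] mult_ac)
    moreover have "(t ^ k) powr q / (t ^ k)\<^sup>2 = (4 powr s) ^ k"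
    proof -
      have "(t ^ k) powr q / (t ^ k)\<^sup>2 = (t ^ k) powr (q - 2)"
        using t by (simp add: powr_diff)
      also have "\<dots> = (2 powr (a * (q - 2))) ^ k"
        by (simp add: t_def powr_powr mult_ac flip: powr_realpow)
      also have "2 powr (a * (q - 2)) = 4 powr s"
        unfolding aq using powr_powr[of 2 2 s] by simp
      finally show ?thesis .
    qed
    ultimately show ?thesis by (simp add: K3_def power_mult_distrib flip: times_divide_times_eq)
  qed
  have main: "(\<integral>\<^sup>+x. indicator U x * ennreal (\<bar>bump_mass * u x\<bar> powr q) \<partial>M) \<le> ennreal R"
    if u: "u = (\<lambda>x. \<Sum>j<N. c j * \<phi> j x)"
      and c1: "(\<Sum>j<N. (c j)\<^sup>2) \<le> E" and c2: "(\<Sum>j<N. lam j powr s * (c j)\<^sup>2) \<le> E" for u N c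
  proof -
    have uL: "u \<in> L2 \<Omega>" unfolding u by (rule combination_L2)
    have [measurable]: "u \<in> borel_measurable M" using uL by (rule L2_measurable)
    define D where "D k = (\<Sum>j<N. (c j)\<^sup>2 * min 1 ((rk k)\<^sup>2 * lam j))" for k
    have D0: "0 \<le> D k" for k
      using lam_nonneg by (auto simp: D_def intro!: sum_nonneg)
    have D_le: "D k \<le> rk k powr (2 * s) * E" for k
    proof -
      have "D k \<le> (\<Sum>j<N. (c j)\<^sup>2 * ((rk k)\<^sup>2 * lam j) powr s)"
        unfolding D_def using s lam_nonneg by (intro sum_mono mult_left_mono min_1_le_powr) auto
      also have "\<dots> = (\<Sum>j<N. rk k powr (2 * s) * (lam j powr s * (c j)\<^sup>2))"
      proof (intro sum.cong refl)
        fix j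
        have "(rk k)\<^sup>2 powr s = rk k powr (2 * s)"
          using rk(1)[of k] powr_powr[of "rk k" 2 s] by simp
        then show "(c j)\<^sup>2 * ((rk k)\<^sup>2 * lam j) powr s = rk k powr (2 * s) * (lam j powr s * (c j)\<^sup>2)"
          using lam_nonneg by (simp add: powr_mult)
      qed
      also have "\<dots> = rk k powr (2 * s) * (\<Sum>j<N. lam j powr s * (c j)\<^sup>2)"
        by (simp add: sum_distrib_left)
      also have "\<dots> \<le> rk k powr (2 * s) * E"
        using c2 by (intro mult_left_mono) auto
      finally show ?thesis .
    qed
    have T_bound: "\<bar>smooth_avg (rk k) u x\<bar> \<le> B * t ^ k" if x: "x \<in> U" for x k
    proof (induction k)
      case 0
      have "(smooth_avg h u x)\<^sup>2 \<le> 2 ^ ?n * ?\<omega> / h ^ ?n * L2_inner \<Omega> u u"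
        by (rule smooth_avg_square_le[OF uL h_pos])
      also have "L2_inner \<Omega> u u = (\<Sum>j<N. (c j)\<^sup>2)"
        unfolding u by (rule inner_combination_self) simp
      also have "2 ^ ?n * ?\<omega> / h ^ ?n * (\<Sum>j<N. (c j)\<^sup>2) \<le> 2 ^ ?n * ?\<omega> / h ^ ?n * E"
        using h_pos by (intro mult_left_mono c1) auto
      finally have "\<bar>smooth_avg h u x\<bar> \<le> B1"
        unfolding B1_def by (intro real_le_rsqrt) simp
      then show ?case using B rk by simp
    next
      case (Suc k)
      let ?d = "smooth_avg (rk k) u x - smooth_avg (rk (Suc k)) u x"
      have r0: "0 < rk k" by (rule rk)
      have "?d\<^sup>2 \<le> K1 / rk k ^ ?n * D k"
        unfolding u D_def K1_def rk(3) by (rule combination_avg_step[OF x rk(1,2)])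
      also have "\<dots> \<le> K1 / rk k ^ ?n * (rk k powr (2 * s) * E)"
        using r0 K by (intro mult_left_mono D_le) auto
      also have "\<dots> = K1 * E * (rk k powr (- a))\<^sup>2"
      proof -
        have "(rk k powr (- a))\<^sup>2 = rk k powr (2 * s - real ?n)"
          using r0 by (simp add: power2_eq_square a_def flip: powr_add)
        also have "\<dots> = rk k powr (2 * s) / rk k ^ ?n"
          using r0 by (simp add: powr_diff powr_realpow)
        finally show ?thesis by simp
      qed
      also have "\<dots> = (sqrt (K1 * E) * rk k powr (- a))\<^sup>2"
        using K E by (simp add: power_mult_distrib)
      finally have "\<bar>?d\<bar> \<le> \<bar>sqrt (K1 * E) * rk k powr (- a)\<bar>"
        by (rule abs_le_square_iff[THEN iffD2])
      also have "\<dots> = sqrt (K1 * E) * rk k powr (- a)"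
        using K E by simp
      also have "rk k powr (- a) = h powr (- a) * t ^ k"
      proof -
        have "rk k powr (- a) = h powr (- a) / (2 ^ k) powr (- a)"
          unfolding rk_def using h_pos by (simp add: powr_divide)
        also have "(2 ^ k) powr (- a) = 1 / (2 ^ k) powr a"
          by (simp add: powr_minus_divide)
        also have "(2 ^ k) powr a = t ^ k"
          by (simp add: t_def powr_powr mult_ac flip: powr_realpow)
        finally show ?thesis by simp
      qed
      also have "sqrt (K1 * E) * (h powr (- a) * t ^ k) = B2 * (t - 1) * t ^ k"
        using t by (simp add: B2_def)
      also have "\<dots> \<le> B * (t - 1) * t ^ k"
        using B t by (intro mult_right_mono) auto
      finally have "\<bar>?d\<bar> \<le> B * (t - 1) * t ^ k" .
      then show ?case using Suc by (simp add: algebra_simps)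
    qed
    let ?e = "\<lambda>k x. indicator U x * ennreal ((bump_mass * u x - smooth_avg (rk k) u x)\<^sup>2)"
    have "(\<integral>\<^sup>+x. indicator U x * ennreal (\<bar>bump_mass * u x\<bar> powr q) \<partial>M)
      \<le> (\<integral>\<^sup>+x. ennreal ((2 * B) powr q) + (\<Sum>k. ennreal (K3 * (4 powr s) ^ k) * ?e k x) \<partial>M)"
    proof (rule nn_integral_mono)
      fix x
      show "indicator U x * ennreal (\<bar>bump_mass * u x\<bar> powr q)
          \<le> ennreal ((2 * B) powr q) + (\<Sum>k. ennreal (K3 * (4 powr s) ^ k) * ?e k x)"
      proof (cases "x \<in> U")
        case True
        have "ennreal (\<bar>bump_mass * u x\<bar> powr q) \<le> ennreal ((2 * B) powr q)
          + (\<Sum>k. ennreal ((2 * (B * t ^ Suc k)) powr q / (B * t ^ k)\<^sup>2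
              * (bump_mass * u x - smooth_avg (rk k) u x)\<^sup>2))"
          unfolding t_def by (rule dyadic_level_bound[OF B(1) a q]) (use T_bound[OF True] in \<open>simp add: t_def\<close>)
        then show ?thesis
          unfolding w_eq using True K3 by (simp add: ennreal_mult)
      qed simp
    qed
    also have "\<dots> = ennreal ((2 * B) powr q) * emeasure M (space M)
        + (\<integral>\<^sup>+x. (\<Sum>k. ennreal (K3 * (4 powr s) ^ k) * ?e k x) \<partial>M)"
      by (subst nn_integral_add) (simp_all del: space_restrict_space)
    also have "(\<integral>\<^sup>+x. (\<Sum>k. ennreal (K3 * (4 powr s) ^ k) * ?e k x) \<partial>M)
        = (\<Sum>k. \<integral>\<^sup>+x. ennreal (K3 * (4 powr s) ^ k) * ?e k x \<partial>M)"
      by (rule nn_integral_suminf) measurable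
    also have "\<dots> = (\<Sum>k. ennreal (K3 * (4 powr s) ^ k) * (\<integral>\<^sup>+x. ?e k x \<partial>M))"
      by (intro suminf_cong nn_integral_cmult) measurable
    also have "\<dots> \<le> (\<Sum>k. ennreal (K3 * (4 powr s) ^ k) * ennreal (K2 * D k))"
      unfolding u K2_def D_def
      by (intro suminf_le mult_left_mono combination_avg_error rk) auto
    \<comment> \<open>Inserting \<open>D_le\<close> scale by scale would leave terms of constant
      size and a divergent series. Exchanging the sums lets the scales be summed first, for each
      eigenvalue separately.\<close>
    also have "\<dots> \<le> ennreal (K3 * K2 * (C4 * (h\<^sup>2 powr s * E)))"
      unfolding suminf_eq_SUP
    proof (rule SUP_least)
      fix m :: nat
      have "(\<Sum>k<m. ennreal (K3 * (4 powr s) ^ k) * ennreal (K2 * D k))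
          = ennreal (\<Sum>k<m. K3 * (4 powr s) ^ k * (K2 * D k))"
        using K K3 D0 by (subst sum_ennreal[symmetric]) (auto simp: ennreal_mult intro!: sum.cong)
      also have "(\<Sum>k<m. K3 * (4 powr s) ^ k * (K2 * D k)) = K3 * K2 * (\<Sum>k<m. (4 powr s) ^ k * D k)"
        by (simp add: sum_distrib_left mult_ac)
      also have "(\<Sum>k<m. (4 powr s) ^ k * D k)
          = (\<Sum>j<N. (c j)\<^sup>2 * (\<Sum>k<m. (4 powr s) ^ k * min 1 (h\<^sup>2 * lam j / 4 ^ k)))"
        unfolding D_def rk(5) sum_distrib_left by (subst sum.swap) (simp add: mult_ac)
      finally have eq: "(\<Sum>k<m. ennreal (K3 * (4 powr s) ^ k) * ennreal (K2 * D k))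
        = ennreal (K3 * K2 * (\<Sum>j<N. (c j)\<^sup>2 * (\<Sum>k<m. (4 powr s) ^ k * min 1 (h\<^sup>2 * lam j / 4 ^ k))))" .
      have "(\<Sum>j<N. (c j)\<^sup>2 * (\<Sum>k<m. (4 powr s) ^ k * min 1 (h\<^sup>2 * lam j / 4 ^ k)))
          \<le> (\<Sum>j<N. (c j)\<^sup>2 * (C4 * (h\<^sup>2 * lam j) powr s))"
        unfolding C4_def using s lam_nonneg
        by (intro sum_mono mult_left_mono geometric_min_sum_le) auto
      also have "\<dots> = C4 * (h\<^sup>2 powr s * (\<Sum>j<N. lam j powr s * (c j)\<^sup>2))"
        using lam_nonneg by (simp add: powr_mult sum_distrib_left mult_ac)
      also have "\<dots> \<le> C4 * (h\<^sup>2 powr s * E)"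
        using C4 c2 by (intro mult_left_mono) auto
      finally show "(\<Sum>k<m. ennreal (K3 * (4 powr s) ^ k) * ennreal (K2 * D k))
          \<le> ennreal (K3 * K2 * (C4 * (h\<^sup>2 powr s * E)))"
        unfolding eq using K K3 by (intro ennreal_leI mult_left_mono) auto
    qed
    finally have "(\<integral>\<^sup>+x. indicator U x * ennreal (\<bar>bump_mass * u x\<bar> powr q) \<partial>M)
      \<le> ennreal ((2 * B) powr q) * emeasure M (space M) + ennreal (K3 * K2 * (C4 * (h\<^sup>2 powr s * E)))"
      by (simp add: add_left_mono)
    also have "\<dots> = ennreal R"
      unfolding R_def using K K3 C4 E
      by (simp add: emeasure_eq_measure ennreal_mult[symmetric] ennreal_plus[symmetric] del: space_restrict_space ennreal_plus)
    finally show ?thesis .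
  qed
  show ?thesis
  proof (rule that[of "R / bump_mass powr q"])
    show "0 \<le> R / bump_mass powr q" using R by simp
    fix N c
    assume c1: "(\<Sum>j<N. (c j)\<^sup>2) \<le> E" and c2: "(\<Sum>j<N. lam j powr s * (c j)\<^sup>2) \<le> E"
    let ?u = "\<lambda>x. \<Sum>j<N. c j * \<phi> j x"
    have [measurable]: "?u \<in> borel_measurable M" by (intro L2_measurable combination_L2)
    \<comment> \<open>The estimate \<open>main\<close> controls \<open>bump_mass * u\<close>;
      homogeneity of degree \<open>q\<close> removes the factor.\<close>
    let ?z = "1 / bump_mass powr q"
    have "(\<integral>\<^sup>+x. indicator U x * ennreal (\<bar>?u x\<bar> powr q) \<partial>M)
        = (\<integral>\<^sup>+x. ennreal ?z * (indicator U x * ennreal (\<bar>bump_mass * ?u x\<bar> powr q)) \<partial>M)"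
    proof (rule nn_integral_cong)
      fix x
      have "\<bar>?u x\<bar> powr q = ?z * \<bar>bump_mass * ?u x\<bar> powr q"
        using bump_mass_pos by (simp add: abs_mult powr_mult)
      then have "ennreal (\<bar>?u x\<bar> powr q) = ennreal ?z * ennreal (\<bar>bump_mass * ?u x\<bar> powr q)"
        by (simp only: ennreal_mult[symmetric] powr_ge_zero divide_nonneg_nonneg zero_le_one)
      then show "indicator U x * ennreal (\<bar>?u x\<bar> powr q)
          = ennreal ?z * (indicator U x * ennreal (\<bar>bump_mass * ?u x\<bar> powr q))"
        by (simp only: mult.left_commute)
    qed
    also have "\<dots> = ennreal ?z * (\<integral>\<^sup>+x. indicator U x * ennreal (\<bar>bump_mass * ?u x\<bar> powr q) \<partial>M)"
      by (rule nn_integral_cmult) measurable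
    also have "\<dots> \<le> ennreal ?z * ennreal R"
      by (intro mult_left_mono main[OF refl c1 c2]) simp
    also have "\<dots> = ennreal (R / bump_mass powr q)"
      using R by (simp flip: ennreal_mult')
    finally show "(\<integral>\<^sup>+x. indicator U x * ennreal (\<bar>?u x\<bar> powr q) \<partial>M) \<le> ennreal (R / bump_mass powr q)" .
  qed
qed

end

section \<open>Embedding of the fractional Sobolev space\<close>

lemma powr_le_1_plus_powr:
  fixes x t s :: real
  assumes "0 \<le> x" "t \<le> s" "0 < t"
  shows "x powr t \<le> 1 + x powr s"
proof (cases "1 \<le> x")
  case True
  then have "x powr t \<le> x powr s" using assms by (intro powr_mono) auto
  then show ?thesis by simp
next
  case False
  then have "x powr t \<le> 1" using assms powr_le1[of t x] by simp
  then show ?thesis by (simp add: add_increasing2)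
qed

text \<open>Near a boundary point the direction of the graph representation works: a step
  \<open>\<rho> *\<^sub>R (e + w)\<close> raises the height by at least
  \<open>\<rho> * (1 - \<delta>)\<close> and shifts the base point by at most
  \<open>2 * \<rho> * \<delta>\<close>, so the graph rises by at most
  \<open>2 * L * \<rho> * \<delta>\<close>. At a point of the open set any unit vector will
  do.\<close>

lemma lipschitz_domain_cone:
  fixes \<Omega> :: "'a::euclidean_space set"
  assumes lip: "lipschitz_domain \<Omega>" and p: "p \<in> closure \<Omega>"
  obtains e \<delta> h where "norm e = 1" "0 < \<delta>" "\<delta> \<le> 1" "0 < h"
    "\<And>x \<rho> w. x \<in> \<Omega> \<inter> ball p h \<Longrightarrow> 0 < \<rho> \<Longrightarrow> \<rho> \<le> h \<Longrightarrow> norm w \<le> \<delta> \<Longrightarrow> x + \<rho> *\<^sub>R (e + w) \<in> \<Omega>"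
proof -
  have op: "open \<Omega>" using lip by (simp add: lipschitz_domain_def)
  \<comment> \<open>The step has length at most \<open>d / 2\<close> and starts within
    \<open>d / 4\<close> of \<open>p\<close>, so the local description is still valid at its
    end.\<close>
  have stay: "x + \<rho> *\<^sub>R (e + w) \<in> ball p d"
    if "x \<in> ball p (d / 4)" "0 < \<rho>" "\<rho> \<le> d / 4" "norm w \<le> 1" "norm e = 1" for x \<rho> w e d
  proof -
    have "norm (\<rho> *\<^sub>R (e + w)) \<le> d / 4 * 2"
      unfolding norm_scaleR using that norm_triangle_ineq[of e w] by (intro mult_mono) auto
    then have "norm (x - p + \<rho> *\<^sub>R (e + w)) < d"
      using that norm_triangle_ineq[of "x - p" "\<rho> *\<^sub>R (e + w)"]
      by (simp add: dist_norm norm_minus_commute)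
    then show ?thesis by (simp add: dist_norm norm_minus_commute algebra_simps)
  qed
  show ?thesis
  proof (cases "p \<in> \<Omega>")
    case True
    then obtain d where d: "0 < d" "ball p d \<subseteq> \<Omega>"
      using op open_contains_ball by blast
    obtain e :: 'a where e: "norm e = 1"
      using nonempty_Basis norm_Basis by blast
    show ?thesis
    proof (rule that[of e 1 "d / 4"])
      show "x + \<rho> *\<^sub>R (e + w) \<in> \<Omega>"
        if "x \<in> \<Omega> \<inter> ball p (d / 4)" "0 < \<rho>" "\<rho> \<le> d / 4" "norm w \<le> 1" for x \<rho> w
        using stay[of x d \<rho> w e] that d e by auto
    qed (use d e in auto)
  next
    case False
    then have front: "p \<in> frontier \<Omega>" using p op by (simp add: frontier_def interior_open)
    obtain e g L r where e: "norm e = 1" and g: "L-lipschitz_on {y. y \<bullet> e = 0} g" and r: "0 < r"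
      and eq: "\<Omega> \<inter> ball p r = {x \<in> ball p r. g (x - (x \<bullet> e) *\<^sub>R e) < x \<bullet> e}"
      using bspec[OF conjunct2[OF conjunct2[OF lip[unfolded lipschitz_domain_def]]] front]
      by (elim exE conjE) (rule that)
    have L: "0 \<le> L" using g by (rule lipschitz_on_nonneg)
    have ee: "e \<bullet> e = 1" using e by (simp add: norm_eq_1)
    \<comment> \<open>The value for which \<open>2 * L * \<delta> = 1 - \<delta>\<close>. Strict
      inequality at the end of the step is inherited from \<open>x\<close>, which lies strictly
      above the graph.\<close>
    define \<delta> where "\<delta> = 1 / (2 * L + 1)"
    have \<delta>: "0 < \<delta>" "\<delta> \<le> 1" "\<delta> * (2 * L + 1) = 1"
      using L by (auto simp: \<delta>_def)
    show ?thesis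
    proof (rule that[of e \<delta> "r / 4"])
      fix x w :: 'a and \<rho> :: real
      assume x: "x \<in> \<Omega> \<inter> ball p (r / 4)" and \<rho>: "0 < \<rho>" "\<rho> \<le> r / 4" and w: "norm w \<le> \<delta>"
      let ?y = "x + \<rho> *\<^sub>R (e + w)"
      have y: "?y \<in> ball p r"
        using stay[of x r \<rho> w e] x \<rho> w \<delta> e by auto
      have "x \<in> \<Omega> \<inter> ball p r" using x r by auto
      then have gx: "g (x - (x \<bullet> e) *\<^sub>R e) < x \<bullet> e" unfolding eq by simp
      have we: "\<bar>w \<bullet> e\<bar> \<le> norm w" using Cauchy_Schwarz_ineq2[of w e] e by simp
      have P: "z - (z \<bullet> e) *\<^sub>R e \<in> {y. y \<bullet> e = 0}" for z
        by (simp add: inner_diff_left ee)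
      have "dist (g (?y - (?y \<bullet> e) *\<^sub>R e)) (g (x - (x \<bullet> e) *\<^sub>R e))
          \<le> L * dist (?y - (?y \<bullet> e) *\<^sub>R e) (x - (x \<bullet> e) *\<^sub>R e)"
        by (rule lipschitz_onD[OF g P P])
      also have "dist (?y - (?y \<bullet> e) *\<^sub>R e) (x - (x \<bullet> e) *\<^sub>R e) = norm (\<rho> *\<^sub>R (w - (w \<bullet> e) *\<^sub>R e))"
        by (simp add: dist_norm inner_add_left ee algebra_simps)
      also have "L * norm (\<rho> *\<^sub>R (w - (w \<bullet> e) *\<^sub>R e)) \<le> L * (\<rho> * (2 * \<delta>))"
      proof -
        have "norm (w - (w \<bullet> e) *\<^sub>R e) \<le> norm w + norm ((w \<bullet> e) *\<^sub>R e)" by (rule norm_triangle_ineq4)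
        also have "\<dots> \<le> 2 * \<delta>" using we w e by simp
        finally show ?thesis using L \<rho> by (auto intro!: mult_left_mono)
      qed
      finally have "g (?y - (?y \<bullet> e) *\<^sub>R e) \<le> g (x - (x \<bullet> e) *\<^sub>R e) + \<rho> * (\<delta> * (2 * L))"
        by (simp add: dist_real_def algebra_simps)
      also have "\<dots> < x \<bullet> e + \<rho> * (1 - \<delta>)"
      proof -
        have "\<delta> * (2 * L) = 1 - \<delta>" using \<delta>(3) by (simp add: algebra_simps)
        then show ?thesis using gx by simp
      qed
      also have "\<dots> \<le> ?y \<bullet> e"
      proof -
        have "1 - \<delta> \<le> 1 + w \<bullet> e" using we w by linarith
        then have "\<rho> * (1 - \<delta>) \<le> \<rho> * (1 + w \<bullet> e)" using \<rho> by (intro mult_left_mono) auto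
        then show ?thesis by (simp add: inner_add_left ee)
      qed
      finally have "?y \<in> \<Omega> \<inter> ball p r" using y unfolding eq by simp
      then show "?y \<in> \<Omega>" by simp
    qed (use \<delta> e r in auto)
  qed
qed

context neumann_system
begin

text \<open>Compactness of the closure: finitely many of the balls with a common cone direction
  cover the domain, and their constants add up.\<close>

lemma combination_embedding:
  fixes s E :: real
  assumes lip: "lipschitz_domain \<Omega>"
    and s: "0 < s" "s < 1" "2 * s < DIM('a)" and E: "0 \<le> E"
  defines "q \<equiv> 2 * real DIM('a) / (real DIM('a) - 2 * s)"
  obtains C where "0 \<le> C" "\<And>N c. (\<Sum>j<N. (c j)\<^sup>2) \<le> E \<Longrightarrow> (\<Sum>j<N. lam j powr s * (c j)\<^sup>2) \<le> E \<Longrightarrow>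
    (\<integral>\<^sup>+x. ennreal (\<bar>\<Sum>j<N. c j * \<phi> j x\<bar> powr q) \<partial>M) \<le> ennreal C"
proof -
  define P where "P p h C \<longleftrightarrow> 0 < h \<and> 0 \<le> C \<and>
    (\<forall>N c. (\<Sum>j<N. (c j)\<^sup>2) \<le> E \<longrightarrow> (\<Sum>j<N. lam j powr s * (c j)\<^sup>2) \<le> E \<longrightarrow>
      (\<integral>\<^sup>+x. indicator (\<Omega> \<inter> ball p h) x * ennreal (\<bar>\<Sum>j<N. c j * \<phi> j x\<bar> powr q) \<partial>M) \<le> ennreal C)"
    for p h C
  have "\<exists>h C. P p h C" if p: "p \<in> closure \<Omega>" for p
  proof -
    obtain e \<delta> h where c: "norm e = 1" "0 < \<delta>" "\<delta> \<le> 1" "0 < h"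
      "\<And>x \<rho> w. x \<in> \<Omega> \<inter> ball p h \<Longrightarrow> 0 < \<rho> \<Longrightarrow> \<rho> \<le> h \<Longrightarrow> norm w \<le> \<delta> \<Longrightarrow> x + \<rho> *\<^sub>R (e + w) \<in> \<Omega>"
      by (rule lipschitz_domain_cone[OF lip p]) blast
    interpret piece: neumann_piece \<Omega> lam \<phi> "\<Omega> \<inter> ball p h" e \<delta> h
      using c by unfold_locales auto
    obtain C where "0 \<le> C" "\<And>N c. (\<Sum>j<N. (c j)\<^sup>2) \<le> E \<Longrightarrow> (\<Sum>j<N. lam j powr s * (c j)\<^sup>2) \<le> E \<Longrightarrow>
      (\<integral>\<^sup>+x. indicator (\<Omega> \<inter> ball p h) x * ennreal (\<bar>\<Sum>j<N. c j * \<phi> j x\<bar> powr q) \<partial>M) \<le> ennreal C"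
      unfolding q_def by (rule piece.local_embedding[OF s E]) blast
    then have "P p h C" using c(4) by (simp add: P_def)
    then show ?thesis by blast
  qed
  then obtain h C where hC: "\<And>p. p \<in> closure \<Omega> \<Longrightarrow> P p (h p) (C p)" by metis
  note hC = hC[unfolded P_def]
  have "compact (closure \<Omega>)" using bounded_dom by (simp add: compact_closure)
  then obtain D where D: "D \<subseteq> closure \<Omega>" "finite D" "closure \<Omega> \<subseteq> (\<Union>p\<in>D. ball p (h p))"
  proof (rule compactE_image)
    show "open (ball p (h p))" for p by simp
    show "closure \<Omega> \<subseteq> (\<Union>p\<in>closure \<Omega>. ball p (h p))" using hC by force
  qed blast
  show ?thesis
  proof (rule that[of "\<Sum>p\<in>D. C p"])
    show "0 \<le> (\<Sum>p\<in>D. C p)" using hC D by (intro sum_nonneg) auto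
    fix N c
    assume c: "(\<Sum>j<N. (c j)\<^sup>2) \<le> E" "(\<Sum>j<N. lam j powr s * (c j)\<^sup>2) \<le> E"
    let ?u = "\<lambda>x. \<Sum>j<N. c j * \<phi> j x"
    have [measurable]: "?u \<in> borel_measurable M" by (intro L2_measurable combination_L2)
    have [measurable]: "\<Omega> \<inter> ball p (h p) \<in> sets M" for p
      by (auto simp: sets_restrict_space_iff)
    have "(\<integral>\<^sup>+x. ennreal (\<bar>?u x\<bar> powr q) \<partial>M)
        \<le> (\<integral>\<^sup>+x. (\<Sum>p\<in>D. indicator (\<Omega> \<inter> ball p (h p)) x * ennreal (\<bar>?u x\<bar> powr q)) \<partial>M)"
    proof (rule nn_integral_mono)
      fix x assume "x \<in> space M"
      then have x: "x \<in> \<Omega>" by simp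
      then obtain p where p: "p \<in> D" "x \<in> ball p (h p)"
        using D(3) closure_subset by blast
      then have "ennreal (\<bar>?u x\<bar> powr q) = indicator (\<Omega> \<inter> ball p (h p)) x * ennreal (\<bar>?u x\<bar> powr q)"
        using x by simp
      also have "\<dots> \<le> (\<Sum>p\<in>D. indicator (\<Omega> \<inter> ball p (h p)) x * ennreal (\<bar>?u x\<bar> powr q))"
        using D(2) p(1) by (intro member_le_sum) auto
      finally show "ennreal (\<bar>?u x\<bar> powr q)
          \<le> (\<Sum>p\<in>D. indicator (\<Omega> \<inter> ball p (h p)) x * ennreal (\<bar>?u x\<bar> powr q))" .
    qed
    also have "\<dots> = (\<Sum>p\<in>D. \<integral>\<^sup>+x. indicator (\<Omega> \<inter> ball p (h p)) x * ennreal (\<bar>?u x\<bar> powr q) \<partial>M)"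
      by (rule nn_integral_sum) measurable
    also have "\<dots> \<le> (\<Sum>p\<in>D. ennreal (C p))"
      using hC D(1) c by (intro sum_mono) blast
    also have "\<dots> = ennreal (\<Sum>p\<in>D. C p)"
      using hC D(1) by (intro sum_ennreal) blast
    finally show "(\<integral>\<^sup>+x. ennreal (\<bar>?u x\<bar> powr q) \<partial>M) \<le> ennreal (\<Sum>p\<in>D. C p)" .
  qed
qed

section \<open>Fourier coefficients and the spectral space\<close>

abbreviation coef :: "('a \<Rightarrow> real) \<Rightarrow> nat \<Rightarrow> real" where
  "coef u j \<equiv> L2_inner \<Omega> u (\<phi> j)"

lemma residual_inner:
  assumes u: "u \<in> L2 \<Omega>"
  shows "L2_inner \<Omega> (\<lambda>x. u x - (\<Sum>j<N. coef u j * \<phi> j x)) (\<lambda>x. u x - (\<Sum>j<N. coef u j * \<phi> j x))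
    = L2_inner \<Omega> u u - (\<Sum>j<N. (coef u j)\<^sup>2)"
proof -
  let ?S = "\<lambda>x. \<Sum>j<N. coef u j * \<phi> j x"
  have S: "?S \<in> L2 \<Omega>" by (rule combination_L2)
  note d = L2_diff[OF u S]
  have uS: "L2_inner \<Omega> ?S u = (\<Sum>j<N. (coef u j)\<^sup>2)"
    using u by (subst L2_inner_sum)
      (auto simp: L2_cmult \<phi>_L2 L2_inner_cmult L2_inner_commute[of "\<phi> _" u] power2_eq_square)
  have SS: "L2_inner \<Omega> ?S ?S = (\<Sum>j<N. (coef u j)\<^sup>2)"
    by (rule inner_combination_self) simp
  have "L2_inner \<Omega> (\<lambda>x. u x - ?S x) (\<lambda>x. u x - ?S x)
      = L2_inner \<Omega> (\<lambda>x. u x - ?S x) u - L2_inner \<Omega> (\<lambda>x. u x - ?S x) ?S"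
    using L2_inner_diff[OF u S d] by (simp add: L2_inner_commute)
  also have "\<dots> = L2_inner \<Omega> u u - (\<Sum>j<N. (coef u j)\<^sup>2)"
    using L2_inner_diff[OF u S u] L2_inner_diff[OF u S S] uS SS by (simp add: L2_inner_commute[of u ?S])
  finally show ?thesis .
qed

lemma parseval:
  assumes u: "u \<in> L2 \<Omega>"
  shows "(\<lambda>j. (coef u j)\<^sup>2) sums L2_inner \<Omega> u u"
proof -
  have "(\<lambda>N. (L2_norm \<Omega> (\<lambda>x. u x - (\<Sum>j<N. coef u j * \<phi> j x)))\<^sup>2) \<longlonglongrightarrow> 0\<^sup>2"
    by (intro tendsto_power partial_sums_tendsto u)
  then have "(\<lambda>N. L2_inner \<Omega> u u - (\<Sum>j<N. (coef u j)\<^sup>2)) \<longlonglongrightarrow> 0"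
    by (simp add: L2_norm_square residual_inner[OF u])
  then have "(\<lambda>N. L2_inner \<Omega> u u - (L2_inner \<Omega> u u - (\<Sum>j<N. (coef u j)\<^sup>2))) \<longlonglongrightarrow> L2_inner \<Omega> u u - 0"
    by (intro tendsto_diff tendsto_const)
  then show ?thesis by (simp add: sums_def)
qed

lemma bessel: "u \<in> L2 \<Omega> \<Longrightarrow> (\<Sum>j<N. (coef u j)\<^sup>2) \<le> L2_inner \<Omega> u u"
  using sum_le_suminf[OF sums_summable[OF parseval], of u "{..<N}"] sums_unique[OF parseval, of u]
  by simp

text \<open>The squared residuals tend to 0 in L1, hence almost everywhere along a subsequence. This
  pointwise convergence is the input for Fatou's lemma in the embedding.\<close>

lemma partial_sums_AE:
  assumes u: "u \<in> L2 \<Omega>"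
  obtains \<sigma> :: "nat \<Rightarrow> nat" where "AE x in M. (\<lambda>k. \<Sum>j<\<sigma> k. coef u j * \<phi> j x) \<longlonglongrightarrow> u x"
proof -
  let ?S = "\<lambda>N x. \<Sum>j<N. coef u j * \<phi> j x"
  have d: "(\<lambda>x. u x - ?S N x) \<in> L2 \<Omega>" for N by (intro L2_diff u combination_L2)
  have "(\<lambda>N. (L2_norm \<Omega> (\<lambda>x. u x - ?S N x))\<^sup>2) \<longlonglongrightarrow> 0\<^sup>2"
    by (intro tendsto_power partial_sums_tendsto u)
  then have "(\<lambda>N. LINT x|M. norm ((u x - ?S N x)\<^sup>2)) \<longlonglongrightarrow> 0"
    by (simp add: L2_norm_square L2_inner_self)
  from tendsto_L1_AE_subseq[OF L2_square_integrable[OF d] this]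
  obtain \<sigma> :: "nat \<Rightarrow> nat" where \<sigma>: "AE x in M. (\<lambda>k. (u x - ?S (\<sigma> k) x)\<^sup>2) \<longlonglongrightarrow> 0" by blast
  show ?thesis
  proof (rule that, use \<sigma> in eventually_elim)
    fix x assume "(\<lambda>k. (u x - ?S (\<sigma> k) x)\<^sup>2) \<longlonglongrightarrow> 0"
    then have "(\<lambda>k. sqrt ((u x - ?S (\<sigma> k) x)\<^sup>2)) \<longlonglongrightarrow> sqrt 0" by (rule tendsto_real_sqrt)
    then have "(\<lambda>k. u x - ?S (\<sigma> k) x) \<longlonglongrightarrow> 0" by (simp add: tendsto_rabs_zero_iff)
    from tendsto_diff[OF tendsto_const this, of "u x"]
    show "(\<lambda>k. ?S (\<sigma> k) x) \<longlonglongrightarrow> u x" by simp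
  qed
qed

lemma Hs_L2: "u \<in> Hs \<Omega> lam \<phi> s \<Longrightarrow> u \<in> L2 \<Omega>"
  and Hs_summable: "u \<in> Hs \<Omega> lam \<phi> s \<Longrightarrow> summable (\<lambda>j. lam (Suc j) powr s * (coef u (Suc j))\<^sup>2)"
  by (simp_all add: Hs_def)

lemma spectral_form_nonneg: "u \<in> Hs \<Omega> lam \<phi> s \<Longrightarrow> 0 \<le> spectral_form \<Omega> lam \<phi> s u"
  unfolding spectral_form_def by (rule suminf_nonneg[OF Hs_summable]) auto

lemma Hs_norm_square:
  "u \<in> Hs \<Omega> lam \<phi> s \<Longrightarrow> (Hs_norm \<Omega> lam \<phi> s u)\<^sup>2 = spectral_form \<Omega> lam \<phi> s u + L2_inner \<Omega> u u"
  by (simp add: Hs_norm_def spectral_form_nonneg L2_norm_square L2_inner_self_nonneg)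

lemma Hs_norm_nonneg: "u \<in> Hs \<Omega> lam \<phi> s \<Longrightarrow> 0 \<le> Hs_norm \<Omega> lam \<phi> s u"
  by (simp add: Hs_norm_def spectral_form_nonneg)

text \<open>The form starts at index 1, the estimates for combinations at index 0. The extra term
  vanishes because \<open>lam 0 = 0\<close> and \<open>0 powr s = 0\<close>.\<close>

lemma partial_form_le:
  assumes u: "u \<in> Hs \<Omega> lam \<phi> s"
  shows "(\<Sum>j<N. lam j powr s * (coef u j)\<^sup>2) \<le> spectral_form \<Omega> lam \<phi> s u"
proof -
  have "(\<Sum>j<N. lam j powr s * (coef u j)\<^sup>2) \<le> (\<Sum>j<Suc N. lam j powr s * (coef u j)\<^sup>2)"
    by simp
  also have "\<dots> = (\<Sum>j<N. lam (Suc j) powr s * (coef u (Suc j))\<^sup>2)"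
    by (simp add: sum.lessThan_Suc_shift lam_0 del: sum.lessThan_Suc)
  also have "\<dots> \<le> spectral_form \<Omega> lam \<phi> s u"
    unfolding spectral_form_def by (rule sum_le_suminf[OF Hs_summable[OF u]]) auto
  finally show ?thesis .
qed

text \<open>\<open>q\<close> is the critical exponent of the order
  \<open>t = DIM('a) * (1 / 2 - 1 / q)\<close>, which is at most \<open>s\<close>. Since
  \<open>lam j powr t \<le> 1 + lam j powr s\<close>, the partial sums of a function in the unit
  ball meet both bounds of \<open>combination_embedding\<close> with \<open>E = 1\<close>, and
  Fatou's lemma passes to the function.\<close>

lemma Hs_embedding_unit_ball:
  fixes s q :: real
  assumes lip: "lipschitz_domain \<Omega>" and s: "0 < s" "s < 1" and q: "2 < q"
    and sq: "real DIM('a) * (1 / 2 - 1 / q) \<le> s"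
  obtains C where "0 \<le> C" "\<And>u. u \<in> Hs \<Omega> lam \<phi> s \<Longrightarrow> Hs_norm \<Omega> lam \<phi> s u \<le> 1 \<Longrightarrow>
    (\<integral>\<^sup>+x. ennreal (\<bar>u x\<bar> powr q) \<partial>M) \<le> ennreal C"
proof -
  define t where "t = real DIM('a) * (1 / 2 - 1 / q)"
  have "1 / q < 1 / 2" using q by (intro divide_strict_left_mono) auto
  then have t: "0 < t" "t < 1" "2 * t < DIM('a)" "t \<le> s"
  proof -
    have "0 < real DIM('a) / q" using q by simp
    then show "2 * t < DIM('a)" by (simp add: t_def right_diff_distrib)
    show "0 < t" using \<open>1 / q < 1 / 2\<close> by (simp add: t_def)
    show "t \<le> s" "t < 1" using s sq by (simp_all add: t_def)
  qed
  have q_eq: "2 * real DIM('a) / (real DIM('a) - 2 * t) = q"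
    using q by (simp add: t_def field_simps)
  obtain C where C: "0 \<le> C" "\<And>N c. (\<Sum>j<N. (c j)\<^sup>2) \<le> 1 \<Longrightarrow> (\<Sum>j<N. lam j powr t * (c j)\<^sup>2) \<le> 1 \<Longrightarrow>
      (\<integral>\<^sup>+x. ennreal (\<bar>\<Sum>j<N. c j * \<phi> j x\<bar> powr q) \<partial>M) \<le> ennreal C"
    by (rule combination_embedding[OF lip t(1-3) zero_le_one, unfolded q_eq]) blast
  show ?thesis
  proof (rule that[OF C(1)])
    fix u assume u: "u \<in> Hs \<Omega> lam \<phi> s" and "Hs_norm \<Omega> lam \<phi> s u \<le> 1"
    then have le1: "spectral_form \<Omega> lam \<phi> s u + L2_inner \<Omega> u u \<le> 1"
      using Hs_norm_square[OF u] power_le_one[OF Hs_norm_nonneg[OF u], of 2] by simp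
    note uL = Hs_L2[OF u]
    have [measurable]: "u \<in> borel_measurable M" by (rule L2_measurable[OF uL])
    let ?S = "\<lambda>N x. \<Sum>j<N. coef u j * \<phi> j x"
    have [measurable]: "?S N \<in> borel_measurable M" for N by (intro L2_measurable combination_L2)
    have S_le: "(\<integral>\<^sup>+x. ennreal (\<bar>?S N x\<bar> powr q) \<partial>M) \<le> ennreal C" for N
    proof (rule C(2))
      show "(\<Sum>j<N. (coef u j)\<^sup>2) \<le> 1"
        using bessel[OF uL, of N] le1 spectral_form_nonneg[OF u] by linarith
      have "(\<Sum>j<N. lam j powr t * (coef u j)\<^sup>2) \<le> (\<Sum>j<N. (1 + lam j powr s) * (coef u j)\<^sup>2)"
        using t lam_nonneg by (intro sum_mono mult_right_mono powr_le_1_plus_powr) auto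
      also have "\<dots> = (\<Sum>j<N. (coef u j)\<^sup>2) + (\<Sum>j<N. lam j powr s * (coef u j)\<^sup>2)"
        by (simp add: distrib_right sum.distrib)
      also have "\<dots> \<le> 1"
        using bessel[OF uL, of N] partial_form_le[OF u, of N] le1 by linarith
      finally show "(\<Sum>j<N. lam j powr t * (coef u j)\<^sup>2) \<le> 1" .
    qed
    obtain \<sigma> :: "nat \<Rightarrow> nat" where \<sigma>: "AE x in M. (\<lambda>k. ?S (\<sigma> k) x) \<longlonglongrightarrow> u x"
      by (rule partial_sums_AE[OF uL])
    have "(\<integral>\<^sup>+x. ennreal (\<bar>u x\<bar> powr q) \<partial>M)
        = (\<integral>\<^sup>+x. liminf (\<lambda>k. ennreal (\<bar>?S (\<sigma> k) x\<bar> powr q)) \<partial>M)"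
    proof (rule nn_integral_cong_AE, use \<sigma> in eventually_elim)
      fix x assume "(\<lambda>k. ?S (\<sigma> k) x) \<longlonglongrightarrow> u x"
      then have "(\<lambda>k. ennreal (\<bar>?S (\<sigma> k) x\<bar> powr q)) \<longlonglongrightarrow> ennreal (\<bar>u x\<bar> powr q)"
        using q by (intro tendsto_ennrealI tendsto_powr' tendsto_rabs tendsto_const) auto
      then show "ennreal (\<bar>u x\<bar> powr q) = liminf (\<lambda>k. ennreal (\<bar>?S (\<sigma> k) x\<bar> powr q))"
        by (intro lim_imp_Liminf[symmetric]) auto
    qed
    also have "\<dots> \<le> liminf (\<lambda>k. \<integral>\<^sup>+x. ennreal (\<bar>?S (\<sigma> k) x\<bar> powr q) \<partial>M)"
      by (rule nn_integral_liminf) measurable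
    also have "\<dots> \<le> liminf (\<lambda>k. ennreal C)"
      by (intro Liminf_mono always_eventually allI S_le)
    also have "\<dots> = ennreal C" by (simp add: Liminf_const)
    finally show "(\<integral>\<^sup>+x. ennreal (\<bar>u x\<bar> powr q) \<partial>M) \<le> ennreal C" .
  qed
qed

lemma spectral_form_cmult:
  "u \<in> Hs \<Omega> lam \<phi> s \<Longrightarrow> spectral_form \<Omega> lam \<phi> s (\<lambda>x. c * u x) = c\<^sup>2 * spectral_form \<Omega> lam \<phi> s u"
  unfolding spectral_form_def L2_inner_cmult power_mult_distrib
  by (subst suminf_mult[OF Hs_summable, symmetric]) (auto simp: mult_ac)

lemma Hs_cmult:
  assumes "u \<in> Hs \<Omega> lam \<phi> s"
  shows "(\<lambda>x. c * u x) \<in> Hs \<Omega> lam \<phi> s"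
  using summable_mult[OF Hs_summable[OF assms], of "c\<^sup>2"] L2_cmult[OF Hs_L2[OF assms]]
  by (simp add: Hs_def L2_inner_cmult power_mult_distrib mult_ac)

lemma Hs_norm_cmult:
  "u \<in> Hs \<Omega> lam \<phi> s \<Longrightarrow> Hs_norm \<Omega> lam \<phi> s (\<lambda>x. c * u x) = \<bar>c\<bar> * Hs_norm \<Omega> lam \<phi> s u"
  unfolding Hs_norm_def spectral_form_cmult L2_norm_square L2_inner_cmult L2_inner_commute[of u "\<lambda>x. c * u x"]
  by (simp add: spectral_form_cmult real_sqrt_mult power2_eq_square mult.assoc flip: distrib_left)

text \<open>Scaling from the unit ball; functions of norm zero cannot be scaled and vanish almost
  everywhere. Integrability is recorded separately, because the Bochner integral of a non-integrable
  function is 0 and the bound alone would then say nothing.\<close>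

lemma Hs_embedding:
  fixes s q :: real
  assumes lip: "lipschitz_domain \<Omega>" and s: "0 < s" "s < 1" and q: "2 < q"
    and sq: "real DIM('a) * (1 / 2 - 1 / q) \<le> s"
  obtains C where "0 \<le> C" "\<And>u. u \<in> Hs \<Omega> lam \<phi> s \<Longrightarrow> integrable M (\<lambda>x. \<bar>u x\<bar> powr q)"
    "\<And>u. u \<in> Hs \<Omega> lam \<phi> s \<Longrightarrow> (LINT x|M. \<bar>u x\<bar> powr q) \<le> C * Hs_norm \<Omega> lam \<phi> s u powr q"
proof -
  obtain C where C: "0 \<le> C" "\<And>u. u \<in> Hs \<Omega> lam \<phi> s \<Longrightarrow> Hs_norm \<Omega> lam \<phi> s u \<le> 1 \<Longrightarrow>
      (\<integral>\<^sup>+x. ennreal (\<bar>u x\<bar> powr q) \<partial>M) \<le> ennreal C"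
    by (rule Hs_embedding_unit_ball[OF assms]) blast
  have *: "(\<integral>\<^sup>+x. ennreal (\<bar>u x\<bar> powr q) \<partial>M) \<le> ennreal (C * Hs_norm \<Omega> lam \<phi> s u powr q)"
    if u: "u \<in> Hs \<Omega> lam \<phi> s" for u
  proof (cases "Hs_norm \<Omega> lam \<phi> s u = 0")
    case True
    then have "L2_inner \<Omega> u u = 0"
      using Hs_norm_square[OF u] spectral_form_nonneg[OF u] L2_inner_self_nonneg[of u] by simp
    then have "(LINT x|M. (u x)\<^sup>2) = 0" by (simp add: L2_inner_self)
    then have "AE x in M. (u x)\<^sup>2 = 0"
      using integral_nonneg_eq_0_iff_AE[OF L2_square_integrable[OF Hs_L2[OF u]]] by simp
    then have "(\<integral>\<^sup>+x. ennreal (\<bar>u x\<bar> powr q) \<partial>M) = (\<integral>\<^sup>+x. 0 \<partial>M)"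
      by (intro nn_integral_cong_AE) auto
    then show ?thesis by simp
  next
    case False
    define H where "H = Hs_norm \<Omega> lam \<phi> s u"
    have H: "0 < H" using False Hs_norm_nonneg[OF u] by (simp add: H_def)
    have [measurable]: "u \<in> borel_measurable M" by (rule L2_measurable[OF Hs_L2[OF u]])
    have "(\<integral>\<^sup>+x. ennreal (\<bar>u x\<bar> powr q) \<partial>M)
        = (\<integral>\<^sup>+x. ennreal (H powr q) * ennreal (\<bar>1 / H * u x\<bar> powr q) \<partial>M)"
    proof (rule nn_integral_cong)
      fix x
      have "\<bar>u x\<bar> powr q = H powr q * \<bar>1 / H * u x\<bar> powr q"
        using H by (simp add: abs_mult powr_mult[symmetric])
      then show "ennreal (\<bar>u x\<bar> powr q) = ennreal (H powr q) * ennreal (\<bar>1 / H * u x\<bar> powr q)"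
        by (simp only: ennreal_mult[symmetric] powr_ge_zero)
    qed
    also have "\<dots> = ennreal (H powr q) * (\<integral>\<^sup>+x. ennreal (\<bar>1 / H * u x\<bar> powr q) \<partial>M)"
      by (rule nn_integral_cmult) measurable
    also have "\<dots> \<le> ennreal (H powr q) * ennreal C"
      using H by (intro mult_left_mono C(2) Hs_cmult u) (simp_all only: Hs_norm_cmult[OF u], simp_all add: H_def)
    also have "\<dots> = ennreal (C * H powr q)"
      using C(1) by (simp add: mult.commute flip: ennreal_mult')
    finally show ?thesis by (simp add: H_def)
  qed
  show ?thesis
  proof (rule that[OF C(1)])
    fix u assume u: "u \<in> Hs \<Omega> lam \<phi> s"
    have [measurable]: "u \<in> borel_measurable M" by (rule L2_measurable[OF Hs_L2[OF u]])
    show i: "integrable M (\<lambda>x. \<bar>u x\<bar> powr q)"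
      unfolding integrable_iff_bounded using order_le_less_trans[OF *[OF u] ennreal_less_top] by simp
    show "(LINT x|M. \<bar>u x\<bar> powr q) \<le> C * Hs_norm \<Omega> lam \<phi> s u powr q"
      using *[OF u] C(1) i by (subst (asm) nn_integral_eq_integral) (auto simp: ennreal_le_iff)
  qed
qed

end

section \<open>Constants and the spectral gap\<close>

lemma C1_test_gradient_eq_0:
  assumes "C1_test \<Omega> \<psi> g" "x \<notin> closure {x. \<psi> x \<noteq> 0}"
  shows "g x = 0"
proof -
  let ?K = "closure {x. \<psi> x \<noteq> 0}"
  have "(\<psi> has_derivative (\<lambda>h. h \<bullet> g x)) (at x)"
    using assms(1) by (auto simp: C1_test_def gderiv_def)
  moreover have "((\<lambda>_. 0) has_derivative (\<lambda>h. 0)) (at x)" by simp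
  then have "(\<psi> has_derivative (\<lambda>h. 0)) (at x)"
  proof (rule has_derivative_transform_within_open)
    show "open (- ?K)" "x \<in> - ?K" using assms(2) by auto
    show "0 = \<psi> y" if "y \<in> - ?K" for y using that closure_subset[of "{x. \<psi> x \<noteq> 0}"] by auto
  qed
  ultimately have "(\<lambda>h. h \<bullet> g x) = (\<lambda>h. 0)" by (rule has_derivative_unique)
  then have "g x \<bullet> g x = 0" by meson
  then show ?thesis by simp
qed

text \<open>Differentiating the translation-invariant integral of a test function along a translation.\<close>

lemma C1_test_gradient_integral:
  fixes \<Omega> :: "'a::euclidean_space set"
  assumes t: "C1_test \<Omega> \<psi> g" and b: "b \<in> Basis"
  shows "(LINT x|lborel. g x \<bullet> b) = 0"
proof -
  let ?K = "closure {x. \<psi> x \<noteq> 0}"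
  have K: "compact ?K" and g: "continuous_on UNIV g" and d: "\<And>x. (\<psi> has_derivative (\<lambda>h. h \<bullet> g x)) (at x)"
    using t by (auto simp: C1_test_def gderiv_def)
  have \<psi>c: "continuous_on UNIV \<psi>"
    by (intro continuous_at_imp_continuous_on ballI has_derivative_continuous[OF d])
  have [measurable]: "g \<in> borel_measurable borel" "\<psi> \<in> borel_measurable borel"
    using g \<psi>c by (auto intro: borel_measurable_continuous_onI)
  have "bounded (g ` ?K)" "bounded (\<psi> ` ?K)"
    using K g \<psi>c by (meson compact_continuous_image compact_imp_bounded continuous_on_subset subset_UNIV)+
  then obtain B B' where B0: "0 < B" and B: "\<And>x. x \<in> ?K \<Longrightarrow> norm (g x) \<le> B" and B': "\<And>x. x \<in> ?K \<Longrightarrow> norm (\<psi> x) \<le> B'"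
    unfolding bounded_pos by blast
  obtain R where R: "\<And>x. x \<in> ?K \<Longrightarrow> norm x \<le> R"
    using compact_imp_bounded[OF K] by (auto simp: bounded_iff)
  have \<psi>0: "\<psi> x = 0" if "x \<notin> ?K" for x using that closure_subset[of "{x. \<psi> x \<noteq> 0}"] by auto
  \<comment> \<open>The radius is enlarged by 1 so that one ball contains the supports of all
    translates by \<open>r *\<^sub>R b\<close> with \<open>\<bar>r\<bar> < 1\<close>.\<close>
  have ball_int: "integrable lborel (indicator (cball (0::'a) (R + 1)) :: 'a \<Rightarrow> real)"
    by (rule integrable_real_indicator, simp, rule emeasure_bounded_finite, simp)
  have outside: "x + r *\<^sub>R b \<notin> ?K" if "x \<notin> cball 0 (R + 1)" "\<bar>r - 0\<bar> < 1" for x r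
  proof
    assume "x + r *\<^sub>R b \<in> ?K"
    then have "norm (x + r *\<^sub>R b) \<le> R" by (rule R)
    moreover have "norm (r *\<^sub>R b) \<le> 1" using that b by simp
    ultimately have "norm x \<le> R + 1" using norm_triangle_ineq4[of "x + r *\<^sub>R b" "r *\<^sub>R b"] by simp
    then show False using that by simp
  qed
  have deriv: "((\<lambda>r. LINT x|lborel. \<psi> (x + r *\<^sub>R b)) has_real_derivative (LINT x|lborel. g (x + 0 *\<^sub>R b) \<bullet> b)) (at 0)"
  proof (rule has_real_derivative_lebesgue_integral[where d = 1 and f' = "\<lambda>r x. g (x + r *\<^sub>R b) \<bullet> b"
        and g = "\<lambda>x. B * indicator (cball (0::'a) (R + 1)) x"])
    show "((\<lambda>r. \<psi> (x + r *\<^sub>R b)) has_real_derivative g (x + r *\<^sub>R b) \<bullet> b) (at r)" for r x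
    proof -
      have "((\<lambda>r. x + r *\<^sub>R b) has_derivative (\<lambda>k. k *\<^sub>R b)) (at r)"
        by (auto intro!: derivative_eq_intros)
      from has_derivative_compose[OF this d] show ?thesis
        unfolding has_field_derivative_def
        by (rule has_derivative_eq_rhs) (auto simp: inner_commute)
    qed
    show "\<bar>g (x + r *\<^sub>R b) \<bullet> b\<bar> \<le> B * indicator (cball (0::'a) (R + 1)) x" if "\<bar>r - 0\<bar> < 1" for r x
    proof (cases "x + r *\<^sub>R b \<in> ?K")
      case True
      then have "x \<in> cball 0 (R + 1)" using outside[of x r] that by blast
      then show ?thesis using B[OF True] Basis_le_norm[OF b, of "g (x + r *\<^sub>R b)"] by simp
    next
      case False
      then have "g (x + r *\<^sub>R b) = 0" by (rule C1_test_gradient_eq_0[OF t])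
      then show ?thesis using B0 by simp
    qed
    show "integrable lborel (\<lambda>x. \<psi> (x + r *\<^sub>R b))" if "\<bar>r - 0\<bar> < 1" for r
    proof (rule Bochner_Integration.integrable_bound)
      show "integrable lborel (\<lambda>x. \<bar>B'\<bar> * indicator (cball (0::'a) (R + 1)) x)"
        using ball_int by simp
      show "AE x in lborel. norm (\<psi> (x + r *\<^sub>R b)) \<le> norm (\<bar>B'\<bar> * indicator (cball (0::'a) (R + 1)) x)"
      proof (rule AE_I2)
        fix x
        show "norm (\<psi> (x + r *\<^sub>R b)) \<le> norm (\<bar>B'\<bar> * indicator (cball (0::'a) (R + 1)) x)"
        proof (cases "x + r *\<^sub>R b \<in> ?K")
          case True
          then have "x \<in> cball 0 (R + 1)" using outside[of x r] that by blast
          then show ?thesis using B'[OF True] by simp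
        next
          case False
          from \<psi>0[OF this] show ?thesis by simp
        qed
      qed
      show "(\<lambda>x. \<psi> (x + r *\<^sub>R b)) \<in> borel_measurable lborel"
        using measurable_compose[of "\<lambda>x. x + r *\<^sub>R b" borel borel \<psi> borel] by simp
    qed
    show "integrable lborel (\<lambda>x. B * indicator (cball (0::'a) (R + 1)) x)"
      using ball_int by simp
    show "(\<lambda>x. g (x + 0 *\<^sub>R b) \<bullet> b) \<in> borel_measurable lborel"
      using borel_measurable_continuous_onI[OF continuous_on_inner[OF g continuous_on_const, of b]] by simp
  qed simp
  have "(LINT x|lborel. \<psi> (x + r *\<^sub>R b)) = (LINT x|lborel. \<psi> x)" for r
  proof -
    have "(LINT x|lborel. \<psi> x) = (LINT x|distr lborel borel ((+) (r *\<^sub>R b)). \<psi> x)"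
      by (subst lborel_distr_plus) simp
    then show ?thesis by (simp add: integral_distr add.commute)
  qed
  then have "((\<lambda>r. LINT x|lborel. \<psi> (x + r *\<^sub>R b)) has_real_derivative 0) (at 0)"
    by simp
  from DERIV_unique[OF deriv this] show ?thesis by simp
qed

context bounded_open_set
begin

text \<open>This amounts to the vanishing integral of the gradient of a test function. Constants
  thereby become admissible in the eigenvalue equation, which forces mean zero on eigenfunctions
  with positive eigenvalue.\<close>

lemma has_weak_gradient_const: "has_weak_gradient \<Omega> (\<lambda>x. c) (\<lambda>x. 0)"
  unfolding has_weak_gradient_def
proof (intro conjI allI impI)
  fix \<psi> g assume t: "C1_test \<Omega> \<psi> g"
  have g: "g \<in> borel_measurable borel"
    using t by (auto simp: C1_test_def intro: borel_measurable_continuous_onI)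
  have sub: "closure {x. \<psi> x \<noteq> 0} \<subseteq> \<Omega>" using t by (simp add: C1_test_def)
  have zero: "(LINT x|M. g x) \<bullet> b = 0" if b: "b \<in> Basis" for b
  proof -
    obtain B where "\<And>x. x \<in> \<Omega> \<Longrightarrow> \<bar>\<psi> x\<bar> \<le> B" "\<And>x. x \<in> \<Omega> \<Longrightarrow> norm (g x) \<le> B"
      "\<psi> \<in> borel_measurable M" "g \<in> borel_measurable M"
      by (rule C1_test_bounded[OF t]) (rule that; simp)
    then have gi: "integrable M g"
      by (intro integrable_const_bound[where B = B] AE_I2) simp_all
    have "(LINT x|M. g x) \<bullet> b = (LINT x|M. g x \<bullet> b)"
      using integral_inner_left[OF gi] by simp
    also have "\<dots> = (LINT x|lebesgue. indicator \<Omega> x *\<^sub>R (g x \<bullet> b))"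
      by (rule integral_restrict_space) simp
    also have "\<dots> = (LINT x|lebesgue. g x \<bullet> b)"
    proof (intro Bochner_Integration.integral_cong refl)
      fix x
      show "indicator \<Omega> x *\<^sub>R (g x \<bullet> b) = g x \<bullet> b"
      proof (cases "x \<in> \<Omega>")
        case False
        then have "g x = 0" using sub by (intro C1_test_gradient_eq_0[OF t]) blast
        then show ?thesis by simp
      qed simp
    qed
    also have "\<dots> = (LINT x|lborel. g x \<bullet> b)"
      using g by (intro integral_completion) simp
    also have "\<dots> = 0" by (rule C1_test_gradient_integral[OF t b])
    finally show ?thesis .
  qed
  have "(LINT x|M. g x) = 0" by (rule euclidean_eqI) (simp add: zero)
  then show "(LINT x|M. c *\<^sub>R g x) = - (LINT x|M. \<psi> x *\<^sub>R 0)" by simp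
qed (simp_all add: L2_const)

end

locale unit_neumann_system = neumann_system +
  assumes measure_1: "measure lebesgue \<Omega> = 1"
begin

lemma measure_dom [simp]: "measure M \<Omega> = 1"
  using measure_1 by (simp add: measure_restrict_space)

lemma integral_const: "(LINT x|M. c) = (c::real)"
  by simp

lemma inner_const: "L2_inner \<Omega> u (\<lambda>x. 1) = (LINT x|M. u x)"
  by (simp add: L2_inner_def)

lemma lam_pos: "0 < lam (Suc j)"
  using lam_1_pos monoD[OF lam_mono, of 1 "Suc j"] by simp

lemma coef_const_eq_0: "coef (\<lambda>x. c) (Suc j) = 0"
proof -
  have "lam (Suc j) * L2_inner \<Omega> (\<phi> (Suc j)) (\<lambda>x. c) = 0"
    using \<phi>_grad_inner[OF has_weak_gradient_const, of "Suc j" c] by simp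
  then show ?thesis using lam_pos[of j] by (simp add: L2_inner_commute)
qed

text \<open>That \<open>\<phi> 0\<close> is constant is derived here. The function 1 has no
  coefficient of positive index, so Parseval forces its coefficient \<open>?c\<close> at index 0 to
  have square 1, and the vanishing residual gives \<open>1 = ?c * \<phi> 0 x\<close> almost
  everywhere. Only squares are compared, as the sign of \<open>\<phi> 0\<close> is free.\<close>

lemma coef_0_square:
  assumes u: "u \<in> L2 \<Omega>"
  shows "(coef u 0)\<^sup>2 = (LINT x|M. u x)\<^sup>2"
proof -
  let ?c = "coef (\<lambda>x. 1) 0"
  have "(\<lambda>j. (coef (\<lambda>x. 1) j)\<^sup>2) sums (coef (\<lambda>x. 1) 0)\<^sup>2"
  proof -
    have "coef (\<lambda>x. 1) j = 0" if "j \<noteq> 0" for j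
      using that coef_const_eq_0[of 1 "j - 1"] by simp
    then show ?thesis using sums_finite[of "{0}" "\<lambda>j. (coef (\<lambda>x. 1) j)\<^sup>2"] by simp
  qed
  moreover have "(\<lambda>j. (coef (\<lambda>x. 1) j)\<^sup>2) sums L2_inner \<Omega> (\<lambda>x. 1) (\<lambda>x. 1)"
    by (rule parseval[OF L2_const])
  ultimately have c: "?c\<^sup>2 = 1"
    by (metis sums_unique2 inner_const integral_const)
  have d: "(\<lambda>x. 1 - ?c * \<phi> 0 x) \<in> L2 \<Omega>"
    by (intro L2_diff L2_const L2_cmult \<phi>_L2)
  have "L2_inner \<Omega> (\<lambda>x. 1 - ?c * \<phi> 0 x) (\<lambda>x. 1 - ?c * \<phi> 0 x) = 0"
    using residual_inner[OF L2_const, of 1 1] c by (simp add: inner_const)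
  then have "(LINT x|M. (1 - ?c * \<phi> 0 x)\<^sup>2) = 0" by (simp add: L2_inner_self)
  then have "AE x in M. (1 - ?c * \<phi> 0 x)\<^sup>2 = 0"
    using integral_nonneg_eq_0_iff_AE[OF L2_square_integrable[OF d]] by simp
  then have "AE x in M. 1 = ?c * \<phi> 0 x" by eventually_elim simp
  then have "L2_inner \<Omega> (\<lambda>x. 1) u = L2_inner \<Omega> (\<lambda>x. ?c * \<phi> 0 x) u"
    by (intro L2_inner_cong_AE L2_const L2_cmult \<phi>_L2 u)
  then have "(LINT x|M. u x) = ?c * coef u 0"
    by (simp add: L2_inner_cmult L2_inner_commute[of _ u] inner_const)
  then show ?thesis using c by (simp add: power_mult_distrib)
qed

lemma coef_affine:
  assumes "u \<in> L2 \<Omega>"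
  shows "coef (\<lambda>x. a + b * u x) (Suc j) = b * coef u (Suc j)"
  using L2_inner_add[OF L2_const L2_cmult[OF assms] \<phi>_L2]
  by (simp add: coef_const_eq_0 L2_inner_cmult)

lemma Hs_affine:
  assumes "u \<in> Hs \<Omega> lam \<phi> s"
  shows "(\<lambda>x. a + b * u x) \<in> Hs \<Omega> lam \<phi> s"
  using summable_mult[OF Hs_summable[OF assms], of "b\<^sup>2"]
    L2_add[OF L2_const L2_cmult[OF Hs_L2[OF assms]]]
  by (simp add: Hs_def coef_affine Hs_L2[OF assms] power_mult_distrib mult_ac)

lemma spectral_form_affine:
  assumes "u \<in> Hs \<Omega> lam \<phi> s"
  shows "spectral_form \<Omega> lam \<phi> s (\<lambda>x. a + b * u x) = b\<^sup>2 * spectral_form \<Omega> lam \<phi> s u"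
  unfolding spectral_form_def coef_affine[OF Hs_L2[OF assms]] power_mult_distrib
  by (subst suminf_mult[OF Hs_summable[OF assms], symmetric]) (simp add: mult_ac)

lemma Hs_const: "(\<lambda>x. c) \<in> Hs \<Omega> lam \<phi> s"
  by (simp add: Hs_def L2_const coef_const_eq_0)

lemma spectral_form_const: "spectral_form \<Omega> lam \<phi> s (\<lambda>x. c) = 0"
  by (simp add: spectral_form_def coef_const_eq_0)

lemma inner_affine:
  assumes "u \<in> L2 \<Omega>" "(LINT x|M. u x) = 0"
  shows "L2_inner \<Omega> (\<lambda>x. a + b * u x) (\<lambda>x. a + b * u x) = a\<^sup>2 + b\<^sup>2 * L2_inner \<Omega> u u"
proof -
  have "L2_inner \<Omega> (\<lambda>x. a + b * u x) (\<lambda>x. a + b * u x)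
      = (LINT x|M. a\<^sup>2 + (2 * a * b) * u x + b\<^sup>2 * (u x)\<^sup>2)"
    unfolding L2_inner_def
    by (intro Bochner_Integration.integral_cong) (auto simp: power2_eq_square algebra_simps)
  also have "\<dots> = a\<^sup>2 + b\<^sup>2 * L2_inner \<Omega> u u"
    using assms L2_integrable[OF assms(1)] L2_square_integrable[OF assms(1)]
    by (simp add: L2_inner_self)
  finally show ?thesis .
qed

lemma parseval_mean_0:
  assumes "u \<in> L2 \<Omega>" "(LINT x|M. u x) = 0"
  shows "(\<lambda>j. (coef u (Suc j))\<^sup>2) sums L2_inner \<Omega> u u"
  using parseval[OF assms(1)] coef_0_square[OF assms(1)] assms(2) by (subst sums_Suc_iff) simp

text \<open>Mean zero removes the coefficient of index 0, so Parseval runs over the positive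
  eigenvalues only, and all of these are at least \<open>lam 1\<close>.\<close>

lemma spectral_gap:
  assumes u: "u \<in> Hs \<Omega> lam \<phi> s" and mean: "(LINT x|M. u x) = 0" and s: "0 < s"
  shows "lam 1 powr s * L2_inner \<Omega> u u \<le> spectral_form \<Omega> lam \<phi> s u"
proof -
  have "(\<lambda>j. lam 1 powr s * (coef u (Suc j))\<^sup>2) sums (lam 1 powr s * L2_inner \<Omega> u u)"
    by (intro sums_mult parseval_mean_0 Hs_L2[OF u] mean)
  moreover have "(\<lambda>j. lam (Suc j) powr s * (coef u (Suc j))\<^sup>2) sums spectral_form \<Omega> lam \<phi> s u"
    unfolding spectral_form_def by (rule summable_sums[OF Hs_summable[OF u]])
  moreover have "lam 1 powr s * (coef u (Suc j))\<^sup>2 \<le> lam (Suc j) powr s * (coef u (Suc j))\<^sup>2" for j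
    using s lam_1_pos monoD[OF lam_mono, of 1 "Suc j"] by (intro mult_right_mono powr_mono2) auto
  ultimately show ?thesis by (rule sums_le[rotated])
qed

text \<open>Applicable to any eigenfunction of \<open>lam 1\<close>, whatever its multiplicity.
  Symmetry of the Dirichlet form gives \<open>lam 1 * coef \<psi> j = lam j * coef \<psi> j\<close>,
  so only coefficients with \<open>lam j = lam 1\<close> survive.\<close>

lemma eigenfunction_lam_1:
  assumes \<psi>: "neumann_eigenfunction \<Omega> (lam 1) \<psi>" and s: "0 < s"
  shows "\<psi> \<in> Hs \<Omega> lam \<phi> s" "(LINT x|M. \<psi> x) = 0"
    "spectral_form \<Omega> lam \<phi> s \<psi> = lam 1 powr s * L2_inner \<Omega> \<psi> \<psi>"
proof -
  obtain G where G: "has_weak_gradient \<Omega> \<psi> G"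
    and eq: "\<And>v H. has_weak_gradient \<Omega> v H \<Longrightarrow> (LINT x|M. G x \<bullet> H x) = lam 1 * L2_inner \<Omega> \<psi> v"
    using \<psi> unfolding neumann_eigenfunction_def by blast
  have L: "\<psi> \<in> L2 \<Omega>" by (rule has_weak_gradient_L2[OF G])
  have "lam 1 * L2_inner \<Omega> \<psi> (\<lambda>x. 1) = 0"
    using eq[OF has_weak_gradient_const, of 1] by simp
  then show mean: "(LINT x|M. \<psi> x) = 0" using lam_1_pos by (simp add: inner_const)
  have "lam j = lam 1 \<or> coef \<psi> j = 0" for j
  proof -
    have "lam 1 * coef \<psi> j = (LINT x|M. G x \<bullet> \<phi>_grad j x)"
      by (rule eq[OF \<phi>_grad, symmetric])
    also have "\<dots> = (LINT x|M. \<phi>_grad j x \<bullet> G x)" by (simp add: inner_commute)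
    also have "\<dots> = lam j * coef \<psi> j"
      using \<phi>_grad_inner[OF G, of j] by (simp add: L2_inner_commute)
    finally show ?thesis by auto
  qed
  then have eqs: "lam (Suc j) powr s * (coef \<psi> (Suc j))\<^sup>2 = lam 1 powr s * (coef \<psi> (Suc j))\<^sup>2" for j
    by (metis mult_zero_right power_zero_numeral)
  have sums: "(\<lambda>j. lam (Suc j) powr s * (coef \<psi> (Suc j))\<^sup>2) sums (lam 1 powr s * L2_inner \<Omega> \<psi> \<psi>)"
    unfolding eqs by (intro sums_mult parseval_mean_0 L mean)
  then show "\<psi> \<in> Hs \<Omega> lam \<phi> s" using L by (auto simp: Hs_def sums_iff)
  show "spectral_form \<Omega> lam \<phi> s \<psi> = lam 1 powr s * L2_inner \<Omega> \<psi> \<psi>"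
    using sums by (simp add: spectral_form_def sums_iff)
qed

end

section \<open>Expansion of the power function\<close>

lemma powr_le_2_powr_abs:
  fixes x r :: real
  assumes "1 / 2 \<le> x" "x \<le> 2"
  shows "x powr r \<le> 2 powr \<bar>r\<bar>"
proof (cases "0 \<le> r")
  case True
  then show ?thesis using assms by (auto intro: powr_mono2)
next
  case False
  have "x powr r = (1 / x) powr (- r)"
    using assms by (simp add: powr_divide powr_minus_divide)
  also have "\<dots> \<le> 2 powr (- r)"
    using assms False by (intro powr_mono2) (auto simp: field_simps)
  finally show ?thesis using False by simp
qed

text \<open>Taylor's formula with Lagrange remainder. \<open>P m\<close> is the falling factorial,
  and \<open>1 + t\<close> stays between 1/2 and 3/2, where its power \<open>p - 4\<close> is at
  most \<open>2 powr \<bar>p - 4\<bar>\<close>.\<close>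

lemma powr_Taylor_4:
  fixes p :: real
  obtains C where "0 \<le> C" "\<And>w. \<bar>w\<bar> \<le> 1 / 2 \<Longrightarrow>
    \<bar>(1 + w) powr p - (1 + p * w + p * (p - 1) / 2 * w\<^sup>2 + p * (p - 1) * (p - 2) / 6 * w ^ 3)\<bar> \<le> C * \<bar>w\<bar> ^ 4"
proof -
  define P where "P m = (\<Prod>i<m. p - real i)" for m
  define D where "D m t = P m * (1 + t) powr (p - real m)" for m t
  have deriv: "DERIV (D m) t :> D (Suc m) t" if "- (1 / 2) \<le> t" for m t
  proof -
    have "DERIV (\<lambda>t. 1 + t) t :> 1" by (auto intro!: derivative_eq_intros)
    from DERIV_cmult[OF DERIV_fun_powr[OF this, of "p - real m"], of "P m"] that
    show ?thesis by (simp add: D_def[abs_def] P_def algebra_simps)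
  qed
  define C where "C = \<bar>P 4\<bar> / 24 * 2 powr \<bar>p - 4\<bar>"
  show ?thesis
  proof (rule that[of C])
    show "0 \<le> C" by (simp add: C_def)
    fix w :: real assume w: "\<bar>w\<bar> \<le> 1 / 2"
    show "\<bar>(1 + w) powr p - (1 + p * w + p * (p - 1) / 2 * w\<^sup>2 + p * (p - 1) * (p - 2) / 6 * w ^ 3)\<bar> \<le> C * \<bar>w\<bar> ^ 4"
    proof (cases "w = 0")
      case False
      have "\<exists>t. (if w < 0 then w < t \<and> t < 0 else 0 < t \<and> t < w) \<and>
        D 0 w = (\<Sum>m<4. D m 0 / fact m * (w - 0) ^ m) + D 4 t / fact 4 * (w - 0) ^ 4"
        by (rule Taylor[where a = "- (1 / 2)" and b = "1 / 2"]) (use w False deriv in auto)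
      then obtain t where t0: "if w < 0 then w < t \<and> t < 0 else 0 < t \<and> t < w"
        and "D 0 w = (\<Sum>m<4. D m 0 / fact m * (w - 0) ^ m) + D 4 t / fact 4 * (w - 0) ^ 4"
        by (elim exE conjE)
      then have eq: "D 0 w = (\<Sum>m<4. D m 0 / fact m * w ^ m) + D 4 t / fact 4 * w ^ 4" by simp
      have t: "\<bar>t\<bar> \<le> 1 / 2" using t0 w by (auto split: if_splits)
      have "(\<Sum>m<4. D m 0 / fact m * w ^ m)
          = 1 + p * w + p * (p - 1) / 2 * w\<^sup>2 + p * (p - 1) * (p - 2) / 6 * w ^ 3"
        by (simp add: D_def P_def eval_nat_numeral lessThan_Suc algebra_simps)
      then have "(1 + w) powr p - (1 + p * w + p * (p - 1) / 2 * w\<^sup>2 + p * (p - 1) * (p - 2) / 6 * w ^ 3)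
          = D 4 t / fact 4 * w ^ 4"
        using eq by (simp add: D_def P_def)
      moreover have "\<bar>D 4 t / fact 4 * w ^ 4\<bar> \<le> C * \<bar>w\<bar> ^ 4"
      proof -
        have "\<bar>D 4 t\<bar> \<le> \<bar>P 4\<bar> * 2 powr \<bar>p - 4\<bar>"
          unfolding D_def abs_mult using t powr_le_2_powr_abs[of "1 + t" "p - 4"]
          by (intro mult_left_mono) auto
        then have "\<bar>D 4 t / fact 4\<bar> \<le> C" by (simp add: C_def fact_numeral)
        then show ?thesis unfolding abs_mult power_abs by (intro mult_right_mono) auto
      qed
      ultimately show ?thesis by simp
    qed simp
  qed
qed

text \<open>With \<open>y = 1 + q * w\<close>, Young's inequality for the product of
  \<open>y powr (1 / q)\<close> and 1 is the tangent inequality; for \<open>y \<le> 0\<close> the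
  left side is not positive. The absolute value makes it available for every real
  \<open>w\<close>.\<close>

lemma Bernoulli_powr:
  fixes q w :: real
  assumes q: "1 < q"
  shows "1 + q * w \<le> \<bar>1 + w\<bar> powr q"
proof (cases "1 + q * w \<le> 0")
  case True
  then show ?thesis using powr_ge_zero[of "\<bar>1 + w\<bar>" q] by linarith
next
  case False
  define y where "y = 1 + q * w"
  have y: "0 < y" using False by (simp add: y_def)
  define q' where "q' = q / (q - 1)"
  have q': "1 < q'" "1 / q + 1 / q' = 1" using q by (auto simp: q'_def field_simps)
  have "y powr (1 / q) * 1 \<le> (y powr (1 / q)) powr q / q + 1 powr q' / q'"
    by (rule Youngs_inequality) (use q q' in auto)
  also have "\<dots> = y / q + (1 - 1 / q)"
  proof -
    have "1 / q' = 1 - 1 / q" using q'(2) by linarith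
    then show ?thesis using y q by (simp add: powr_powr)
  qed
  also have "\<dots> = 1 + w" using q by (simp add: y_def field_simps)
  finally have "y powr (1 / q) \<le> 1 + w" by simp
  moreover from this have "0 \<le> 1 + w" using powr_ge_zero[of y "1 / q"] by linarith
  ultimately have "(y powr (1 / q)) powr q \<le> \<bar>1 + w\<bar> powr q"
    using q by (intro powr_mono2) auto
  then show ?thesis using y q by (simp add: powr_powr y_def)
qed

text \<open>Near 0 the cubic and quartic terms are absorbed in \<open>\<eta> * w\<^sup>2\<close>;
  away from 0 everything is absorbed in \<open>\<bar>w\<bar> powr q\<close>. The excess
  \<open>\<eta>\<close> must be at choice, since below the critical parameter the quadratic terms
  leave only a limited slack.\<close>

lemma powr_upper_expansion:
  fixes q \<eta> :: real
  assumes q: "2 < q" and \<eta>: "0 < \<eta>"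
  obtains C where "0 \<le> C" "\<And>w. \<bar>1 + w\<bar> powr q \<le> 1 + q * w + (q * (q - 1) / 2 + \<eta>) * w\<^sup>2 + C * \<bar>w\<bar> powr q"
proof -
  let ?K = "q * (q - 1) / 2" let ?K3 = "q * (q - 1) * (q - 2) / 6"
  obtain C4 where C4: "0 \<le> C4" and taylor: "\<And>w. \<bar>w\<bar> \<le> 1 / 2 \<Longrightarrow>
    \<bar>(1 + w) powr q - (1 + q * w + ?K * w\<^sup>2 + ?K3 * w ^ 3)\<bar> \<le> C4 * \<bar>w\<bar> ^ 4"
    by (rule powr_Taylor_4[of q]) blast
  have K: "0 < ?K" "0 < ?K3" using q by auto
  define a where "a = min (1 / 2) (\<eta> / (?K3 + C4))"
  have a: "0 < a" "a \<le> 1 / 2"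
  proof -
    show "0 < a" using \<eta> K C4 by (auto simp: a_def add_pos_nonneg)
    show "a \<le> 1 / 2" unfolding a_def by (rule min.cobounded1)
  qed
  have a_le: "(?K3 + C4) * a \<le> \<eta>"
  proof -
    have "a \<le> \<eta> / (?K3 + C4)" by (simp add: a_def)
    then show ?thesis using K C4 by (simp add: pos_le_divide_eq add_pos_nonneg mult.commute)
  qed
  \<comment> \<open>For \<open>\<bar>w\<bar> > a\<close> the first summand comes from
    \<open>\<bar>1 + w\<bar> \<le> (1 / a + 1) * \<bar>w\<bar>\<close>. The second compensates the
    linear term when it is negative, through
    \<open>\<bar>w\<bar> \<le> a powr (1 - q) * \<bar>w\<bar> powr q\<close>.\<close>
  define C where "C = (1 / a + 1) powr q + q * a powr (1 - q)"
  show ?thesis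
  proof (rule that[of C])
    show "0 \<le> C" using q by (simp add: C_def)
    fix w :: real
    show "\<bar>1 + w\<bar> powr q \<le> 1 + q * w + (?K + \<eta>) * w\<^sup>2 + C * \<bar>w\<bar> powr q"
    proof (cases "\<bar>w\<bar> \<le> a")
      case True
      then have w: "\<bar>w\<bar> \<le> 1 / 2" using a by linarith
      have "\<bar>1 + w\<bar> powr q \<le> 1 + q * w + ?K * w\<^sup>2 + ?K3 * w ^ 3 + C4 * \<bar>w\<bar> ^ 4"
        using taylor[OF w] w by (simp add: abs_le_iff)
      moreover have "?K3 * w ^ 3 + C4 * \<bar>w\<bar> ^ 4 \<le> \<eta> * w\<^sup>2"
      proof -
        have "?K3 * w ^ 3 \<le> ?K3 * (\<bar>w\<bar> * w\<^sup>2)"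
        proof (rule mult_left_mono)
          have "w ^ 3 = w * w\<^sup>2" by (simp add: power3_eq_cube power2_eq_square)
          also have "\<dots> \<le> \<bar>w\<bar> * w\<^sup>2" by (rule mult_right_mono) auto
          finally show "w ^ 3 \<le> \<bar>w\<bar> * w\<^sup>2" .
        qed (use K in simp)
        moreover have "C4 * \<bar>w\<bar> ^ 4 \<le> C4 * (\<bar>w\<bar> * w\<^sup>2)"
        proof (intro mult_left_mono C4)
          have "\<bar>w\<bar> ^ 4 = (\<bar>w\<bar> * w\<^sup>2) * \<bar>w\<bar>" by (simp add: eval_nat_numeral mult_ac flip: abs_mult)
          also have "\<dots> \<le> \<bar>w\<bar> * w\<^sup>2" using w by (intro mult_left_le) auto
          finally show "\<bar>w\<bar> ^ 4 \<le> \<bar>w\<bar> * w\<^sup>2" .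
        qed
        moreover have "?K3 * (\<bar>w\<bar> * w\<^sup>2) + C4 * (\<bar>w\<bar> * w\<^sup>2) = (?K3 + C4) * \<bar>w\<bar> * w\<^sup>2"
          by (simp only: distrib_right mult.assoc)
        moreover have "(?K3 + C4) * \<bar>w\<bar> * w\<^sup>2 \<le> \<eta> * w\<^sup>2"
        proof (rule mult_right_mono)
          have "(?K3 + C4) * \<bar>w\<bar> \<le> (?K3 + C4) * a" using True K C4 by (intro mult_left_mono) auto
          then show "(?K3 + C4) * \<bar>w\<bar> \<le> \<eta>" using a_le by linarith
        qed simp
        ultimately show ?thesis by linarith
      qed
      moreover have "0 \<le> C * \<bar>w\<bar> powr q" using q by (simp add: C_def)
      moreover have "(?K + \<eta>) * w\<^sup>2 = ?K * w\<^sup>2 + \<eta> * w\<^sup>2" by (rule distrib_right)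
      ultimately show ?thesis by linarith
    next
      case False
      then have w: "a < \<bar>w\<bar>" by simp
      have "\<bar>1 + w\<bar> \<le> (1 / a + 1) * \<bar>w\<bar>"
      proof -
        have "1 \<le> \<bar>w\<bar> / a" using w a by simp
        then show ?thesis by (simp add: distrib_right)
      qed
      then have "\<bar>1 + w\<bar> powr q \<le> ((1 / a + 1) * \<bar>w\<bar>) powr q"
        using q by (intro powr_mono2) auto
      also have "\<dots> = (1 / a + 1) powr q * \<bar>w\<bar> powr q"
        using a by (simp add: powr_mult)
      finally have 1: "\<bar>1 + w\<bar> powr q \<le> (1 / a + 1) powr q * \<bar>w\<bar> powr q" .
      have "\<bar>w\<bar> = \<bar>w\<bar> powr q * \<bar>w\<bar> powr (1 - q)"
        using w a by (simp flip: powr_add)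
      also have "\<dots> \<le> \<bar>w\<bar> powr q * a powr (1 - q)"
        using w a q by (intro mult_left_mono powr_mono2') auto
      finally have "q * \<bar>w\<bar> \<le> q * (\<bar>w\<bar> powr q * a powr (1 - q))"
        using q by (intro mult_left_mono) auto
      moreover have "- (q * w) \<le> q * \<bar>w\<bar>"
      proof -
        have "q * (- w) \<le> q * \<bar>w\<bar>" using q by (intro mult_left_mono) auto
        then show ?thesis by simp
      qed
      moreover have "0 \<le> (?K + \<eta>) * w\<^sup>2" using K \<eta> by simp
      moreover have "C * \<bar>w\<bar> powr q
          = (1 / a + 1) powr q * \<bar>w\<bar> powr q + q * (\<bar>w\<bar> powr q * a powr (1 - q))"
      proof -
        have "(A + q * D) * E = A * E + q * (E * D)" for A D E :: real by (simp add: algebra_simps)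
        then show ?thesis unfolding C_def .
      qed
      ultimately show ?thesis using 1 by linarith
    qed
  qed
qed

text \<open>Measures how far the power falls below a polynomial: the Taylor polynomial of degree 2
  for \<open>\<kappa> = 0\<close>, of degree 3 for the cubic coefficient. The positive part suffices
  for lower bounds of an integral of the power, and it has a growth bound independent of the
  exponent \<open>q\<close>.\<close>

definition expansion_defect :: "real \<Rightarrow> real \<Rightarrow> real \<Rightarrow> real" where
  "expansion_defect q \<kappa> w =
    max 0 (1 + q * w + q * (q - 1) / 2 * w\<^sup>2 + \<kappa> * w ^ 3 - \<bar>1 + w\<bar> powr q)"

lemma expansion_defect_continuous: 
  assumes "0 < q"
  shows "continuous_on UNIV (expansion_defect q \<kappa>)"
  unfolding expansion_defect_def[abs_def] using assms
  by (intro continuous_intros continuous_on_powr') auto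

text \<open>Near 0 the defect is a Taylor remainder of order \<open>m + 1\<close>. For large
  arguments Bernoulli's inequality discards the power together with the linear part, which leaves at
  most order \<open>m\<close>. Integrability of \<open>\<bar>\<psi>\<bar> ^ m\<close> will therefore
  be enough for dominated convergence.\<close>

lemma expansion_defect_bound:
  assumes q: "2 < q" and m: "m = 2 \<and> \<kappa> = 0 \<or> m = 3 \<and> \<kappa> = q * (q - 1) * (q - 2) / 6"
  obtains C where "0 \<le> C" "\<And>w. expansion_defect q \<kappa> w \<le> C * \<bar>w\<bar> ^ m"
    "\<And>w. \<bar>w\<bar> \<le> 1 / 2 \<Longrightarrow> expansion_defect q \<kappa> w \<le> C * \<bar>w\<bar> ^ Suc m"
proof -
  let ?K = "q * (q - 1) / 2" let ?K3 = "q * (q - 1) * (q - 2) / 6"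
  obtain C4 where C4: "0 \<le> C4" and taylor: "\<And>w. \<bar>w\<bar> \<le> 1 / 2 \<Longrightarrow>
    \<bar>(1 + w) powr q - (1 + q * w + ?K * w\<^sup>2 + ?K3 * w ^ 3)\<bar> \<le> C4 * \<bar>w\<bar> ^ 4"
    by (rule powr_Taylor_4[of q]) blast
  have K: "0 < ?K" "0 < ?K3" using q by auto
  define C where "C = ?K3 + C4 + 2 * ?K"
  have C: "0 \<le> C" "?K3 + C4 \<le> C" "2 * ?K + ?K3 \<le> C" using K C4 by (auto simp: C_def)
  have small: "expansion_defect q \<kappa> w \<le> C * \<bar>w\<bar> ^ Suc m" if w: "\<bar>w\<bar> \<le> 1 / 2" for w
  proof -
    have "1 + q * w + ?K * w\<^sup>2 + \<kappa> * w ^ 3 - \<bar>1 + w\<bar> powr q \<le> (\<kappa> - ?K3) * w ^ 3 + C4 * \<bar>w\<bar> ^ 4"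
      using taylor[OF w] w by (simp add: abs_le_iff left_diff_distrib)
    also have "\<dots> \<le> (?K3 + C4) * \<bar>w\<bar> ^ Suc m"
    proof (cases "m = 2")
      case True
      then have "\<kappa> = 0" using m by auto
      have "\<bar>w\<bar> ^ 4 \<le> \<bar>w\<bar> ^ 3" using w by (intro power_decreasing) auto
      then have "C4 * \<bar>w\<bar> ^ 4 \<le> C4 * \<bar>w\<bar> ^ 3" using C4 by (rule mult_left_mono)
      moreover have "- (?K3 * w ^ 3) \<le> ?K3 * \<bar>w\<bar> ^ 3"
      proof -
        have "?K3 * (- (w ^ 3)) \<le> ?K3 * \<bar>w\<bar> ^ 3"
          using K by (intro mult_left_mono) (auto simp flip: power_abs)
        then show ?thesis by simp
      qed
      ultimately show ?thesis using True \<open>\<kappa> = 0\<close> by (simp add: distrib_right)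
    next
      case False
      then have "\<kappa> = ?K3" "m = 3" using m by auto
      have "0 \<le> ?K3 * \<bar>w\<bar> ^ 4" using K by (intro mult_nonneg_nonneg) auto
      then show ?thesis unfolding \<open>\<kappa> = ?K3\<close> \<open>m = 3\<close> by (simp add: distrib_right)
    qed
    also have "\<dots> \<le> C * \<bar>w\<bar> ^ Suc m" using C by (intro mult_right_mono) auto
    finally show ?thesis using C by (simp add: expansion_defect_def)
  qed
  show ?thesis
  proof (rule that[OF C(1) _ small])
    fix w
    show "expansion_defect q \<kappa> w \<le> C * \<bar>w\<bar> ^ m"
    proof (cases "\<bar>w\<bar> \<le> 1 / 2")
      case True
      have "C * \<bar>w\<bar> ^ Suc m \<le> C * \<bar>w\<bar> ^ m"
        using True C by (intro mult_left_mono power_decreasing) auto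
      then show ?thesis using small[OF True] by linarith
    next
      case False
      then have w: "1 / 2 \<le> \<bar>w\<bar>" by simp
      have "1 + q * w + ?K * w\<^sup>2 + \<kappa> * w ^ 3 - \<bar>1 + w\<bar> powr q \<le> ?K * w\<^sup>2 + \<kappa> * w ^ 3"
        using Bernoulli_powr[of q w] q by simp
      also have "\<dots> \<le> (2 * ?K + ?K3) * \<bar>w\<bar> ^ m"
      proof (cases "m = 2")
        case True
        then have "\<kappa> = 0" using m by auto
        have "0 \<le> ?K * w\<^sup>2" "0 \<le> ?K3 * w\<^sup>2" using K by simp_all
        then show ?thesis using True \<open>\<kappa> = 0\<close> by (simp add: distrib_right)
      next
        case False
        then have \<kappa>: "\<kappa> = ?K3" "m = 3" using m by auto
        have "\<bar>w\<bar>\<^sup>2 * 1 \<le> \<bar>w\<bar>\<^sup>2 * (2 * \<bar>w\<bar>)" using w by (intro mult_left_mono) auto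
        then have "w\<^sup>2 \<le> 2 * \<bar>w\<bar> ^ 3" by (simp add: power3_eq_cube power2_eq_square)
        then have "?K * w\<^sup>2 \<le> ?K * (2 * \<bar>w\<bar> ^ 3)" using K by (intro mult_left_mono) auto
        moreover have "?K3 * w ^ 3 \<le> ?K3 * \<bar>w\<bar> ^ 3"
          using K by (intro mult_left_mono) (auto simp flip: power_abs)
        moreover have "(2 * ?K + ?K3) * \<bar>w\<bar> ^ 3 = ?K * (2 * \<bar>w\<bar> ^ 3) + ?K3 * \<bar>w\<bar> ^ 3"
        proof -
          have "(2 * a + b) * c = a * (2 * c) + b * c" for a b c :: real by (simp add: algebra_simps)
          then show ?thesis .
        qed
        ultimately show ?thesis unfolding \<kappa> by linarith
      qed
      also have "\<dots> \<le> C * \<bar>w\<bar> ^ m" using C by (intro mult_right_mono) auto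
      finally show ?thesis using C by (simp add: expansion_defect_def)
    qed
  qed
qed

context bounded_open_set
begin

text \<open>After division by \<open>\<bar>t n\<bar> ^ m\<close> the global bound dominates and the
  local bound gives pointwise convergence: the defect is of smaller order than the term that
  decides.\<close>

lemma expansion_defect_tendsto:
  fixes t :: "nat \<Rightarrow> real"
  assumes q: "2 < q" and m: "m = 2 \<and> \<kappa> = 0 \<or> m = 3 \<and> \<kappa> = q * (q - 1) * (q - 2) / 6"
    and \<psi>: "\<psi> \<in> borel_measurable M" "integrable M (\<lambda>x. \<bar>\<psi> x\<bar> ^ m)"
    and t: "t \<longlonglongrightarrow> 0" "\<And>n. t n \<noteq> 0"
  shows "integrable M (\<lambda>x. expansion_defect q \<kappa> (c * \<psi> x))"
    "(\<lambda>n. (LINT x|M. expansion_defect q \<kappa> (t n * \<psi> x)) / \<bar>t n\<bar> ^ m) \<longlonglongrightarrow> 0"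
proof -
  note [measurable] = \<psi>(1)
  obtain C where C: "0 \<le> C" "\<And>w. expansion_defect q \<kappa> w \<le> C * \<bar>w\<bar> ^ m"
    "\<And>w. \<bar>w\<bar> \<le> 1 / 2 \<Longrightarrow> expansion_defect q \<kappa> w \<le> C * \<bar>w\<bar> ^ Suc m"
    by (rule expansion_defect_bound[OF q m]) blast
  have nn: "0 \<le> expansion_defect q \<kappa> w" for w by (simp add: expansion_defect_def)
  have [measurable]: "expansion_defect q \<kappa> \<in> borel_measurable borel"
    using q by (intro borel_measurable_continuous_onI expansion_defect_continuous) simp
  have meas [measurable]: "(\<lambda>x. expansion_defect q \<kappa> (c * \<psi> x)) \<in> borel_measurable M" for c
    by measurable
  have bd: "\<bar>expansion_defect q \<kappa> (c * \<psi> x)\<bar> \<le> (C * \<bar>c\<bar> ^ m) * \<bar>\<psi> x\<bar> ^ m" for c x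
    using C(2)[of "c * \<psi> x"] nn by (simp add: abs_mult power_mult_distrib mult.assoc)
  show int: "integrable M (\<lambda>x. expansion_defect q \<kappa> (c * \<psi> x))" for c
  proof (rule Bochner_Integration.integrable_bound)
    show "integrable M (\<lambda>x. (C * \<bar>c\<bar> ^ m) * \<bar>\<psi> x\<bar> ^ m)" using \<psi>(2) by simp
    show "AE x in M. norm (expansion_defect q \<kappa> (c * \<psi> x)) \<le> norm ((C * \<bar>c\<bar> ^ m) * \<bar>\<psi> x\<bar> ^ m)"
      using bd by (auto intro!: AE_I2 intro: order_trans[OF _ abs_ge_self])
  qed measurable
  have "(\<lambda>n. LINT x|M. expansion_defect q \<kappa> (t n * \<psi> x) / \<bar>t n\<bar> ^ m) \<longlonglongrightarrow> (LINT x|M. 0)"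
  proof (rule integral_dominated_convergence[where w = "\<lambda>x. C * \<bar>\<psi> x\<bar> ^ m"])
    show "integrable M (\<lambda>x. C * \<bar>\<psi> x\<bar> ^ m)" using \<psi>(2) by simp
    show "AE x in M. norm (expansion_defect q \<kappa> (t n * \<psi> x) / \<bar>t n\<bar> ^ m) \<le> C * \<bar>\<psi> x\<bar> ^ m" for n
    proof (rule AE_I2)
      fix x
      have "\<bar>expansion_defect q \<kappa> (t n * \<psi> x)\<bar> / \<bar>t n\<bar> ^ m \<le> (C * \<bar>t n\<bar> ^ m) * \<bar>\<psi> x\<bar> ^ m / \<bar>t n\<bar> ^ m"
        by (intro divide_right_mono bd) simp
      then show "norm (expansion_defect q \<kappa> (t n * \<psi> x) / \<bar>t n\<bar> ^ m) \<le> C * \<bar>\<psi> x\<bar> ^ m"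
        using t(2)[of n] by (simp add: abs_divide power_abs)
    qed
    show "AE x in M. (\<lambda>n. expansion_defect q \<kappa> (t n * \<psi> x) / \<bar>t n\<bar> ^ m) \<longlonglongrightarrow> 0"
    proof (rule AE_I2)
      fix x
      have t\<psi>: "(\<lambda>n. t n * \<psi> x) \<longlonglongrightarrow> 0" using tendsto_mult_left_zero[OF t(1)] .
      have "eventually (\<lambda>n. \<bar>t n * \<psi> x\<bar> < 1 / 2) sequentially"
        using order_tendstoD(2)[OF tendsto_rabs_zero[OF t\<psi>], of "1 / 2"] by simp
      then have "eventually (\<lambda>n. norm (expansion_defect q \<kappa> (t n * \<psi> x) / \<bar>t n\<bar> ^ m)
          \<le> C * \<bar>\<psi> x\<bar> ^ m * \<bar>t n * \<psi> x\<bar>) sequentially"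
      proof eventually_elim
        case (elim n)
        have "expansion_defect q \<kappa> (t n * \<psi> x) \<le> C * \<bar>t n * \<psi> x\<bar> ^ Suc m"
          using elim by (intro C(3)) simp
        also have "\<dots> = C * \<bar>\<psi> x\<bar> ^ m * \<bar>t n * \<psi> x\<bar> * \<bar>t n\<bar> ^ m"
          by (simp add: abs_mult power_mult_distrib)
        finally show ?case
          using t(2)[of n] nn by (simp add: abs_divide power_abs pos_divide_le_eq)
      qed
      then show "(\<lambda>n. expansion_defect q \<kappa> (t n * \<psi> x) / \<bar>t n\<bar> ^ m) \<longlonglongrightarrow> 0"
        by (rule Lim_null_comparison)
          (intro tendsto_mult_right_zero tendsto_rabs_zero t\<psi>)
    qed
  qed simp_all
  then show "(\<lambda>n. (LINT x|M. expansion_defect q \<kappa> (t n * \<psi> x)) / \<bar>t n\<bar> ^ m) \<longlonglongrightarrow> 0"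
    by simp
qed

end

section \<open>Perturbations of the constant\<close>

text \<open>The scaling condition under which the embedding was proved. For \<open>n \<ge> 2\<close>
  or \<open>s < 1 / 2\<close> it is the bound by the critical exponent rearranged; in the remaining
  case \<open>n = 1\<close>, \<open>s \<ge> 1 / 2\<close> already implies it.\<close>

lemma admissible_exponent:
  fixes q s :: real
  assumes "admissible n s (ereal q)" "2 < q" "0 < s" "s < 1" "0 < n"
  shows "real n * (1 / 2 - 1 / q) \<le> s"
proof (cases "n \<ge> 2 \<or> s < 1 / 2")
  case True
  then have pos: "0 < real n - 2 * s" using assms by auto
  have "q \<le> 2 * real n / (real n - 2 * s)" using assms(1) True by (auto simp: admissible_def)
  then have "q * (real n - 2 * s) \<le> 2 * real n" using pos by (simp add: pos_le_divide_eq)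
  then have "real n - 2 * s \<le> 2 * real n / q" using assms by (simp add: pos_le_divide_eq mult.commute)
  then show ?thesis by (simp add: right_diff_distrib)
next
  case False
  then have "n = 1" "1 / 2 \<le> s" using assms by auto
  moreover have "1 / 2 - 1 / q \<le> s"
  proof -
    have "0 < 1 / q" using assms by simp
    then show ?thesis using \<open>1 / 2 \<le> s\<close> by linarith
  qed
  ultimately show ?thesis by simp
qed

lemma powr_upper_quadratic:
  fixes p :: real
  obtains C where "0 \<le> C" "\<And>X. 0 \<le> X \<Longrightarrow> X \<le> 1 / 2 \<Longrightarrow> (1 + X) powr p \<le> 1 + p * X + C * X\<^sup>2"
proof -
  let ?a = "p * (p - 1) / 2" and ?b = "p * (p - 1) * (p - 2) / 6"
  obtain C4 where C4: "0 \<le> C4" and taylor: "\<And>w. \<bar>w\<bar> \<le> 1 / 2 \<Longrightarrow>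
    \<bar>(1 + w) powr p - (1 + p * w + ?a * w\<^sup>2 + ?b * w ^ 3)\<bar> \<le> C4 * \<bar>w\<bar> ^ 4"
    by (rule powr_Taylor_4[of p]) blast
  show ?thesis
  proof (rule that[of "\<bar>?a\<bar> + \<bar>?b\<bar> + C4"])
    show "0 \<le> \<bar>?a\<bar> + \<bar>?b\<bar> + C4" using C4 by (intro add_nonneg_nonneg) auto
    fix X :: real assume X: "0 \<le> X" "X \<le> 1 / 2"
    then have "\<bar>X\<bar> \<le> 1 / 2" by simp
    from taylor[OF this] X
    have "(1 + X) powr p \<le> 1 + p * X + ?a * X\<^sup>2 + ?b * X ^ 3 + C4 * X ^ 4"
      by (simp add: abs_le_iff)
    moreover have "?a * X\<^sup>2 \<le> \<bar>?a\<bar> * X\<^sup>2" by (intro mult_right_mono) auto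
    moreover have "?b * X ^ 3 \<le> \<bar>?b\<bar> * X\<^sup>2"
      using X by (intro mult_mono power_decreasing) auto
    moreover have "C4 * X ^ 4 \<le> C4 * X\<^sup>2"
      using X C4 by (intro mult_left_mono power_decreasing) auto
    ultimately show "(1 + X) powr p \<le> 1 + p * X + (\<bar>?a\<bar> + \<bar>?b\<bar> + C4) * X\<^sup>2"
      unfolding distrib_right by linarith
  qed
qed

section \<open>Comparison of the quotient with its value at the constant\<close>

context unit_neumann_system
begin

lemma one_not_ae_zero: "\<not> ae_zero \<Omega> (\<lambda>x. 1)"
proof
  assume "ae_zero \<Omega> (\<lambda>x. 1)"
  then have "(LINT x|M. 1) = (LINT x|M. (0::real))"
    unfolding ae_zero_def by (intro integral_cong_AE) auto
  then show False by simp
qed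

lemma Lq_norm_square:
  "0 < q \<Longrightarrow> (Lq_norm \<Omega> (ereal q) u)\<^sup>2 = (LINT x|M. \<bar>u x\<bar> powr q) powr (2 / q)"
  by (simp add: Lq_norm_def power2_eq_square flip: powr_add)

lemma I_quot_finite:
  "0 < q \<Longrightarrow> I_quot \<Omega> lam \<phi> s (ereal q) \<epsilon> u
    = (spectral_form \<Omega> lam \<phi> s u + \<epsilon> powr (2 * s) * L2_inner \<Omega> u u) / (LINT x|M. \<bar>u x\<bar> powr q) powr (2 / q)"
  by (simp add: I_quot_def Lq_norm_square L2_norm_square)

lemma I_quot_one:
  assumes "2 < q"
  shows "I_quot \<Omega> lam \<phi> s q \<epsilon> (\<lambda>x. 1) = \<epsilon> powr (2 * s)"
proof -
  have "(Lq_norm \<Omega> q (\<lambda>x. 1))\<^sup>2 = 1"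
  proof (cases q)
    case PInf
    have "emeasure M (space M) \<noteq> 0"
      by (simp add: emeasure_eq_measure)
    from esssup_const[OF this, of "1::ereal"] show ?thesis using PInf by (simp add: Lq_norm_def one_ereal_def)
  qed (use assms in \<open>auto simp: Lq_norm_def\<close>)
  then show ?thesis
    by (simp add: I_quot_def spectral_form_const L2_norm_square inner_const)
qed

text \<open>Raising to the power \<open>q / 2\<close> frees the integral from its outer exponent, so
  that it can be expanded. The strict inequality also makes the integral positive, which excludes
  division by zero.\<close>

lemma I_quot_less:
  assumes q: "2 < q" and \<epsilon>: "0 < \<epsilon>" and u: "u \<in> Hs \<Omega> lam \<phi> s"
    and less: "(L2_inner \<Omega> u u + spectral_form \<Omega> lam \<phi> s u / \<epsilon> powr (2 * s)) powr (q / 2) < (LINT x|M. \<bar>u x\<bar> powr q)"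
  shows "I_quot \<Omega> lam \<phi> s (ereal q) \<epsilon> u < \<epsilon> powr (2 * s)"
proof -
  let ?A = "LINT x|M. \<bar>u x\<bar> powr q" and ?e = "\<epsilon> powr (2 * s)"
  define Y where "Y = L2_inner \<Omega> u u + spectral_form \<Omega> lam \<phi> s u / ?e"
  have Y: "0 \<le> Y" using L2_inner_self_nonneg spectral_form_nonneg[OF u] by (simp add: Y_def)
  have e: "0 < ?e" using \<epsilon> by simp
  have less: "Y powr (q / 2) < ?A" using less by (simp add: Y_def)
  have A: "0 < ?A" using less powr_ge_zero[of Y "q / 2"] by linarith
  have "Y < ?A powr (2 / q)"
  proof (rule ccontr)
    assume "\<not> ?thesis"
    then have "(?A powr (2 / q)) powr (q / 2) \<le> Y powr (q / 2)"
      using q by (intro powr_mono2) auto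
    then show False using less A q by (simp add: powr_powr)
  qed
  then have "?e * Y < ?e * ?A powr (2 / q)" using e by simp
  moreover have "?e * Y = spectral_form \<Omega> lam \<phi> s u + ?e * L2_inner \<Omega> u u"
    using e by (simp add: Y_def distrib_left)
  ultimately show ?thesis using A q by (simp add: I_quot_finite pos_divide_less_eq)
qed

text \<open>Positivity of the integral is a premise because a zero denominator would give the
  quotient the value 0.\<close>

lemma I_quot_ge:
  assumes q: "2 < q" and \<epsilon>: "0 < \<epsilon>" and u: "u \<in> Hs \<Omega> lam \<phi> s"
    and A: "0 < (LINT x|M. \<bar>u x\<bar> powr q)"
    and le: "(LINT x|M. \<bar>u x\<bar> powr q) \<le> (L2_inner \<Omega> u u + spectral_form \<Omega> lam \<phi> s u / \<epsilon> powr (2 * s)) powr (q / 2)"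
  shows "\<epsilon> powr (2 * s) \<le> I_quot \<Omega> lam \<phi> s (ereal q) \<epsilon> u"
proof -
  let ?A = "LINT x|M. \<bar>u x\<bar> powr q" and ?e = "\<epsilon> powr (2 * s)"
  define Y where "Y = L2_inner \<Omega> u u + spectral_form \<Omega> lam \<phi> s u / ?e"
  have Y: "0 \<le> Y" using L2_inner_self_nonneg spectral_form_nonneg[OF u] by (simp add: Y_def)
  have e: "0 < ?e" using \<epsilon> by simp
  have "?A powr (2 / q) \<le> (Y powr (q / 2)) powr (2 / q)"
    using A q le by (intro powr_mono2) (auto simp: Y_def)
  also have "\<dots> = Y" using Y q by (simp add: powr_powr)
  finally have "?e * ?A powr (2 / q) \<le> ?e * Y" using e by simp
  moreover have "?e * Y = spectral_form \<Omega> lam \<phi> s u + ?e * L2_inner \<Omega> u u"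
    using e by (simp add: Y_def distrib_left)
  ultimately show ?thesis using A q by (simp add: I_quot_finite pos_le_divide_eq)
qed

lemma Lq_integral_pos:
  assumes "integrable M (\<lambda>x. \<bar>u x\<bar> powr q)" "\<not> ae_zero \<Omega> u"
  shows "0 < (LINT x|M. \<bar>u x\<bar> powr q)"
proof -
  have "(LINT x|M. \<bar>u x\<bar> powr q) \<noteq> 0"
  proof
    assume "(LINT x|M. \<bar>u x\<bar> powr q) = 0"
    then have "AE x in M. \<bar>u x\<bar> powr q = 0"
      using integral_nonneg_eq_0_iff_AE[OF assms(1)] by simp
    then have "ae_zero \<Omega> u" unfolding ae_zero_def by eventually_elim simp
    then show False using assms(2) by simp
  qed
  moreover have "0 \<le> (LINT x|M. \<bar>u x\<bar> powr q)"
    by (rule Bochner_Integration.integral_nonneg) simp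
  ultimately show ?thesis by linarith
qed

section \<open>Competitors along an eigenfunction\<close>

lemma not_local_minimizerI:
  assumes "\<And>\<delta>. 0 < \<delta> \<Longrightarrow> \<exists>u\<in>Hs \<Omega> lam \<phi> s. \<not> ae_zero \<Omega> u \<and> Hs_norm \<Omega> lam \<phi> s (\<lambda>x. u x - v x) < \<delta>
    \<and> I_quot \<Omega> lam \<phi> s q \<epsilon> u < I_quot \<Omega> lam \<phi> s q \<epsilon> v"
  shows "\<not> local_minimizer \<Omega> lam \<phi> s q \<epsilon> v" "\<not> global_minimizer \<Omega> lam \<phi> s q \<epsilon> v"
  using assms assms[of 1] unfolding local_minimizer_def global_minimizer_def
  by (meson leD zero_less_one)+

text \<open>The pointwise expansion is integrated: mean zero removes the linear term, and the
  normalisation of \<open>\<psi>\<close> fixes the quadratic one.\<close>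

lemma Lq_integral_perturbation:
  assumes q: "2 < q" and \<psi>: "\<psi> \<in> L2 \<Omega>" "(LINT x|M. \<psi> x) = 0" "L2_inner \<Omega> \<psi> \<psi> = 1"
    and \<kappa>: "integrable M (\<lambda>x. \<kappa> * \<psi> x ^ 3)"
    and int: "integrable M (\<lambda>x. \<bar>1 + t * \<psi> x\<bar> powr q)"
    and def: "integrable M (\<lambda>x. expansion_defect q \<kappa> (t * \<psi> x))"
  shows "1 + q * (q - 1) / 2 * t\<^sup>2 + t ^ 3 * (LINT x|M. \<kappa> * \<psi> x ^ 3)
      - (LINT x|M. expansion_defect q \<kappa> (t * \<psi> x)) \<le> (LINT x|M. \<bar>1 + t * \<psi> x\<bar> powr q)"
proof -
  have i: "integrable M \<psi>" "integrable M (\<lambda>x. (\<psi> x)\<^sup>2)"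
    using \<psi>(1) L2_integrable L2_square_integrable by auto
  have "(LINT x|M. 1 + q * t * \<psi> x + q * (q - 1) / 2 * t\<^sup>2 * (\<psi> x)\<^sup>2 + t ^ 3 * (\<kappa> * \<psi> x ^ 3)
      - expansion_defect q \<kappa> (t * \<psi> x)) \<le> (LINT x|M. \<bar>1 + t * \<psi> x\<bar> powr q)"
  proof (rule Bochner_Integration.integral_mono)
    show "integrable M (\<lambda>x. 1 + q * t * \<psi> x + q * (q - 1) / 2 * t\<^sup>2 * (\<psi> x)\<^sup>2 + t ^ 3 * (\<kappa> * \<psi> x ^ 3)
      - expansion_defect q \<kappa> (t * \<psi> x))"
      using i \<kappa> def by (intro Bochner_Integration.integrable_diff Bochner_Integration.integrable_add
          integrable_mult_right) auto
    show "1 + q * t * \<psi> x + q * (q - 1) / 2 * t\<^sup>2 * (\<psi> x)\<^sup>2 + t ^ 3 * (\<kappa> * \<psi> x ^ 3)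
      - expansion_defect q \<kappa> (t * \<psi> x) \<le> \<bar>1 + t * \<psi> x\<bar> powr q" for x
    proof -
      have "1 + q * (t * \<psi> x) + q * (q - 1) / 2 * (t * \<psi> x)\<^sup>2 + \<kappa> * (t * \<psi> x) ^ 3 - \<bar>1 + t * \<psi> x\<bar> powr q
          \<le> expansion_defect q \<kappa> (t * \<psi> x)" unfolding expansion_defect_def by (rule max.cobounded2)
      moreover have "q * (q - 1) / 2 * (t * \<psi> x)\<^sup>2 = q * (q - 1) / 2 * t\<^sup>2 * (\<psi> x)\<^sup>2"
        "\<kappa> * (t * \<psi> x) ^ 3 = t ^ 3 * (\<kappa> * \<psi> x ^ 3)" "q * (t * \<psi> x) = q * t * \<psi> x"
        by (simp_all add: power_mult_distrib)
      ultimately show ?thesis by linarith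
    qed
  qed (rule int)
  moreover have "(LINT x|M. 1 + q * t * \<psi> x + q * (q - 1) / 2 * t\<^sup>2 * (\<psi> x)\<^sup>2 + t ^ 3 * (\<kappa> * \<psi> x ^ 3)
      - expansion_defect q \<kappa> (t * \<psi> x))
    = (LINT x|M. 1) + q * t * (LINT x|M. \<psi> x) + q * (q - 1) / 2 * t\<^sup>2 * (LINT x|M. (\<psi> x)\<^sup>2)
      + t ^ 3 * (LINT x|M. \<kappa> * \<psi> x ^ 3) - (LINT x|M. expansion_defect q \<kappa> (t * \<psi> x))"
    using i \<kappa> def
    by (simp only: Bochner_Integration.integral_diff Bochner_Integration.integral_add integral_mult_right_zero
        Bochner_Integration.integrable_diff Bochner_Integration.integrable_add
          integrable_mult_right integrable_const)
  ultimately show ?thesis using \<psi> by (simp add: L2_inner_self)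
qed

text \<open>In the application \<open>1 + \<beta> * t\<^sup>2\<close> is the squared L2 norm plus
  the scaled form of \<open>1 + t * \<psi>\<close>. The premise \<open>gap\<close> collects what is
  left at leading order as \<open>\<gamma> * r ^ m\<close>, which covers a decision at second order
  (\<open>m = 2\<close>) and at third order (\<open>m = 3\<close>) alike. The sign
  \<open>\<sigma>\<close> of the direction matters in the second of these.\<close>

lemma perturbation_beats_constant:
  fixes \<sigma> \<gamma> \<beta> q :: real
  assumes q: "2 < q" and \<psi>: "\<psi> \<in> L2 \<Omega>" "(LINT x|M. \<psi> x) = 0" "L2_inner \<Omega> \<psi> \<psi> = 1"
    and \<beta>: "0 \<le> \<beta>" and \<sigma>: "\<bar>\<sigma>\<bar> = 1"
    and m: "m = 2 \<and> \<kappa> = 0 \<or> m = 3 \<and> \<kappa> = q * (q - 1) * (q - 2) / 6"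
    and \<psi>m: "integrable M (\<lambda>x. \<bar>\<psi> x\<bar> ^ m)" and \<kappa>: "integrable M (\<lambda>x. \<kappa> * \<psi> x ^ 3)"
    and int: "\<And>t. integrable M (\<lambda>x. \<bar>1 + t * \<psi> x\<bar> powr q)"
    and gap: "\<And>r. (q * (q - 1) / 2 - q / 2 * \<beta>) * (\<sigma> * r)\<^sup>2 + (\<sigma> * r) ^ 3 * (LINT x|M. \<kappa> * \<psi> x ^ 3)
      = \<gamma> * r ^ m" and \<gamma>: "0 < \<gamma>"
  shows "\<forall>\<^sub>F n in sequentially. (1 + \<beta> * (\<sigma> / real (Suc n))\<^sup>2) powr (q / 2)
    < (LINT x|M. \<bar>1 + \<sigma> / real (Suc n) * \<psi> x\<bar> powr q)"
proof -
  define r where "r n = 1 / real (Suc n)" for n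
  have r: "0 < r n" "r n \<le> 1" for n by (auto simp: r_def)
  have r0: "r \<longlonglongrightarrow> 0" unfolding r_def[abs_def] using LIMSEQ_inverse_real_of_nat by (simp add: inverse_eq_divide)
  have t0: "(\<lambda>n. \<sigma> * r n) \<longlonglongrightarrow> 0" by (rule tendsto_mult_right_zero[OF r0])
  have \<sigma>0: "\<sigma> \<noteq> 0" using \<sigma> by auto
  have \<sigma>2: "\<sigma>\<^sup>2 = 1" using \<sigma> by (metis power2_abs one_power2)
  have abs_t: "\<bar>\<sigma> * r n\<bar> = r n" for n using \<sigma> r(1)[of n] by (simp add: abs_mult)
  have m_le: "Suc m \<le> 4" using m by auto
  obtain C where C: "0 \<le> C" and quad: "\<And>X. 0 \<le> X \<Longrightarrow> X \<le> 1 / 2 \<Longrightarrow> (1 + X) powr (q / 2) \<le> 1 + q / 2 * X + C * X\<^sup>2"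
    by (rule powr_upper_quadratic[of "q / 2"]) blast
  let ?D = "\<lambda>n. LINT x|M. expansion_defect q \<kappa> (\<sigma> * r n * \<psi> x)"
  note defect = expansion_defect_tendsto[OF q m L2_measurable[OF \<psi>(1)] \<psi>m t0]
  have ne: "\<sigma> * r n \<noteq> 0" for n using \<sigma>0 r(1)[of n] by simp
  have lim: "(\<lambda>n. ?D n / r n ^ m) \<longlonglongrightarrow> 0"
    using defect(2)[OF ne] by (simp add: abs_t)
  have "(\<lambda>n. ?D n / r n ^ m + C * \<beta>\<^sup>2 * r n) \<longlonglongrightarrow> 0 + C * \<beta>\<^sup>2 * 0"
    by (intro tendsto_intros lim r0)
  from order_tendstoD(2)[OF this, of \<gamma>] \<gamma>
  have ev1: "\<forall>\<^sub>F n in sequentially. ?D n / r n ^ m + C * \<beta>\<^sup>2 * r n < \<gamma>" by simp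
  have "(\<lambda>n. \<beta> * (r n)\<^sup>2) \<longlonglongrightarrow> \<beta> * 0\<^sup>2" by (intro tendsto_intros r0)
  from order_tendstoD(2)[OF this, of "1 / 2"]
  have ev2: "\<forall>\<^sub>F n in sequentially. \<beta> * (r n)\<^sup>2 < 1 / 2" by simp
  from ev1 ev2 show ?thesis
  proof eventually_elim
    case (elim n)
    let ?t = "\<sigma> * r n"
    have t2: "?t\<^sup>2 = (r n)\<^sup>2" by (simp add: power_mult_distrib \<sigma>2)
    have "(1 + \<beta> * ?t\<^sup>2) powr (q / 2) \<le> 1 + q / 2 * (\<beta> * ?t\<^sup>2) + C * (\<beta> * ?t\<^sup>2)\<^sup>2"
      by (rule quad) (use \<beta> elim t2 in auto)
    also have "C * (\<beta> * ?t\<^sup>2)\<^sup>2 = C * \<beta>\<^sup>2 * r n ^ 4"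
      unfolding t2 by (simp add: power_mult_distrib)
    \<comment> \<open>As \<open>r n \<le> 1\<close> and \<open>m \<le> 3\<close>, the fourth-order
      error of the left side is at most of order \<open>m + 1\<close>.\<close>
    also have "C * \<beta>\<^sup>2 * r n ^ 4 \<le> C * \<beta>\<^sup>2 * r n ^ Suc m"
      using C r m_le by (intro mult_left_mono power_decreasing) (auto simp: less_imp_le)
    also have "1 + q / 2 * (\<beta> * ?t\<^sup>2) + C * \<beta>\<^sup>2 * r n ^ Suc m
        < 1 + q / 2 * (\<beta> * ?t\<^sup>2) + \<gamma> * r n ^ m - ?D n"
    proof -
      have "(?D n / r n ^ m + C * \<beta>\<^sup>2 * r n) * r n ^ m < \<gamma> * r n ^ m"
        using r elim(1) by (intro mult_strict_right_mono) auto
      moreover have "(?D n / r n ^ m + C * \<beta>\<^sup>2 * r n) * r n ^ m = ?D n + C * \<beta>\<^sup>2 * r n ^ Suc m"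
        using r(1)[of n] by (simp add: distrib_right)
      ultimately show ?thesis by linarith
    qed
    also have "\<dots> = 1 + q * (q - 1) / 2 * ?t\<^sup>2 + ?t ^ 3 * (LINT x|M. \<kappa> * \<psi> x ^ 3) - ?D n"
      using gap[of "r n"] by (simp only: left_diff_distrib mult.assoc)
    also have "\<dots> \<le> (LINT x|M. \<bar>1 + ?t * \<psi> x\<bar> powr q)"
      by (rule Lq_integral_perturbation[OF q \<psi> \<kappa> int defect(1)[OF ne]])
    finally show ?case by (simp add: r_def)
  qed
qed

end

context unit_neumann_system
begin

text \<open>The conclusion keeps the form required by \<open>I_quot_less\<close>, with
  \<open>e\<close> for the power of the parameter, so that a competitor found at one parameter can
  be reused at nearby ones.\<close>

lemma better_perturbation:
  fixes \<sigma> \<gamma> q s e :: real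
  assumes q: "2 < q" and s: "0 < s" and e: "0 < e"
    and int: "\<And>u. u \<in> Hs \<Omega> lam \<phi> s \<Longrightarrow> integrable M (\<lambda>x. \<bar>u x\<bar> powr q)"
    and \<psi>: "neumann_eigenfunction \<Omega> (lam 1) \<psi>" "L2_inner \<Omega> \<psi> \<psi> = 1"
    and \<sigma>: "\<bar>\<sigma>\<bar> = 1"
    and m: "m = 2 \<and> \<kappa> = 0 \<or> m = 3 \<and> \<kappa> = q * (q - 1) * (q - 2) / 6"
    and \<psi>m: "integrable M (\<lambda>x. \<bar>\<psi> x\<bar> ^ m)" and \<kappa>: "integrable M (\<lambda>x. \<kappa> * \<psi> x ^ 3)"
    and gap: "\<And>r. q / 2 * (q - 2 - lam 1 powr s / e) * (\<sigma> * r)\<^sup>2 + (\<sigma> * r) ^ 3 * (LINT x|M. \<kappa> * \<psi> x ^ 3)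
      = \<gamma> * r ^ m" and \<gamma>: "0 < \<gamma>" and \<delta>: "0 < \<delta>"
  shows "\<exists>u\<in>Hs \<Omega> lam \<phi> s. \<not> ae_zero \<Omega> u \<and> Hs_norm \<Omega> lam \<phi> s (\<lambda>x. u x - 1) < \<delta>
    \<and> (L2_inner \<Omega> u u + spectral_form \<Omega> lam \<phi> s u / e) powr (q / 2) < (LINT x|M. \<bar>u x\<bar> powr q)"
proof -
  note eig = eigenfunction_lam_1[OF \<psi>(1) s]
  note L = Hs_L2[OF eig(1)]
  define \<beta> where "\<beta> = 1 + lam 1 powr s / e"
  have \<beta>: "0 \<le> \<beta>" using e by (simp add: \<beta>_def)
  have aff: "(\<lambda>x. 1 + t * \<psi> x) \<in> Hs \<Omega> lam \<phi> s" for t by (rule Hs_affine[OF eig(1)])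
  have gap': "(q * (q - 1) / 2 - q / 2 * \<beta>) * (\<sigma> * r)\<^sup>2 + (\<sigma> * r) ^ 3 * (LINT x|M. \<kappa> * \<psi> x ^ 3)
      = \<gamma> * r ^ m" for r
  proof -
    have "q * (q - 1) / 2 - q / 2 * (1 + z) = q / 2 * (q - 2 - z)" for z
      by (simp add: field_simps)
    then have "q * (q - 1) / 2 - q / 2 * \<beta> = q / 2 * (q - 2 - lam 1 powr s / e)"
      unfolding \<beta>_def .
    then show ?thesis using gap[of r] by (simp only:)
  qed
  have ev1: "\<forall>\<^sub>F n in sequentially. (1 + \<beta> * (\<sigma> / real (Suc n))\<^sup>2) powr (q / 2)
      < (LINT x|M. \<bar>1 + \<sigma> / real (Suc n) * \<psi> x\<bar> powr q)"
    by (rule perturbation_beats_constant[OF q L eig(2) \<psi>(2) \<beta> \<sigma> m \<psi>m \<kappa> int[OF aff] gap' \<gamma>])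
  have "(\<lambda>n. 1 / real (Suc n) * Hs_norm \<Omega> lam \<phi> s \<psi>) \<longlonglongrightarrow> 0 * Hs_norm \<Omega> lam \<phi> s \<psi>"
    using LIMSEQ_inverse_real_of_nat by (intro tendsto_mult tendsto_const) (simp add: inverse_eq_divide)
  from order_tendstoD(2)[OF this, of \<delta>] \<delta>
  have "\<forall>\<^sub>F n in sequentially. 1 / real (Suc n) * Hs_norm \<Omega> lam \<phi> s \<psi> < \<delta>" by simp
  with ev1 have "\<forall>\<^sub>F n in sequentially. (1 + \<beta> * (\<sigma> / real (Suc n))\<^sup>2) powr (q / 2)
      < (LINT x|M. \<bar>1 + \<sigma> / real (Suc n) * \<psi> x\<bar> powr q) \<and> 1 / real (Suc n) * Hs_norm \<Omega> lam \<phi> s \<psi> < \<delta>"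
    by eventually_elim simp
  then obtain n where n1: "(1 + \<beta> * (\<sigma> / real (Suc n))\<^sup>2) powr (q / 2)
      < (LINT x|M. \<bar>1 + \<sigma> / real (Suc n) * \<psi> x\<bar> powr q)"
    and n2: "1 / real (Suc n) * Hs_norm \<Omega> lam \<phi> s \<psi> < \<delta>"
    using eventually_happens'[OF sequentially_bot] by blast
  define t where "t = \<sigma> / real (Suc n)"
  let ?u = "\<lambda>x. 1 + t * \<psi> x"
  have "\<not> ae_zero \<Omega> ?u"
  proof
    assume "ae_zero \<Omega> ?u"
    then have "(LINT x|M. \<bar>?u x\<bar> powr q) = (LINT x|M. 0)"
      using int[OF aff, of t] unfolding ae_zero_def
      by (intro integral_cong_AE borel_measurable_integrable) auto
    then have "(1 + \<beta> * t\<^sup>2) powr (q / 2) < 0" using n1 unfolding t_def by simp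
    then show False using powr_ge_zero[of "1 + \<beta> * t\<^sup>2" "q / 2"] by linarith
  qed
  moreover have "Hs_norm \<Omega> lam \<phi> s (\<lambda>x. ?u x - 1) < \<delta>"
  proof -
    have "Hs_norm \<Omega> lam \<phi> s (\<lambda>x. ?u x - 1) = \<bar>t\<bar> * Hs_norm \<Omega> lam \<phi> s \<psi>"
      using Hs_norm_cmult[OF eig(1)] by simp
    then show ?thesis using n2 \<sigma> by (simp add: t_def abs_divide)
  qed
  moreover have "(L2_inner \<Omega> ?u ?u + spectral_form \<Omega> lam \<phi> s ?u / e) powr (q / 2) < (LINT x|M. \<bar>?u x\<bar> powr q)"
  proof -
    have "L2_inner \<Omega> ?u ?u + spectral_form \<Omega> lam \<phi> s ?u / e = 1 + \<beta> * t\<^sup>2"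
      by (simp add: inner_affine[OF L eig(2)] spectral_form_affine[OF eig(1)] eig(3) \<psi>(2) \<beta>_def algebra_simps)
    then show ?thesis using n1 by (simp only: t_def)
  qed
  ultimately show ?thesis using aff[of t] by blast
qed

text \<open>Along \<open>1 + t * \<psi>\<close> the squared essential supremum exceeds
  \<open>1 + 2 * t * c\<close>, a first-order gain, while the numerator grows only at order
  \<open>t\<^sup>2\<close>. Hence no positive parameter protects the constant.\<close>

lemma not_local_minimizer_infinity:
  assumes \<epsilon>: "0 < \<epsilon>" and s: "0 < s"
    and \<psi>: "neumann_eigenfunction \<Omega> (lam 1) \<psi>" "L2_inner \<Omega> \<psi> \<psi> = 1" and \<delta>: "0 < \<delta>"
  shows "\<exists>u\<in>Hs \<Omega> lam \<phi> s. \<not> ae_zero \<Omega> u \<and> Hs_norm \<Omega> lam \<phi> s (\<lambda>x. u x - 1) < \<delta>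
    \<and> I_quot \<Omega> lam \<phi> s \<infinity> \<epsilon> u < I_quot \<Omega> lam \<phi> s \<infinity> \<epsilon> (\<lambda>x. 1)"
proof -
  note eig = eigenfunction_lam_1[OF \<psi>(1) s]
  note L = Hs_L2[OF eig(1)]
  define e where "e = \<epsilon> powr (2 * s)"
  have e: "0 < e" using \<epsilon> by (simp add: e_def)
  \<comment> \<open>Otherwise \<open>\<psi> \<le> 0\<close> almost everywhere, and mean zero would
    make it vanish, against the normalisation.\<close>
  have "\<exists>c>0. \<not> (AE x in M. \<psi> x \<le> c)"
  proof (rule ccontr)
    assume "\<not> ?thesis"
    then have "\<forall>n. AE x in M. \<psi> x \<le> 1 / real (Suc n)" by simp
    then have "AE x in M. \<forall>n. \<psi> x \<le> 1 / real (Suc n)" by (simp add: AE_all_countable)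
    then have neg: "AE x in M. 0 \<le> - \<psi> x"
    proof eventually_elim
      case (elim x)
      have "(\<lambda>n. 1 / real (Suc n)) \<longlonglongrightarrow> 0"
        using LIMSEQ_inverse_real_of_nat by (simp add: inverse_eq_divide)
      then have "\<psi> x \<le> 0" using elim by (intro LIMSEQ_le_const) auto
      then show ?case by simp
    qed
    have "AE x in M. - \<psi> x = 0"
      using integral_nonneg_eq_0_iff_AE[of M "\<lambda>x. - \<psi> x"] neg L2_integrable[OF L] eig(2) by simp
    then have "L2_inner \<Omega> \<psi> \<psi> = L2_inner \<Omega> (\<lambda>x. 0) \<psi>"
      by (intro L2_inner_cong_AE L L2_const) simp
    then show False using \<psi>(2) by (simp add: L2_inner_def)
  qed
  then obtain c where c: "0 < c" "\<not> (AE x in M. \<psi> x \<le> c)" by blast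
  define b where "b = lam 1 powr s / e + 1"
  have b: "0 < b" using e by (simp add: b_def add_nonneg_pos)
  define H where "H = Hs_norm \<Omega> lam \<phi> s \<psi>"
  have H: "0 \<le> H" unfolding H_def by (rule Hs_norm_nonneg[OF eig(1)])
  \<comment> \<open>Small enough for \<open>t * b < 2 * c\<close>, so that the first-order gain
    wins, and for \<open>t * H < \<delta>\<close>, so that the competitor is close to the
    constant.\<close>
  define t where "t = min (c / b) (\<delta> / (H + 1)) / 2"
  have t: "0 < t" using b c \<delta> H by (auto simp: t_def)
  have t1: "t * b < 2 * c"
  proof -
    have "t \<le> (c / b) / 2" unfolding t_def by (intro divide_right_mono min.cobounded1) simp
    also have "\<dots> < 2 * c / b" using b c by (simp add: field_simps)
    finally show ?thesis using b by (simp add: pos_less_divide_eq)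
  qed
  have t2: "t * H < \<delta>"
  proof -
    have "t \<le> (\<delta> / (H + 1)) / 2" unfolding t_def by (intro divide_right_mono min.cobounded2) simp
    also have "\<dots> < \<delta> / (H + 1)"
    proof -
      have "0 < \<delta> / (H + 1)" using H \<delta> by simp
      moreover have "x / 2 < x" if "0 < x" for x :: real using that by simp
      ultimately show ?thesis by blast
    qed
    finally have "t * (H + 1) < \<delta>" using H by (simp add: pos_less_divide_eq)
    then show ?thesis using t by (simp add: distrib_left)
  qed
  let ?u = "\<lambda>x. 1 + t * \<psi> x"
  have aff: "?u \<in> Hs \<Omega> lam \<phi> s" by (rule Hs_affine[OF eig(1)])
  let ?S = "esssup M (\<lambda>x. ereal \<bar>?u x\<bar>)"
  have S: "AE x in M. ereal \<bar>?u x\<bar> \<le> ?S" by (rule esssup_AE)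
  have S_gt: "ereal (1 + t * c) < ?S"
  proof (rule ccontr)
    assume "\<not> ?thesis"
    then have "?S \<le> ereal (1 + t * c)" by simp
    have "AE x in M. \<psi> x \<le> c"
      using S
    proof eventually_elim
      case (elim x)
      then have "ereal \<bar>?u x\<bar> \<le> ereal (1 + t * c)" using \<open>?S \<le> _\<close> by (rule order_trans)
      then have "1 + t * \<psi> x \<le> 1 + t * c" by simp
      then show ?case using t by simp
    qed
    then show False using c(2) by simp
  qed
  have nz: "\<not> ae_zero \<Omega> ?u"
  proof
    assume "ae_zero \<Omega> ?u"
    then have "AE x in M. \<psi> x \<le> c" unfolding ae_zero_def
    proof eventually_elim
      case (elim x)
      then have "t * \<psi> x < t * c" using t c by (smt (verit) mult_pos_pos)
      then show ?case using t by simp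
    qed
    then show False using c(2) by simp
  qed
  have num: "spectral_form \<Omega> lam \<phi> s ?u + e * L2_inner \<Omega> ?u ?u = e * (1 + t\<^sup>2 * b)"
    using e by (simp add: inner_affine[OF L eig(2)] spectral_form_affine[OF eig(1)] eig(3) \<psi>(2) b_def algebra_simps)
  have "I_quot \<Omega> lam \<phi> s \<infinity> \<epsilon> ?u < e"
  proof (cases ?S)
    case (real r)
    then have r: "1 + t * c < r" using S_gt by simp
    have "1 + t\<^sup>2 * b < 1 + 2 * (t * c)"
      using mult_strict_left_mono[OF t1 t] by (simp add: power2_eq_square mult_ac)
    also have "\<dots> \<le> (1 + t * c)\<^sup>2"
      by (simp add: power2_sum)
    also have "\<dots> < r\<^sup>2"
      using r t c by (intro power_strict_mono) auto
    finally have "e * (1 + t\<^sup>2 * b) < e * r\<^sup>2" using e by simp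
    moreover have "0 < r" using r t c by (smt (verit) mult_pos_pos)
    ultimately show ?thesis
      using num by (simp add: I_quot_def Lq_norm_def real L2_norm_square e_def[symmetric] pos_divide_less_eq)
  next
    case PInf
    \<comment> \<open>Here the norm has the junk value \<open>real_of_ereal \<infinity> = 0\<close>, and the quotient is \<open>0\<close>.\<close>
    then show ?thesis using e by (simp add: I_quot_def Lq_norm_def)
  next
    case MInf
    then show ?thesis using S_gt by simp
  qed
  then have "I_quot \<Omega> lam \<phi> s \<infinity> \<epsilon> ?u < I_quot \<Omega> lam \<phi> s \<infinity> \<epsilon> (\<lambda>x. 1)"
    by (simp add: I_quot_one e_def)
  moreover have "Hs_norm \<Omega> lam \<phi> s (\<lambda>x. ?u x - 1) < \<delta>"
    using t t2 Hs_norm_cmult[OF eig(1), of t] by (simp add: H_def)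
  ultimately show ?thesis using aff nz by blast
qed

text \<open>With \<open>u = a * (1 + w)\<close> and \<open>w\<close> of mean zero the factor
  \<open>a\<close> cancels. Bernoulli's inequality bounds the power of norm plus form from below,
  \<open>powr_upper_expansion\<close> the integral from above. The difference of the quadratic parts
  is \<open>q / 2 * (Q / e - (q - 2) * y)\<close>, at least \<open>G * Q\<close> by the spectral
  gap; the excess \<open>\<eta> * y\<close> and the term of degree \<open>q\<close> each take at
  most half of it.\<close>

lemma local_minimizer_subcritical:
  assumes q: "2 < q" and s: "0 < s" and \<epsilon>: "0 < \<epsilon>" and sub: "q - 2 < lam 1 powr s / \<epsilon> powr (2 * s)"
    and C: "0 \<le> C" "\<And>u. u \<in> Hs \<Omega> lam \<phi> s \<Longrightarrow> integrable M (\<lambda>x. \<bar>u x\<bar> powr q)"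
      "\<And>u. u \<in> Hs \<Omega> lam \<phi> s \<Longrightarrow> (LINT x|M. \<bar>u x\<bar> powr q) \<le> C * Hs_norm \<Omega> lam \<phi> s u powr q"
  shows "local_minimizer \<Omega> lam \<phi> s (ereal q) \<epsilon> (\<lambda>x. 1)"
proof -
  define e where "e = \<epsilon> powr (2 * s)"
  define \<Lambda> where "\<Lambda> = lam 1 powr s"
  have e: "0 < e" using \<epsilon> by (simp add: e_def)
  have \<Lambda>: "0 < \<Lambda>" using lam_1_pos by (simp add: \<Lambda>_def)
  have sub': "(q - 2) * e < \<Lambda>" using sub e by (simp add: e_def \<Lambda>_def pos_less_divide_eq)
  \<comment> \<open>The slack that the strict inequality \<open>sub\<close> leaves after
    \<open>y\<close> has been replaced by its upper bound \<open>Q / \<Lambda>\<close>.\<close>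
  define G where "G = q / 2 * (1 / e - (q - 2) / \<Lambda>)"
  have G: "0 < G"
  proof -
    have "(q - 2) / \<Lambda> < 1 / e"
      using sub' e \<Lambda> by (simp add: divide_less_eq less_divide_eq mult.commute)
    then show ?thesis using q unfolding G_def by (intro mult_pos_pos) auto
  qed
  define \<eta> where "\<eta> = G * \<Lambda> / 2"
  have \<eta>: "0 < \<eta>" using G \<Lambda> by (simp add: \<eta>_def)
  obtain C1 where C1: "0 \<le> C1" and up: "\<And>w. \<bar>1 + w\<bar> powr q
      \<le> 1 + q * w + (q * (q - 1) / 2 + \<eta>) * w\<^sup>2 + C1 * \<bar>w\<bar> powr q"
    by (rule powr_upper_expansion[OF q \<eta>]) blast
  \<comment> \<open>\<open>B\<close> will bound the norm of \<open>w\<close> to the power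
    \<open>q - 2\<close>, the factor by which the term of degree \<open>q\<close> is smaller than
    the squared norm. This value lets that term consume at most half of the slack.\<close>
  define B where "B = G / (2 * (1 / \<Lambda> + 1) * (C1 * C + 1))"
  have CC: "0 \<le> C1 * C" using C1 C(1) by simp
  have pos: "0 < (1 / \<Lambda> + 1)" using \<Lambda> by (simp add: add_pos_pos)
  have B: "0 < B" using G pos CC by (simp add: B_def add_nonneg_pos)
  have BC: "C1 * C * B * (1 / \<Lambda> + 1) \<le> G / 2"
  proof -
    have "(C1 * C + 1) * B * (1 / \<Lambda> + 1) = G / 2"
    proof -
      have "K * (G / (2 * P * K)) * P = G / 2" if "0 < K" "0 < P" for K P :: real
        using that by simp
      then show ?thesis unfolding B_def using pos CC by (meson add_nonneg_pos zero_less_one)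
    qed
    moreover have "C1 * C * B * (1 / \<Lambda> + 1) \<le> (C1 * C + 1) * B * (1 / \<Lambda> + 1)"
      using B pos by (intro mult_right_mono) auto
    ultimately show ?thesis by (simp only:)
  qed
  \<comment> \<open>The entry 1/2 keeps the mean \<open>a\<close> at least 1/2, so division by
    \<open>a\<close> at most doubles the norm; the second entry is therefore arranged for
    \<open>2 * \<delta>\<close>.\<close>
  define \<delta> where "\<delta> = min (1 / 2) (B powr (1 / (q - 2)) / 2)"
  have \<delta>: "0 < \<delta>" "\<delta> \<le> 1 / 2" "2 * \<delta> \<le> B powr (1 / (q - 2))" using B by (auto simp: \<delta>_def min_def)
  have \<delta>B: "(2 * \<delta>) powr (q - 2) \<le> B"
  proof -
    have "(2 * \<delta>) powr (q - 2) \<le> (B powr (1 / (q - 2))) powr (q - 2)"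
      using \<delta> q by (intro powr_mono2) auto
    then show ?thesis using B q by (simp add: powr_powr)
  qed
  have "I_quot \<Omega> lam \<phi> s (ereal q) \<epsilon> (\<lambda>x. 1) \<le> I_quot \<Omega> lam \<phi> s (ereal q) \<epsilon> u"
    if u: "u \<in> Hs \<Omega> lam \<phi> s" and nz: "\<not> ae_zero \<Omega> u" and near: "Hs_norm \<Omega> lam \<phi> s (\<lambda>x. u x - 1) < \<delta>" for u
  proof -
    note uL = Hs_L2[OF u]
    define a where "a = (LINT x|M. u x)"
    define v where "v x = - a + 1 * u x" for x
    have v: "v \<in> Hs \<Omega> lam \<phi> s" unfolding v_def by (rule Hs_affine[OF u])
    note vL = Hs_L2[OF v]
    have v0: "(LINT x|M. v x) = 0"
      using L2_integrable[OF uL] by (simp add: v_def a_def)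
    have u1: "(\<lambda>x. u x - 1) = (\<lambda>x. (a - 1) + 1 * v x)" by (auto simp: v_def)
    have u1H: "(\<lambda>x. u x - 1) \<in> Hs \<Omega> lam \<phi> s" unfolding u1 by (rule Hs_affine[OF v])
    let ?n = "Hs_norm \<Omega> lam \<phi> s (\<lambda>x. u x - 1)"
    have n2: "?n\<^sup>2 = spectral_form \<Omega> lam \<phi> s v + (a - 1)\<^sup>2 + L2_inner \<Omega> v v"
      unfolding Hs_norm_square[OF u1H] unfolding u1
      by (simp only: spectral_form_affine[OF v] inner_affine[OF vL v0]) simp
    have n0: "0 \<le> ?n" by (rule Hs_norm_nonneg[OF u1H])
    have a: "1 / 2 \<le> a"
    proof -
      have "(a - 1)\<^sup>2 \<le> ?n\<^sup>2"
        unfolding n2 using spectral_form_nonneg[OF v] L2_inner_self_nonneg[of v] by simp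
      then have "\<bar>a - 1\<bar> \<le> ?n" using n0 by (simp add: abs_le_square_iff[symmetric])
      then show ?thesis using near \<delta>(2) by linarith
    qed
    define w where "w x = 1 / a * v x" for x
    have w: "w \<in> Hs \<Omega> lam \<phi> s" unfolding w_def by (rule Hs_cmult[OF v])
    note wL = Hs_L2[OF w]
    have w0: "(LINT x|M. w x) = 0" using v0 by (simp add: w_def)
    have uw: "u = (\<lambda>x. a + a * w x)" using a by (auto simp: w_def v_def)
    define y where "y = L2_inner \<Omega> w w"
    define Q where "Q = spectral_form \<Omega> lam \<phi> s w"
    have y: "0 \<le> y" unfolding y_def by (rule L2_inner_self_nonneg)
    have gap: "\<Lambda> * y \<le> Q" unfolding \<Lambda>_def y_def Q_def by (rule spectral_gap[OF w w0 s])
    have Q: "0 \<le> Q" using gap y \<Lambda> by (meson mult_nonneg_nonneg less_imp_le order_trans)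
    have y_le: "y \<le> Q / \<Lambda>" using gap \<Lambda> by (simp add: pos_le_divide_eq mult.commute)
    let ?W = "Hs_norm \<Omega> lam \<phi> s w"
    have W0: "0 \<le> ?W" by (rule Hs_norm_nonneg[OF w])
    have W2: "?W\<^sup>2 = Q + y" unfolding y_def Q_def by (rule Hs_norm_square[OF w])
    have W_le: "?W \<le> 2 * \<delta>"
    proof -
      have "?W = 1 / a * Hs_norm \<Omega> lam \<phi> s v"
        using a unfolding w_def by (subst Hs_norm_cmult[OF v]) simp
      also have "\<dots> \<le> 2 * Hs_norm \<Omega> lam \<phi> s v"
        using a Hs_norm_nonneg[OF v] by (intro mult_right_mono) (auto simp: field_simps)
      also have "Hs_norm \<Omega> lam \<phi> s v \<le> ?n"
      proof (rule power2_le_imp_le[OF _ n0])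
        show "(Hs_norm \<Omega> lam \<phi> s v)\<^sup>2 \<le> ?n\<^sup>2" unfolding n2 Hs_norm_square[OF v] by simp
      qed
      finally show ?thesis using near by simp
    qed
    have wq: "(LINT x|M. \<bar>w x\<bar> powr q) \<le> C * (B * (Q + y))"
    proof -
      have "(LINT x|M. \<bar>w x\<bar> powr q) \<le> C * ?W powr q" by (rule C(3)[OF w])
      also have "?W powr q \<le> B * (Q + y)"
      proof (cases "?W = 0")
        case True
        then show ?thesis using B Q y by simp
      next
        case False
        have "?W powr q = ?W powr (q - 2) * ?W powr 2" by (simp flip: powr_add)
        also have "?W powr 2 = Q + y" using W0 False W2 by simp
        also have "?W powr (q - 2) * (Q + y) \<le> B * (Q + y)"
        proof (rule mult_right_mono)
          have "?W powr (q - 2) \<le> (2 * \<delta>) powr (q - 2)"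
            using W0 W_le q by (intro powr_mono2) auto
          then show "?W powr (q - 2) \<le> B" using \<delta>B by linarith
        qed (use Q y in auto)
        finally show ?thesis .
      qed
      then have "C * ?W powr q \<le> C * (B * (Q + y))" using C(1) by (rule mult_left_mono)
      finally show ?thesis .
    qed
    have wi: "integrable M w" "integrable M (\<lambda>x. (w x)\<^sup>2)" "integrable M (\<lambda>x. \<bar>w x\<bar> powr q)"
      using L2_integrable[OF wL] L2_square_integrable[OF wL] C(2)[OF w] by auto
    have w1: "(\<lambda>x. 1 + 1 * w x) \<in> Hs \<Omega> lam \<phi> s" by (rule Hs_affine[OF w])
    let ?K = "q * (q - 1) / 2"
    have "(LINT x|M. \<bar>1 + w x\<bar> powr q)
        \<le> (LINT x|M. 1 + q * w x + (?K + \<eta>) * (w x)\<^sup>2 + C1 * \<bar>w x\<bar> powr q)"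
      using C(2)[OF w1] wi up by (intro Bochner_Integration.integral_mono) auto
    also have "\<dots> = 1 + (?K + \<eta>) * y + C1 * (LINT x|M. \<bar>w x\<bar> powr q)"
      using wi w0 by (simp add: y_def L2_inner_self)
    also have "\<dots> \<le> 1 + (?K + \<eta>) * y + C1 * (C * (B * (Q + y)))"
      using wq C1 by (intro add_left_mono mult_left_mono)
    also have "\<dots> \<le> 1 + q / 2 * (y + Q / e)"
    proof -
      have "C1 * (C * (B * (Q + y))) \<le> C1 * (C * (B * (Q * (1 / \<Lambda> + 1))))"
      proof (intro mult_left_mono)
        show "Q + y \<le> Q * (1 / \<Lambda> + 1)" using y_le by (simp add: distrib_left)
      qed (use B C(1) C1 in auto)
      also have "\<dots> = Q * (C1 * C * B * (1 / \<Lambda> + 1))" by (simp only: mult_ac)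
      also have "\<dots> \<le> Q * (G / 2)" by (rule mult_left_mono[OF BC Q])
      finally have 1: "C1 * (C * (B * (Q + y))) \<le> Q * (G / 2)" .
      have "\<eta> * y \<le> \<eta> * (Q / \<Lambda>)" using y_le \<eta> by (intro mult_left_mono) auto
      also have "\<dots> = Q * (G / 2)" using \<Lambda> by (simp add: \<eta>_def)
      finally have 2: "\<eta> * y \<le> Q * (G / 2)" .
      have "q / 2 * (q - 2) * y \<le> q / 2 * (q - 2) * (Q / \<Lambda>)"
        using y_le q by (intro mult_left_mono) auto
      moreover have "Q * G + q / 2 * (q - 2) * (Q / \<Lambda>) = q / 2 * (Q / e)"
        using e \<Lambda> by (simp add: G_def field_simps)
      moreover have "?K * y = q / 2 * y + q / 2 * (q - 2) * y"
        by (simp add: field_simps)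
      ultimately show ?thesis using 1 2 unfolding distrib_right distrib_left by linarith
    qed
    also have "\<dots> \<le> \<bar>1 + (y + Q / e)\<bar> powr (q / 2)"
      using q by (intro Bernoulli_powr) simp
    also have "\<bar>1 + (y + Q / e)\<bar> = 1 + (y + Q / e)" using y Q e by simp
    finally have main: "(LINT x|M. \<bar>1 + w x\<bar> powr q) \<le> (1 + (y + Q / e)) powr (q / 2)" .
    have "e \<le> I_quot \<Omega> lam \<phi> s (ereal q) \<epsilon> u"
      unfolding e_def
    proof (rule I_quot_ge[OF q \<epsilon> u Lq_integral_pos[OF C(2)[OF u] nz]])
      have "(LINT x|M. \<bar>u x\<bar> powr q) = (LINT x|M. a powr q * \<bar>1 + w x\<bar> powr q)"
      proof (intro Bochner_Integration.integral_cong refl)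
        fix x
        have "\<bar>u x\<bar> = \<bar>a * (1 + w x)\<bar>" by (subst uw) (simp add: distrib_left)
        then have "\<bar>u x\<bar> = a * \<bar>1 + w x\<bar>" using a by (simp add: abs_mult)
        then show "\<bar>u x\<bar> powr q = a powr q * \<bar>1 + w x\<bar> powr q" using a by (simp add: powr_mult)
      qed
      also have "\<dots> = a powr q * (LINT x|M. \<bar>1 + w x\<bar> powr q)" by simp
      also have "\<dots> \<le> a powr q * (1 + (y + Q / e)) powr (q / 2)"
        by (intro mult_left_mono main) simp
      also have "\<dots> = (a\<^sup>2 * (1 + (y + Q / e))) powr (q / 2)"
      proof -
        have "a powr q = (a\<^sup>2) powr (q / 2)" using a powr_powr[of a 2 "q / 2"] by simp
        then show ?thesis using y Q e by (simp add: powr_mult)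
      qed
      also have "a\<^sup>2 * (1 + (y + Q / e)) = L2_inner \<Omega> u u + spectral_form \<Omega> lam \<phi> s u / e"
        unfolding uw by (simp add: inner_affine[OF wL w0] spectral_form_affine[OF w] y_def Q_def algebra_simps)
      finally show "(LINT x|M. \<bar>u x\<bar> powr q)
          \<le> (L2_inner \<Omega> u u + spectral_form \<Omega> lam \<phi> s u / \<epsilon> powr (2 * s)) powr (q / 2)"
        by (simp add: e_def)
    qed
    then show ?thesis using q by (simp add: I_quot_one e_def)
  qed
  then show ?thesis
    unfolding local_minimizer_def using \<delta>(1) one_not_ae_zero Hs_const by blast
qed

end

section \<open>The supercritical and the critical parameter\<close>

context unit_neumann_system
begin

text \<open>Second order decides: the coefficient along \<open>\<phi> 1\<close> is
  \<open>q / 2 * (q - 2 - lam 1 powr s / \<epsilon> powr (2 * s))\<close>, which is positive here,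
  whence \<open>m = 2\<close> and \<open>\<kappa> = 0\<close>.\<close>

lemma not_minimizer_supercritical:
  assumes q: "2 < q" and s: "0 < s" and \<epsilon>: "0 < \<epsilon>" and super: "lam 1 powr s / \<epsilon> powr (2 * s) < q - 2"
    and int: "\<And>u. u \<in> Hs \<Omega> lam \<phi> s \<Longrightarrow> integrable M (\<lambda>x. \<bar>u x\<bar> powr q)"
  shows "\<not> local_minimizer \<Omega> lam \<phi> s (ereal q) \<epsilon> (\<lambda>x. 1)"
    "\<not> global_minimizer \<Omega> lam \<phi> s (ereal q) \<epsilon> (\<lambda>x. 1)"
proof -
  have e: "0 < \<epsilon> powr (2 * s)" using \<epsilon> by simp
  have \<phi>1: "L2_inner \<Omega> (\<phi> 1) (\<phi> 1) = 1" by (simp add: \<phi>_inner)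
  have sq: "integrable M (\<lambda>x. \<bar>\<phi> 1 x\<bar> ^ 2)" using L2_square_integrable[OF \<phi>_L2] by simp
  have better: "\<exists>u\<in>Hs \<Omega> lam \<phi> s. \<not> ae_zero \<Omega> u \<and> Hs_norm \<Omega> lam \<phi> s (\<lambda>x. u x - 1) < \<delta>
    \<and> I_quot \<Omega> lam \<phi> s (ereal q) \<epsilon> u < I_quot \<Omega> lam \<phi> s (ereal q) \<epsilon> (\<lambda>x. 1)" if "0 < \<delta>" for \<delta>
    using better_perturbation[where \<sigma> = 1 and m = 2 and \<kappa> = 0 and \<gamma> = "q / 2 * (q - 2 - lam 1 powr s / \<epsilon> powr (2 * s))",
        OF q s e int eigenfunction \<phi>1 _ _ sq _ _ _ that] I_quot_less[OF q \<epsilon>] q super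
    by (auto simp: I_quot_one)
  show "\<not> local_minimizer \<Omega> lam \<phi> s (ereal q) \<epsilon> (\<lambda>x. 1)"
    "\<not> global_minimizer \<Omega> lam \<phi> s (ereal q) \<epsilon> (\<lambda>x. 1)"
    by (rule not_local_minimizerI[OF better], assumption)+
qed

text \<open>The second-order coefficient vanishes and third order decides. Moving in the direction
  given by the sign of the cubic integral turns the odd term into a gain.\<close>

lemma better_perturbation_critical:
  assumes q: "2 < q" and s: "0 < s" and e: "0 < e" "lam 1 powr s / e = q - 2"
    and int: "\<And>u. u \<in> Hs \<Omega> lam \<phi> s \<Longrightarrow> integrable M (\<lambda>x. \<bar>u x\<bar> powr q)"
    and \<psi>: "neumann_eigenfunction \<Omega> (lam 1) \<psi>" "L2_inner \<Omega> \<psi> \<psi> = 1"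
    and cubic: "(LINT x|M. \<psi> x ^ 3) \<noteq> 0" and \<delta>: "0 < \<delta>"
  shows "\<exists>u\<in>Hs \<Omega> lam \<phi> s. \<not> ae_zero \<Omega> u \<and> Hs_norm \<Omega> lam \<phi> s (\<lambda>x. u x - 1) < \<delta>
    \<and> (L2_inner \<Omega> u u + spectral_form \<Omega> lam \<phi> s u / e) powr (q / 2) < (LINT x|M. \<bar>u x\<bar> powr q)"
proof -
  let ?I = "LINT x|M. \<psi> x ^ 3"
  define \<kappa> where "\<kappa> = q * (q - 1) * (q - 2) / 6"
  have \<kappa>: "0 < \<kappa>" using q by (simp add: \<kappa>_def)
  \<comment> \<open>The Bochner integral of a function that is not integrable is \<open>0\<close>.\<close>
  have i3: "integrable M (\<lambda>x. \<psi> x ^ 3)" using cubic not_integrable_integral_eq by blast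
  have i: "integrable M (\<lambda>x. \<bar>\<psi> x\<bar> ^ 3)" "integrable M (\<lambda>x. \<kappa> * \<psi> x ^ 3)"
    using integrable_abs[OF i3] i3 by (simp_all add: power_abs)
  have \<sigma>: "\<bar>sgn ?I\<bar> = 1" using cubic by (simp add: abs_sgn_eq)
  have gap: "q / 2 * (q - 2 - lam 1 powr s / e) * (sgn ?I * r)\<^sup>2 + (sgn ?I * r) ^ 3 * (LINT x|M. \<kappa> * \<psi> x ^ 3)
      = \<kappa> * \<bar>?I\<bar> * r ^ 3" for r
  proof -
    have "sgn ?I ^ 3 * ?I = \<bar>?I\<bar>"
      using cubic by (cases "?I > 0") (auto simp: sgn_if)
    then have "(sgn ?I * r) ^ 3 * (\<kappa> * ?I) = \<kappa> * \<bar>?I\<bar> * r ^ 3"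
      by (simp only: power_mult_distrib mult_ac)
    then show ?thesis using e(2) by simp
  qed
  have "0 < \<kappa> * \<bar>?I\<bar>" using \<kappa> cubic by simp
  then show ?thesis
    using better_perturbation[where \<sigma> = "sgn ?I" and m = 3 and \<kappa> = \<kappa> and \<gamma> = "\<kappa> * \<bar>?I\<bar>",
        OF q s e(1) int \<psi> \<sigma> _ i gap _ \<delta>] by (simp add: \<kappa>_def)
qed

end

theorem theorem1:
  fixes \<Omega> :: "'a::euclidean_space set"
    and lam :: "nat \<Rightarrow> real" and \<phi> :: "nat \<Rightarrow> 'a \<Rightarrow> real"
    and s :: real and q :: ereal
  assumes "bounded \<Omega>" and "lipschitz_domain \<Omega>" and "measure lebesgue \<Omega> = 1"
    and "neumann_eigensystem \<Omega> lam \<phi>"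
    and "0 < s" and "s < 1"
    and "admissible DIM('a) s q" and "2 < q"
  shows "(\<forall>\<epsilon>. eps_crit (lam 1) s q < \<epsilon> \<longrightarrow>
            \<not> local_minimizer \<Omega> lam \<phi> s q \<epsilon> (\<lambda>x. 1) \<and>
            \<not> global_minimizer \<Omega> lam \<phi> s q \<epsilon> (\<lambda>x. 1)) \<and>
         (q < \<infinity> \<longrightarrow> (\<forall>\<epsilon>. 0 < \<epsilon> \<and> \<epsilon> < eps_crit (lam 1) s q \<longrightarrow>
            local_minimizer \<Omega> lam \<phi> s q \<epsilon> (\<lambda>x. 1))) \<and>
         (\<forall>\<psi>. q < \<infinity> \<and> neumann_eigenfunction \<Omega> (lam 1) \<psi> \<and> L2_norm \<Omega> \<psi> = 1 \<and>
            (LINT x|lebesgue_on \<Omega>. (\<psi> x) ^ 3) \<noteq> 0 \<longrightarrow>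
            \<not> local_minimizer \<Omega> lam \<phi> s q (eps_crit (lam 1) s q) (\<lambda>x. 1) \<and>
            (\<exists>\<epsilon>0 < eps_crit (lam 1) s q. \<forall>\<epsilon>. 0 < \<epsilon> \<and> \<epsilon>0 < \<epsilon> \<and> \<epsilon> \<le> eps_crit (lam 1) s q \<longrightarrow>
               \<not> global_minimizer \<Omega> lam \<phi> s q \<epsilon> (\<lambda>x. 1) \<and>
               (\<epsilon> < eps_crit (lam 1) s q \<longrightarrow> local_minimizer \<Omega> lam \<phi> s q \<epsilon> (\<lambda>x. 1))))"
proof -
  interpret unit_neumann_system \<Omega> lam \<phi>
    using assms(1-4) by unfold_locales (auto simp: lipschitz_domain_def)
  note s = \<open>0 < s\<close> \<open>s < 1\<close>
  show ?thesis
  proof (cases q)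
    case PInf
    \<comment> \<open>The critical value is 0 here, so all positive parameters are covered; the
      assertions about finite exponents are vacuous.\<close>
    have "\<not> local_minimizer \<Omega> lam \<phi> s \<infinity> \<epsilon> (\<lambda>x. 1)" "\<not> global_minimizer \<Omega> lam \<phi> s \<infinity> \<epsilon> (\<lambda>x. 1)"
      if "0 < \<epsilon>" for \<epsilon>
      using not_local_minimizerI[OF not_local_minimizer_infinity[OF that s(1) eigenfunction]]
      by (simp_all add: \<phi>_inner)
    then show ?thesis by (simp add: PInf eps_crit_def)
  next
    case MInf
    then show ?thesis using \<open>2 < q\<close> by simp
  next
    case (real p)
    have p: "2 < p" using \<open>2 < q\<close> real by simp
    have exponent: "real DIM('a) * (1 / 2 - 1 / p) \<le> s"
      using admissible_exponent[of "DIM('a)" s p] assms(7) real p s by simp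
    obtain C where C: "0 \<le> C" "\<And>u. u \<in> Hs \<Omega> lam \<phi> s \<Longrightarrow> integrable M (\<lambda>x. \<bar>u x\<bar> powr p)"
      "\<And>u. u \<in> Hs \<Omega> lam \<phi> s \<Longrightarrow> (LINT x|M. \<bar>u x\<bar> powr p) \<le> C * Hs_norm \<Omega> lam \<phi> s u powr p"
      by (rule Hs_embedding[OF \<open>lipschitz_domain \<Omega>\<close> s p exponent]) blast
    define \<Lambda> where "\<Lambda> = lam 1 powr s"
    have \<Lambda>: "0 < \<Lambda>" using lam_1_pos by (simp add: \<Lambda>_def)
    define c where "c = eps_crit (lam 1) s q"
    have c_eq: "c = (\<Lambda> / (p - 2)) powr (1 / (2 * s))"
      by (simp add: c_def eps_crit_def real \<Lambda>_def)
    have c: "0 < c" using \<Lambda> p by (simp add: c_eq)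
    \<comment> \<open>Through this identity and the monotonicity of the power \<open>2 * s\<close>,
      comparing \<open>\<epsilon>\<close> with \<open>c\<close> becomes comparing
      \<open>\<Lambda> / \<epsilon> powr (2 * s)\<close> with \<open>p - 2\<close>, the sign that
      decides at second order.\<close>
    have c_powr: "c powr (2 * s) = \<Lambda> / (p - 2)"
      using \<Lambda> p s by (simp add: c_eq powr_powr)
    have super: "\<Lambda> / \<epsilon> powr (2 * s) < p - 2" if "c < \<epsilon>" for \<epsilon>
    proof -
      have "\<Lambda> / (p - 2) < \<epsilon> powr (2 * s)"
        using powr_less_mono2[of "2 * s" c \<epsilon>] c that s c_powr by simp
      then show ?thesis using p c that by (simp add: pos_divide_less_eq mult.commute)
    qed
    have sub: "p - 2 < \<Lambda> / \<epsilon> powr (2 * s)" if "0 < \<epsilon>" "\<epsilon> < c" for \<epsilon>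
    proof -
      have "\<epsilon> powr (2 * s) < \<Lambda> / (p - 2)"
        using powr_less_mono2[of "2 * s" \<epsilon> c] that s c_powr by simp
      then show ?thesis using p that by (simp add: pos_less_divide_eq mult.commute)
    qed
    have part1: "\<not> local_minimizer \<Omega> lam \<phi> s q \<epsilon> (\<lambda>x. 1) \<and> \<not> global_minimizer \<Omega> lam \<phi> s q \<epsilon> (\<lambda>x. 1)"
      if "c < \<epsilon>" for \<epsilon>
      using not_minimizer_supercritical[OF p s(1) _ super[OF that, unfolded \<Lambda>_def] C(2)] c that
      by (simp add: real)
    have part2: "local_minimizer \<Omega> lam \<phi> s q \<epsilon> (\<lambda>x. 1)" if "0 < \<epsilon>" "\<epsilon> < c" for \<epsilon>
      using local_minimizer_subcritical[OF p s(1) that(1) sub[OF that, unfolded \<Lambda>_def] C] by (simp add: real)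
    have part3: "\<not> local_minimizer \<Omega> lam \<phi> s q c (\<lambda>x. 1) \<and>
        (\<exists>\<epsilon>0 < c. \<forall>\<epsilon>. 0 < \<epsilon> \<and> \<epsilon>0 < \<epsilon> \<and> \<epsilon> \<le> c \<longrightarrow> \<not> global_minimizer \<Omega> lam \<phi> s q \<epsilon> (\<lambda>x. 1))"
      if \<psi>: "neumann_eigenfunction \<Omega> (lam 1) \<psi>" "L2_norm \<Omega> \<psi> = 1" and cubic: "(LINT x|M. \<psi> x ^ 3) \<noteq> 0" for \<psi>
    proof
      have "L2_inner \<Omega> \<psi> \<psi> = 1" using L2_norm_square[of \<psi>] \<psi>(2) by simp
      moreover have "0 < c powr (2 * s)" "lam 1 powr s / c powr (2 * s) = p - 2"
        using c \<Lambda> p unfolding c_powr by (simp_all add: \<Lambda>_def)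
      ultimately have better: "\<exists>u\<in>Hs \<Omega> lam \<phi> s. \<not> ae_zero \<Omega> u \<and> Hs_norm \<Omega> lam \<phi> s (\<lambda>x. u x - 1) < \<delta>
        \<and> (L2_inner \<Omega> u u + spectral_form \<Omega> lam \<phi> s u / c powr (2 * s)) powr (p / 2)
          < (LINT x|M. \<bar>u x\<bar> powr p)" if "0 < \<delta>" for \<delta>
        using better_perturbation_critical[OF p s(1) _ _ C(2) \<psi>(1) _ cubic that] by blast
      show "\<not> local_minimizer \<Omega> lam \<phi> s q c (\<lambda>x. 1)"
        using not_local_minimizerI(1)[of s "\<lambda>x. 1" q c] better I_quot_less[OF p c] I_quot_one[OF \<open>2 < q\<close>]
        by (simp add: real) meson
      \<comment> \<open>For global minimality the distance to the constant is irrelevant, so any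
        radius will do. This competitor is kept fixed while the parameter varies.\<close>
      obtain u where u: "u \<in> Hs \<Omega> lam \<phi> s" "\<not> ae_zero \<Omega> u"
        and less: "(L2_inner \<Omega> u u + spectral_form \<Omega> lam \<phi> s u / c powr (2 * s)) powr (p / 2)
          < (LINT x|M. \<bar>u x\<bar> powr p)"
        using better[OF zero_less_one] by blast
      let ?Y = "\<lambda>\<epsilon>. L2_inner \<Omega> u u + spectral_form \<Omega> lam \<phi> s u / \<epsilon> powr (2 * s)"
      \<comment> \<open>The strict inequality at the critical parameter is an open condition,
        because \<open>?Y\<close> is continuous at \<open>c > 0\<close>. Its neighbourhood of radius
        \<open>d\<close> yields the threshold \<open>c - d\<close>.\<close>
      have "((\<lambda>\<epsilon>. ?Y \<epsilon> powr (p / 2)) \<longlongrightarrow> ?Y c powr (p / 2)) (at c)"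
      proof (rule tendsto_powr')
        show "(?Y \<longlongrightarrow> ?Y c) (at c)"
          using c by (intro tendsto_intros) auto
        show "?Y c \<noteq> 0 \<or> 0 < p / 2 \<and> (\<forall>\<^sub>F \<epsilon> in at c. 0 \<le> ?Y \<epsilon>)"
          using p L2_inner_self_nonneg[of u] spectral_form_nonneg[OF u(1)] by simp
      qed simp
      from order_tendstoD(2)[OF this less]
      obtain d where d: "0 < d" "\<And>\<epsilon>. \<epsilon> \<noteq> c \<Longrightarrow> dist \<epsilon> c < d \<Longrightarrow> ?Y \<epsilon> powr (p / 2) < (LINT x|M. \<bar>u x\<bar> powr p)"
        unfolding eventually_at by blast
      have "\<not> global_minimizer \<Omega> lam \<phi> s q \<epsilon> (\<lambda>x. 1)" if "0 < \<epsilon>" "c - d < \<epsilon>" "\<epsilon> \<le> c" for \<epsilon>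
      proof -
        have "?Y \<epsilon> powr (p / 2) < (LINT x|M. \<bar>u x\<bar> powr p)"
          using less d(2)[of \<epsilon>] that by (cases "\<epsilon> = c") (auto simp: dist_real_def)
        then have "I_quot \<Omega> lam \<phi> s q \<epsilon> u < I_quot \<Omega> lam \<phi> s q \<epsilon> (\<lambda>x. 1)"
          using I_quot_less[OF p that(1) u(1)] I_quot_one[OF \<open>2 < q\<close>] by (simp add: real)
        then show ?thesis using u unfolding global_minimizer_def by (meson leD)
      qed
      then show "\<exists>\<epsilon>0 < c. \<forall>\<epsilon>. 0 < \<epsilon> \<and> \<epsilon>0 < \<epsilon> \<and> \<epsilon> \<le> c \<longrightarrow> \<not> global_minimizer \<Omega> lam \<phi> s q \<epsilon> (\<lambda>x. 1)"
        using d(1) by (intro exI[of _ "c - d"]) auto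
    qed
    show ?thesis
      unfolding c_def[symmetric] using part1 part2 part3 by meson
  qed
qed

end
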